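(* Let $\Xi$, $X$, $\mathbf T$, $X_\infty$, $\mathbf T_0$ be as follows: $\Xi$ is a manageable second countable groupoid with unit space $X$; $\mathbf T\subset\mathrm{Cl}(X)$ is a Fell-closed family of tame subsets containing a closed invariant subset $X_\infty$ which is an accumulation point of $\mathbf T$, with $X_\infty\subset M$ for all $M\in\mathbf T_0:=\mathbf T\setminus\{X_\infty\}$. Let $h\in C^*[\Xi]$ be self-adjoint. Then $$\inf_{x\in X_\infty}\inf\mathrm{sp}(\mathsf H^{X_\infty}_x)=\sup_{M\in\mathbf T_0}\Big[\inf_{y\in M}\inf\mathrm{sp}(\mathsf H^M_y)\Big],\qquad \sup_{x\in X_\infty}\sup\mathrm{sp}(\mathsf H^{X_\infty}_x)=\inf_{M\in\mathbf T_0}\Big[\sup_{y\in M}\sup\mathrm{sp}(\mathsf H^M_y)\Big].$$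
   Context: Manageable groupoid: Hausdorff locally compact $\sigma$-compact groupoid with compact unit space $X$, étale and amenable; $C^*[\Xi]$ is its groupoid $C^*$-algebra (full = reduced), built from $C_c(\Xi)$ with $(f\star g)(\xi)=\sum_{\eta\zeta=\xi}f(\eta)g(\zeta)$, $f^\star(\xi)=\overline{f(\xi^{-1})}$; its elements are continuous functions on $\Xi$ vanishing at infinity. For closed $N\subset X$: $\Xi(N)=\{\xi:\mathrm r(\xi),\mathrm d(\xi)\in N\}$; $N$ invariant if $\mathrm d(\xi)\in N\Rightarrow\mathrm r(\xi)\in N$; $N$ tame if $\mathrm d|_{\Xi(N)}:\Xi(N)\to\Xi(N)$ is open (then $\Xi(N)$ is manageable). $\rho_N(h)=h|_{\Xi(N)}\in C^*[\Xi(N)]$. For tame $N$ and $x\in N$ let $\Xi^N_x=\{\xi\in\Xi(N):\mathrm d(\xi)=x\}$ and let $\pi^N_x$ be the regular representation of $C^*[\Xi(N)]$ on $\ell^2(\Xi^N_x)$, given for $f\in C_c(\Xi(N))$ by $(\pi^N_x(f)v)(\xi)=\sum_{\eta\in\Xi^N_x}f(\xi\eta^{-1})v(\eta)$, $\xi\in\Xi^N_x$, and extended by continuity. Set $\mathsf H^N_x:=\pi^N_x(\rho_N(h))\in\mathbb B(\ell^2(\Xi^N_x))$; for $h\in C_c(\Xi)$, $(\mathsf H^N_xv)(\xi)=\sum_{\eta\in\Xi^N_x}h(\xi\eta^{-1})v(\eta)$. Fell topology on the set $\mathrm{Cl}(X)$ of closed subsets: basic open sets $\{A:A\cap K=\emptyset,\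 A\cap\mathcal O\neq\emptyset\ \forall\mathcal O\in\mathfrak O\}$, $K$ compact, $\mathfrak O$ finite family of open sets. *)

theory Defs
  imports "HOL-Analysis.Analysis"
begin

record 'g groupoid =
  gmult :: "'g \<Rightarrow> 'g \<Rightarrow> 'g"
  ginv  :: "'g \<Rightarrow> 'g"
  grng  :: "'g \<Rightarrow> 'g"
  gdom  :: "'g \<Rightarrow> 'g"

definition is_groupoid :: "'g groupoid \<Rightarrow> bool" where
  "is_groupoid G \<longleftrightarrow>
     (\<forall>a. grng G (grng G a) = grng G a \<and> gdom G (grng G a) = grng G a
          \<and> grng G (gdom G a) = gdom G a \<and> gdom G (gdom G a) = gdom G a) \<and>
     (\<forall>a b. gdom G a = grng G b \<longrightarrow>
          grng G (gmult G a b) = grng G a \<and> gdom G (gmult G a b) = gdom G b) \<and>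
     (\<forall>a b c. gdom G a = grng G b \<and> gdom G b = grng G c \<longrightarrow>
          gmult G (gmult G a b) c = gmult G a (gmult G b c)) \<and>
     (\<forall>a. gmult G (grng G a) a = a \<and> gmult G a (gdom G a) = a) \<and>
     (\<forall>a. grng G (ginv G a) = gdom G a \<and> gdom G (ginv G a) = grng G a \<and>
          gmult G a (ginv G a) = grng G a \<and> gmult G (ginv G a) a = gdom G a)"

definition unit_space :: "'g groupoid \<Rightarrow> 'g set" where
  "unit_space G = range (grng G)"

definition Cc_on :: "('g::topological_space) set \<Rightarrow> ('g \<Rightarrow> 'b::real_normed_vector) set" where
  "Cc_on S = {f. continuous_on S f \<and> (\<exists>K. compact K \<and> K \<subseteq> S \<and> (\<forall>a\<in>S - K. f a = 0))}"

definition etale :: "('g::topological_space) groupoid \<Rightarrow> bool" where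
  "etale G \<longleftrightarrow> (\<forall>a. \<exists>U. open U \<and> a \<in> U \<and>
       openin (top_of_set (unit_space G)) (gdom G ` U) \<and>
       homeomorphic_map (top_of_set U) (top_of_set (gdom G ` U)) (gdom G))"

text \<open>Topological amenability of an etale groupoid (approximate invariant
  continuous means, indexed by a sequence).\<close>
definition amenable_etale :: "('g::topological_space) groupoid \<Rightarrow> bool" where
  "amenable_etale G \<longleftrightarrow> (\<exists>f :: nat \<Rightarrow> 'g \<Rightarrow> real.
     (\<forall>n. f n \<in> Cc_on UNIV \<and> (\<forall>a. f n a \<ge> 0)) \<and>
     (\<forall>K. compact K \<and> K \<subseteq> unit_space G \<longrightarrow>
        uniform_limit K (\<lambda>n x. infsum (f n) {a. grng G a = x}) (\<lambda>x. 1) sequentially) \<and>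
     (\<forall>L. compact L \<longrightarrow>
        uniform_limit L (\<lambda>n b. infsum (\<lambda>a. \<bar>f n (gmult G (ginv G b) a) - f n a\<bar>)
                                   {a. grng G a = grng G b}) (\<lambda>b. 0) sequentially))"

definition manageable :: "('g::t2_space) groupoid \<Rightarrow> bool" where
  "manageable G \<longleftrightarrow> is_groupoid G \<and>
     continuous_on {(a,b). gdom G a = grng G b} (\<lambda>(a,b). gmult G a b) \<and>
     continuous_on UNIV (ginv G) \<and>
     continuous_on UNIV (grng G) \<and> continuous_on UNIV (gdom G) \<and>
     locally_compact_space (euclidean :: 'g topology) \<and>
     (\<exists>F. countable F \<and> (\<forall>K\<in>F. compact K) \<and> \<Union>F = (UNIV :: 'g set)) \<and>
     compact (unit_space G) \<and> etale G \<and> amenable_etale G"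

definition XiN :: "'g groupoid \<Rightarrow> 'g set \<Rightarrow> 'g set" where
  "XiN G N = {a. grng G a \<in> N \<and> gdom G a \<in> N}"

definition invariant :: "'g groupoid \<Rightarrow> 'g set \<Rightarrow> bool" where
  "invariant G N \<longleftrightarrow> (\<forall>a. gdom G a \<in> N \<longrightarrow> grng G a \<in> N)"

definition closed_subsets :: "('g::topological_space) groupoid \<Rightarrow> 'g set set" where
  "closed_subsets G = {A. closed A \<and> A \<subseteq> unit_space G}"

definition tame :: "('g::topological_space) groupoid \<Rightarrow> 'g set \<Rightarrow> bool" where
  "tame G N \<longleftrightarrow> N \<in> closed_subsets G \<and>
     open_map (top_of_set (XiN G N)) (top_of_set (XiN G N)) (gdom G)"

definition fiberN :: "'g groupoid \<Rightarrow> 'g set \<Rightarrow> 'g \<Rightarrow> 'g set" where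
  "fiberN G N x = {a \<in> XiN G N. gdom G a = x}"

definition fell_basic :: "('g::topological_space) groupoid \<Rightarrow> 'g set \<Rightarrow> 'g set set \<Rightarrow> 'g set set" where
  "fell_basic G K Us = {A \<in> closed_subsets G. A \<inter> K = {} \<and> (\<forall>U\<in>Us. A \<inter> U \<noteq> {})}"

definition fell_admissible :: "('g::topological_space) groupoid \<Rightarrow> 'g set \<Rightarrow> 'g set set \<Rightarrow> bool" where
  "fell_admissible G K Us \<longleftrightarrow> compact K \<and> K \<subseteq> unit_space G \<and> finite Us \<and>
     (\<forall>U\<in>Us. openin (top_of_set (unit_space G)) U)"

definition fell_open :: "('g::topological_space) groupoid \<Rightarrow> 'g set set \<Rightarrow> bool" where
  "fell_open G S \<longleftrightarrow> S \<subseteq> closed_subsets G \<and>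
     (\<forall>A\<in>S. \<exists>K Us. fell_admissible G K Us \<and> A \<in> fell_basic G K Us \<and> fell_basic G K Us \<subseteq> S)"

definition fell_closed :: "('g::topological_space) groupoid \<Rightarrow> 'g set set \<Rightarrow> bool" where
  "fell_closed G T \<longleftrightarrow> T \<subseteq> closed_subsets G \<and> fell_open G (closed_subsets G - T)"

definition fell_accumulation :: "('g::topological_space) groupoid \<Rightarrow> 'g set set \<Rightarrow> 'g set \<Rightarrow> bool" where
  "fell_accumulation G T A \<longleftrightarrow> A \<in> closed_subsets G \<and>
     (\<forall>S. fell_open G S \<and> A \<in> S \<longrightarrow> (\<exists>M\<in>T. M \<noteq> A \<and> M \<in> S))"

definition l2 :: "'g set \<Rightarrow> ('g \<Rightarrow> complex) set" where
  "l2 S = {v. (\<forall>a. a \<notin> S \<longrightarrow> v a = 0) \<and> (\<lambda>a. (cmod (v a))\<^sup>2) summable_on S}"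

definition l2norm :: "'g set \<Rightarrow> ('g \<Rightarrow> complex) \<Rightarrow> real" where
  "l2norm S v = sqrt (infsum (\<lambda>a. (cmod (v a))\<^sup>2) S)"

definition bdd_op :: "'g set \<Rightarrow> (('g \<Rightarrow> complex) \<Rightarrow> ('g \<Rightarrow> complex)) \<Rightarrow> bool" where
  "bdd_op S T \<longleftrightarrow> (\<forall>v\<in>l2 S. T v \<in> l2 S) \<and>
     (\<forall>u\<in>l2 S. \<forall>v\<in>l2 S. \<forall>c. T (\<lambda>a. u a + c * v a) = (\<lambda>a. T u a + c * T v a)) \<and>
     (\<exists>C. \<forall>v\<in>l2 S. l2norm S (T v) \<le> C * l2norm S v)"

definition opnorm :: "'g set \<Rightarrow> (('g \<Rightarrow> complex) \<Rightarrow> ('g \<Rightarrow> complex)) \<Rightarrow> real" where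
  "opnorm S T = Sup {l2norm S (T v) | v. v \<in> l2 S \<and> l2norm S v \<le> 1}"

definition spec :: "'g set \<Rightarrow> (('g \<Rightarrow> complex) \<Rightarrow> ('g \<Rightarrow> complex)) \<Rightarrow> complex set" where
  "spec S T = {l. \<not> (\<exists>U. bdd_op S U \<and>
       (\<forall>v\<in>l2 S. U (\<lambda>a. T v a - l * v a) = v) \<and>
       (\<forall>v\<in>l2 S. (\<lambda>a. T (U v) a - l * U v a) = v))}"

definition inf_sp :: "'g set \<Rightarrow> (('g \<Rightarrow> complex) \<Rightarrow> ('g \<Rightarrow> complex)) \<Rightarrow> real" where
  "inf_sp S T = Inf (Re ` spec S T)"

definition sup_sp :: "'g set \<Rightarrow> (('g \<Rightarrow> complex) \<Rightarrow> ('g \<Rightarrow> complex)) \<Rightarrow> real" where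
  "sup_sp S T = Sup (Re ` spec S T)"

definition reg_rep :: "'g groupoid \<Rightarrow> 'g set \<Rightarrow> 'g \<Rightarrow> ('g \<Rightarrow> complex)
                        \<Rightarrow> ('g \<Rightarrow> complex) \<Rightarrow> ('g \<Rightarrow> complex)" where
  "reg_rep G N x f v = (\<lambda>a. if a \<in> fiberN G N x
       then infsum (\<lambda>b. f (gmult G a (ginv G b)) * v b) (fiberN G N x) else 0)"

text \<open>Reduced C*-norm on C_c(Xi(N)) (full = reduced by amenability).\<close>
definition red_norm :: "'g groupoid \<Rightarrow> 'g set \<Rightarrow> ('g \<Rightarrow> complex) \<Rightarrow> real" where
  "red_norm G N f = Sup {opnorm (fiberN G N x) (reg_rep G N x f) | x. x \<in> N}"

text \<open>C*[Xi], realised as continuous functions on Xi: limits of C*-Cauchy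
  sequences from C_c(Xi).\<close>
definition Cstar :: "('g::topological_space) groupoid \<Rightarrow> ('g \<Rightarrow> complex) set" where
  "Cstar G = {h. \<exists>f. (\<forall>n. f n \<in> Cc_on UNIV) \<and>
     (\<forall>e>0. \<exists>n0. \<forall>m\<ge>n0. \<forall>n\<ge>n0. red_norm G (unit_space G) (\<lambda>a. f m a - f n a) < e) \<and>
     (\<forall>a. (\<lambda>n. f n a) \<longlonglongrightarrow> h a)}"

definition self_adjoint :: "('g::topological_space) groupoid \<Rightarrow> ('g \<Rightarrow> complex) \<Rightarrow> bool" where
  "self_adjoint G h \<longleftrightarrow> h \<in> Cstar G \<and> (\<forall>a. h a = cnj (h (ginv G a)))"

text \<open>H^N_x = pi^N_x(rho_N(h)): the bounded operator on l^2(Xi^N_x) obtained as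
  the norm limit of pi^N_x(g_n), g_n in C_c(Xi(N)) converging to h on Xi(N)
  (extension by continuity).  Operators are normalised to vanish off l^2.\<close>
definition Hop :: "('g::topological_space) groupoid \<Rightarrow> 'g set \<Rightarrow> ('g \<Rightarrow> complex) \<Rightarrow> 'g
                   \<Rightarrow> ('g \<Rightarrow> complex) \<Rightarrow> ('g \<Rightarrow> complex)" where
  "Hop G N h x = (THE T. bdd_op (fiberN G N x) T \<and>
      (\<forall>v. v \<notin> l2 (fiberN G N x) \<longrightarrow> T v = (\<lambda>a. 0)) \<and>
      (\<exists>g. (\<forall>n. g n \<in> Cc_on (XiN G N)) \<and>
           (\<forall>a\<in>XiN G N. (\<lambda>n. g n a) \<longlonglongrightarrow> h a) \<and>
           (\<lambda>n. opnorm (fiberN G N x) (\<lambda>v a. reg_rep G N x (g n) v a - T v a)) \<longlonglongrightarrow> 0))"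

end

theory Submission
  imports Defs
begin

text \<open>
  The operator \<open>H\<^sup>N\<^sub>x\<close> has matrix entries \<open>h (a b\<^sup>-\<^sup>1)\<close>, so it is the compression of
  \<open>H\<^sup>X\<^sub>x\<close> to \<open>\<ell>\<^sup>2(\<Xi>\<^sup>N\<^sub>x)\<close>, and the infimum of its spectrum is the largest lower bound
  of the form \<open>\<Sum> cnj (v a) h (a b\<^sup>-\<^sup>1) v b\<close> over finitely supported \<open>v\<close>. Enlarging the set therefore
  lowers the infimum, which gives one inequality.

  For the other one, approximate \<open>h\<close> by compactly supported \<open>f\<close>. Amenability localises: if \<open>\<phi>\<close> is an
  approximately invariant mean supported in the compact set \<open>K\<close>, the cut-offs
  \<open>v\<^sub>\<zeta> (\<xi>) = sqrt (\<phi> (\<xi> \<zeta>\<^sup>-\<^sup>1)) v (\<xi>)\<close> satisfy \<open>\<Sum> \<parallel>v\<^sub>\<zeta>\<parallel>\<^sup>2 \<approx> \<parallel>v\<parallel>\<^sup>2\<close> and their forms add up to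
  approximately the form of \<open>v\<close>; after a right translation each of them lives on \<open>K\<close>. Forms of vectors
  supported on \<open>K\<close> involve boundedly many points, so by compactness a lower bound valid over \<open>X\<^sub>\<infinity>\<close>
  persists up to \<open>\<epsilon>\<close> on a neighbourhood of \<open>X\<^sub>\<infinity>\<close>, and some \<open>M \<noteq> X\<^sub>\<infinity>\<close> lies in it.
\<close>

section \<open>Square-summable functions as a Hilbert space\<close>

text \<open>Right translation by \<open>ginv G z\<close> carries a cut-off from the fibre of
  \<open>x\<close> to the fibre of \<open>r z\<close>, and \<open>r z\<close> may lie outside
  \<open>M\<close>. Only the ranges survive, since \<open>r (quot a z) = r a\<close>; this is why
  the local hypotheses restrict the ranges of the support and never the base point of its fibre.
  Invariance of \<open>Xinf\<close> makes up for the loss: when ranges converge into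
  \<open>Xinf\<close>, the limit points also have their common domain in \<open>Xinf\<close>. The
  order of choices matters as well. The compact set of the localisation depends on the approximant,
  the constant and the tolerance, but not on \<open>M\<close>, so it is available before a
  neighbourhood of \<open>Xinf\<close> is chosen for it. Everything is phrased as "c is a lower
  bound of the form on finitely supported vectors". Such statements compare operators acting on
  different fibres, for which spectra have no direct relation. Upper bounds are treated as lower
  bounds for \<open>- h\<close>.\<close>

typedef 'a ell2 = "l2 (UNIV :: 'a set)"
  morphisms ell2_fun Abs_ell2
  by (rule exI[of _ "\<lambda>_. 0"]) (simp add: l2_def)

setup_lifting type_definition_ell2

lemma l2_UNIV_iff: "v \<in> l2 UNIV \<longleftrightarrow> (\<lambda>a. (cmod (v a))\<^sup>2) summable_on UNIV"
  by (simp add: l2_def)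

lemma summable_ell2: "(\<lambda>a. (cmod (ell2_fun x a))\<^sup>2) summable_on UNIV"
  using ell2_fun[of x] by (simp add: l2_UNIV_iff)

lemma l2_UNIV_add:
  assumes "u \<in> l2 UNIV" "v \<in> l2 UNIV"
  shows "(\<lambda>a. u a + v a) \<in> l2 UNIV"
proof -
  have "(\<lambda>a. 2 * (cmod (u a))\<^sup>2 + 2 * (cmod (v a))\<^sup>2) summable_on UNIV"
    using assms by (intro summable_on_add summable_on_cmult_right) (auto simp: l2_UNIV_iff)
  moreover have "(cmod (u a + v a))\<^sup>2 \<le> 2 * (cmod (u a))\<^sup>2 + 2 * (cmod (v a))\<^sup>2" for a
  proof -
    have "(cmod (u a + v a))\<^sup>2 \<le> (cmod (u a) + cmod (v a))\<^sup>2"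
      by (simp add: norm_triangle_ineq power_mono)
    also have "\<dots> \<le> 2 * (cmod (u a))\<^sup>2 + 2 * (cmod (v a))\<^sup>2"
      using sum_squares_bound[of "cmod (u a)" "cmod (v a)"] by (simp add: power2_sum)
    finally show ?thesis .
  qed
  ultimately show ?thesis
    unfolding l2_UNIV_iff by (rule summable_on_comparison_test) auto
qed

lemma l2_UNIV_mult:
  assumes "v \<in> l2 UNIV"
  shows "(\<lambda>a. c * v a) \<in> l2 UNIV"
  using assms unfolding l2_UNIV_iff norm_mult power_mult_distrib
  by (rule summable_on_cmult_right)

lemma summable_on_inner_l2:
  assumes "u \<in> l2 UNIV" "v \<in> l2 UNIV"
  shows "(\<lambda>a. u a \<bullet> v a) summable_on UNIV"
proof -
  have "(\<lambda>a. (cmod (u a))\<^sup>2 + (cmod (v a))\<^sup>2) summable_on UNIV"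
    using assms by (intro summable_on_add) (auto simp: l2_UNIV_iff)
  moreover have "\<bar>u a \<bullet> v a\<bar> \<le> (cmod (u a))\<^sup>2 + (cmod (v a))\<^sup>2" for a
  proof -
    have "\<bar>u a \<bullet> v a\<bar> \<le> cmod (u a) * cmod (v a)"
      by (rule Cauchy_Schwarz_ineq2)
    also have "\<dots> \<le> (cmod (u a))\<^sup>2 + (cmod (v a))\<^sup>2"
      using sum_squares_bound[of "cmod (u a)" "cmod (v a)"]
        mult_nonneg_nonneg[OF norm_ge_zero norm_ge_zero, of "u a" "v a"] by linarith
    finally show ?thesis .
  qed
  ultimately have "(\<lambda>a. \<bar>u a \<bullet> v a\<bar>) summable_on UNIV"
    by (rule summable_on_comparison_test) auto
  then show ?thesis
    using abs_summable_summable[of "\<lambda>a. u a \<bullet> v a" UNIV] by simp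
qed

instantiation ell2 :: (type) real_vector
begin

lift_definition zero_ell2 :: "'a ell2" is "\<lambda>_. 0"
  by (simp add: l2_UNIV_iff)

lift_definition plus_ell2 :: "'a ell2 \<Rightarrow> 'a ell2 \<Rightarrow> 'a ell2" is "\<lambda>u v a. u a + v a"
  by (rule l2_UNIV_add)

lift_definition uminus_ell2 :: "'a ell2 \<Rightarrow> 'a ell2" is "\<lambda>u a. - u a"
  by (simp add: l2_UNIV_iff)

lift_definition minus_ell2 :: "'a ell2 \<Rightarrow> 'a ell2 \<Rightarrow> 'a ell2" is "\<lambda>u v a. u a - v a"
proof -
  fix u v :: "'a \<Rightarrow> complex"
  assume "u \<in> l2 UNIV" "v \<in> l2 UNIV"
  with l2_UNIV_add[OF this(1) l2_UNIV_mult[OF this(2), of "-1"]]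
  show "(\<lambda>a. u a - v a) \<in> l2 UNIV" by simp
qed

lift_definition scaleR_ell2 :: "real \<Rightarrow> 'a ell2 \<Rightarrow> 'a ell2" is "\<lambda>r u a. r *\<^sub>R u a"
  by (simp add: scaleR_conv_of_real l2_UNIV_mult)

instance
  by standard (transfer; simp add: fun_eq_iff algebra_simps)+

end

instantiation ell2 :: (type) real_inner
begin

text \<open>This is the real part of the complex inner product. Coercivity, positivity and symmetry
  are all tested on it; complex scalars act separately through \<open>cmult_ell2\<close>.\<close>

definition inner_ell2 :: "'a ell2 \<Rightarrow> 'a ell2 \<Rightarrow> real" where
  "inner_ell2 x y = (\<Sum>\<^sub>\<infinity>a. ell2_fun x a \<bullet> ell2_fun y a)"

definition norm_ell2 :: "'a ell2 \<Rightarrow> real" where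
  "norm_ell2 x = sqrt (inner x x)"

definition dist_ell2 :: "'a ell2 \<Rightarrow> 'a ell2 \<Rightarrow> real" where
  "dist_ell2 x y = norm (x - y)"

definition sgn_ell2 :: "'a ell2 \<Rightarrow> 'a ell2" where
  "sgn_ell2 x = x /\<^sub>R norm x"

definition uniformity_ell2 :: "('a ell2 \<times> 'a ell2) filter" where
  "uniformity_ell2 = (INF e\<in>{0 <..}. principal {(x, y). dist x y < e})"

definition open_ell2 :: "'a ell2 set \<Rightarrow> bool" where
  "open_ell2 U \<longleftrightarrow> (\<forall>x\<in>U. eventually (\<lambda>(x', y). x' = x \<longrightarrow> y \<in> U) uniformity)"

instance
proof
  fix x y z :: "'a ell2" and r :: real
  note s = summable_on_inner_l2[OF ell2_fun ell2_fun]
  show "inner x y = inner y x"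
    by (simp add: inner_ell2_def inner_commute)
  show "inner (x + y) z = inner x z + inner y z"
    by (simp add: inner_ell2_def plus_ell2.rep_eq inner_add_left infsum_add s)
  show "inner (r *\<^sub>R x) y = r * inner x y"
    by (simp add: inner_ell2_def scaleR_ell2.rep_eq infsum_cmult_right' del: inner_complex_def)
  show "0 \<le> inner x x"
    by (simp add: inner_ell2_def infsum_nonneg)
  show "inner x x = 0 \<longleftrightarrow> x = 0"
  proof
    assume "inner x x = 0"
    then have "ell2_fun x a = 0" for a
      using nonneg_infsum_le_0D[OF _ s, of x x a] by (simp add: inner_ell2_def)
    then show "x = 0"
      by (simp add: ell2_fun_inject[symmetric] zero_ell2.rep_eq fun_eq_iff)
  qed (simp add: inner_ell2_def zero_ell2.rep_eq)
qed (simp_all add: norm_ell2_def dist_ell2_def sgn_ell2_def uniformity_ell2_def open_ell2_def)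

end

lemma norm_ell2_eq: "norm x = l2norm UNIV (ell2_fun x)"
  unfolding norm_ell2_def inner_ell2_def l2norm_def by (simp add: dot_square_norm)

lemma norm_ell2_power2: "(norm x)\<^sup>2 = (\<Sum>\<^sub>\<infinity>a. (cmod (ell2_fun x a))\<^sup>2)"
  by (simp add: norm_ell2_eq l2norm_def infsum_nonneg)

lemma sum_le_norm_ell2:
  assumes "finite F"
  shows "(\<Sum>a\<in>F. (cmod (ell2_fun x a))\<^sup>2) \<le> (norm x)\<^sup>2"
  unfolding norm_ell2_power2 by (rule finite_sum_le_infsum[OF summable_ell2]) (use assms in auto)

lemma coord_le_norm_ell2: "cmod (ell2_fun x a) \<le> norm x"
  by (rule power2_le_imp_le) (use sum_le_norm_ell2[of "{a}" x] in simp_all)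

lemma l2_UNIV_I:
  assumes "\<And>F. finite F \<Longrightarrow> (\<Sum>a\<in>F. (cmod (v a))\<^sup>2) \<le> B"
  shows "v \<in> l2 UNIV"
  unfolding l2_UNIV_iff
  by (rule nonneg_bdd_above_summable_on) (use assms in \<open>auto simp: bdd_above_def\<close>)

lemma norm_ell2_le:
  assumes "\<And>F. finite F \<Longrightarrow> (\<Sum>a\<in>F. (cmod (ell2_fun x a))\<^sup>2) \<le> B\<^sup>2" "0 \<le> B"
  shows "norm x \<le> B"
proof -
  have "(norm x)\<^sup>2 \<le> B\<^sup>2"
    unfolding norm_ell2_power2 by (rule infsum_le_finite_sums[OF summable_ell2]) (use assms in auto)
  then show ?thesis using assms(2) by (rule power2_le_imp_le)
qed

text \<open>A Fatou argument: on each finite set of coordinates the bound \<open>e\<close> passes to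
  the limit in \<open>m\<close>, and the norm is controlled by such finite sums. For a Cauchy
  sequence it turns the coordinatewise limit into the norm limit.\<close>

lemma ell2_pointwise_limit:
  fixes X :: "nat \<Rightarrow> 'a ell2"
  assumes lim: "\<And>a. (\<lambda>n. ell2_fun (X n) a) \<longlonglongrightarrow> v a"
    and bd: "\<And>m. m \<ge> n \<Longrightarrow> norm (X m - X n) \<le> e"
  shows "v \<in> l2 UNIV" "norm (X n - Abs_ell2 v) \<le> e"
proof -
  have e: "0 \<le> e" using bd[of n] by simp
  have *: "(\<Sum>a\<in>F. (cmod (v a - ell2_fun (X n) a))\<^sup>2) \<le> e\<^sup>2" if "finite F" for F
  proof (rule LIMSEQ_le_const2)
    show "(\<lambda>m. \<Sum>a\<in>F. (cmod (ell2_fun (X m) a - ell2_fun (X n) a))\<^sup>2)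
        \<longlonglongrightarrow> (\<Sum>a\<in>F. (cmod (v a - ell2_fun (X n) a))\<^sup>2)"
      by (intro tendsto_intros lim)
    have "(\<Sum>a\<in>F. (cmod (ell2_fun (X m) a - ell2_fun (X n) a))\<^sup>2) \<le> e\<^sup>2" if "m \<ge> n" for m
      using sum_le_norm_ell2[OF \<open>finite F\<close>, of "X m - X n"] bd[OF that]
        power_mono[OF bd[OF that], of 2]
      by (simp add: minus_ell2.rep_eq)
    then show "\<exists>N. \<forall>m\<ge>N. (\<Sum>a\<in>F. (cmod (ell2_fun (X m) a - ell2_fun (X n) a))\<^sup>2) \<le> e\<^sup>2" by blast
  qed
  have "(\<lambda>a. v a - ell2_fun (X n) a) \<in> l2 UNIV"
    by (rule l2_UNIV_I[OF *])
  from l2_UNIV_add[OF this ell2_fun[of "X n"]] show v: "v \<in> l2 UNIV" by simp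
  show "norm (X n - Abs_ell2 v) \<le> e"
    by (rule norm_ell2_le)
       (use * e v in \<open>simp_all add: minus_ell2.rep_eq Abs_ell2_inverse norm_minus_commute\<close>)
qed

instance ell2 :: (type) complete_space
proof
  fix X :: "nat \<Rightarrow> 'a ell2"
  assume C: "Cauchy X"
  have "Cauchy (\<lambda>n. ell2_fun (X n) a)" for a
  proof (rule CauchyI)
    fix e :: real assume "e > 0"
    then obtain N where N: "\<forall>m\<ge>N. \<forall>n\<ge>N. norm (X m - X n) < e"
      using CauchyD[OF C] by blast
    have "cmod (ell2_fun (X m) a - ell2_fun (X n) a) \<le> norm (X m - X n)" for m n
      using coord_le_norm_ell2[of "X m - X n" a] by (simp add: minus_ell2.rep_eq)
    then show "\<exists>N. \<forall>m\<ge>N. \<forall>n\<ge>N. cmod (ell2_fun (X m) a - ell2_fun (X n) a) < e"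
      using N by (meson le_less_trans)
  qed
  then obtain v where v: "\<And>a. (\<lambda>n. ell2_fun (X n) a) \<longlonglongrightarrow> v a"
    unfolding Cauchy_convergent_iff convergent_def by metis
  have "X \<longlonglongrightarrow> Abs_ell2 v"
  proof (rule LIMSEQ_I)
    fix e :: real assume "e > 0"
    then obtain N where N: "\<forall>m\<ge>N. \<forall>n\<ge>N. norm (X m - X n) < e / 2"
      using CauchyD[OF C, of "e / 2"] by auto
    have "norm (X n - Abs_ell2 v) \<le> e / 2" if "n \<ge> N" for n
      by (rule ell2_pointwise_limit(2)[OF v]) (use N that in \<open>simp add: less_imp_le\<close>)
    then show "\<exists>no. \<forall>n\<ge>no. norm (X n - Abs_ell2 v) < e"
      using \<open>e > 0\<close> by (intro exI[of _ N]) force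
  qed
  then show "convergent X" by (rule convergentI)
qed

section \<open>Coercive and positive operators on a real Hilbert space\<close>

text \<open>The map \<open>x \<mapsto> x - t (A x - y)\<close> is a contraction for \<open>t = c / D\<^sup>2\<close>.\<close>

lemma coercive_surjective:
  fixes A :: "'h::{real_inner, complete_space} \<Rightarrow> 'h"
  assumes V: "subspace V" "closed V" and maps: "\<And>x. x \<in> V \<Longrightarrow> A x \<in> V"
    and diff: "\<And>x y. x \<in> V \<Longrightarrow> y \<in> V \<Longrightarrow> A (x - y) = A x - A y"
    and bound: "\<And>x. x \<in> V \<Longrightarrow> norm (A x) \<le> C * norm x"
    and c: "0 < c" and coercive: "\<And>x. x \<in> V \<Longrightarrow> c * (norm x)\<^sup>2 \<le> x \<bullet> A x"
    and y: "y \<in> V"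
  shows "\<exists>x\<in>V. A x = y"
proof -
  \<comment> \<open>With \<open>D \<ge> c\<close> the quotient \<open>c\<^sup>2 / D\<^sup>2\<close>
    is at most 1, so the contraction factor \<open>q\<close> below is the root of a nonnegative
    number; \<open>c > 0\<close> makes it less than 1.\<close>
  define D where "D = max C c"
  have D: "D > 0" "c \<le> D" using c by (auto simp: D_def)
  have boundD: "norm (A x) \<le> D * norm x" if "x \<in> V" for x
    using bound[OF that] mult_right_mono[of C D "norm x"] by (simp add: D_def)
  define t where "t = c / D\<^sup>2"
  have t: "t > 0" using c D by (simp add: t_def)
  define q where "q = sqrt (1 - c\<^sup>2 / D\<^sup>2)"
  have cD: "c\<^sup>2 / D\<^sup>2 \<le> 1" using D c by (simp add: divide_simps power_mono)
  have q: "0 \<le> q" "q < 1"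
    unfolding q_def using cD c D by auto
  have contr: "norm (x - t *\<^sub>R A x) \<le> q * norm x" if "x \<in> V" for x
  proof (rule power2_le_imp_le)
    have "(norm (x - t *\<^sub>R A x))\<^sup>2 = (norm x)\<^sup>2 - 2 * t * (x \<bullet> A x) + t\<^sup>2 * (norm (A x))\<^sup>2"
      unfolding power2_norm_eq_inner by (simp add: inner_diff_left inner_diff_right power2_eq_square inner_commute[of "A x" x] algebra_simps)
    also have "\<dots> \<le> (norm x)\<^sup>2 - 2 * t * (c * (norm x)\<^sup>2) + t\<^sup>2 * (D * norm x)\<^sup>2"
      using coercive[OF that] boundD[OF that] t
      by (intro add_mono diff_mono mult_left_mono power_mono) auto
    also have "\<dots> = (1 - c\<^sup>2 / D\<^sup>2) * (norm x)\<^sup>2"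
      unfolding t_def using D(1) by (simp add: power_mult_distrib power_divide field_simps) (simp add: power2_eq_square algebra_simps)
    also have "\<dots> = (q * norm x)\<^sup>2"
      using cD by (simp add: q_def power_mult_distrib)
    finally show "(norm (x - t *\<^sub>R A x))\<^sup>2 \<le> (q * norm x)\<^sup>2" .
  qed (use q in simp)
  have "\<exists>!x\<in>V. x - t *\<^sub>R (A x - y) = x"
  proof (rule Banach_fix[of V q])
    show "complete V" using V(2) by (simp add: complete_eq_closed)
    show "V \<noteq> {}" using y by auto
    show "(\<lambda>x. x - t *\<^sub>R (A x - y)) ` V \<subseteq> V"
      using V(1) maps y by (auto intro!: subspace_diff subspace_scale)
    show "dist (x - t *\<^sub>R (A x - y)) (z - t *\<^sub>R (A z - y)) \<le> q * dist x z"
      if "x \<in> V" "z \<in> V" for x z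
    proof -
      have eq: "x - t *\<^sub>R (A x - y) - (z - t *\<^sub>R (A z - y)) = (x - z) - t *\<^sub>R A (x - z)"
        unfolding diff[OF that] by (simp add: algebra_simps)
      show ?thesis
        unfolding dist_norm eq by (rule contr[OF subspace_diff[OF V(1) that]])
    qed
  qed (use q in auto)
  then obtain x where "x \<in> V" "t *\<^sub>R (A x - y) = 0" by auto
  then show ?thesis using t by auto
qed

text \<open>Does the work of a square root of a positive operator: where the form is small,
  \<open>A x\<close> is small. Read backwards, a lower bound for \<open>norm (A x)\<close>, such as
  an inverse provides, becomes a lower bound for the form.\<close>

lemma norm_le_positive_form:
  fixes A :: "'h::real_inner \<Rightarrow> 'h"
  assumes V: "subspace V" and maps: "\<And>x. x \<in> V \<Longrightarrow> A x \<in> V"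
    and lin: "\<And>x y r. x \<in> V \<Longrightarrow> y \<in> V \<Longrightarrow> A (x - r *\<^sub>R y) = A x - r *\<^sub>R A y"
    and bound: "\<And>x. x \<in> V \<Longrightarrow> norm (A x) \<le> C * norm x" and C: "C > 0"
    and sym: "\<And>x y. x \<in> V \<Longrightarrow> y \<in> V \<Longrightarrow> x \<bullet> A y = A x \<bullet> y"
    and pos: "\<And>x. x \<in> V \<Longrightarrow> 0 \<le> x \<bullet> A x"
    and x: "x \<in> V"
  shows "(norm (A x))\<^sup>2 \<le> C * (x \<bullet> A x)"
proof -
  define y where "y = A x"
  have y: "y \<in> V" using maps x by (simp add: y_def)
  have "y \<bullet> A y \<le> norm y * (C * norm y)"
    using norm_cauchy_schwarz[of y "A y"] mult_left_mono[OF bound[OF y] norm_ge_zero[of y]] by linarith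
  then have yAy: "y \<bullet> A y \<le> C * (norm y)\<^sup>2" by (simp add: power2_eq_square mult.left_commute)
  \<comment> \<open>positivity of the form at \<open>x - A x / C\<close>\<close>
  have "0 \<le> (x - (1/C) *\<^sub>R y) \<bullet> A (x - (1/C) *\<^sub>R y)"
    by (rule pos) (use V x y in \<open>simp add: subspace_diff subspace_scale\<close>)
  also have "\<dots> = x \<bullet> A x - (2/C) * (norm y)\<^sup>2 + (1/C)\<^sup>2 * (y \<bullet> A y)"
    using sym[OF x y] by (simp add: lin[OF x y] y_def[symmetric] inner_diff_left inner_diff_right
        power2_norm_eq_inner[symmetric] dot_square_norm power2_eq_square inner_commute)
  also have "\<dots> \<le> x \<bullet> A x - (2/C) * (norm y)\<^sup>2 + (1/C)\<^sup>2 * (C * (norm y)\<^sup>2)"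
    using yAy by (intro add_left_mono mult_left_mono) auto
  also have "\<dots> = x \<bullet> A x - (norm y)\<^sup>2 / C"
    using C by (simp add: power2_eq_square field_simps)
  finally show ?thesis using C by (simp add: y_def field_simps)
qed

section \<open>Spectra of symmetric operators\<close>

lemma l2_iff: "v \<in> l2 S \<longleftrightarrow> v \<in> l2 UNIV \<and> (\<forall>a. a \<notin> S \<longrightarrow> v a = 0)"
proof -
  have "(\<lambda>a. (cmod (v a))\<^sup>2) summable_on S \<longleftrightarrow> (\<lambda>a. (cmod (v a))\<^sup>2) summable_on UNIV"
    if "\<forall>a. a \<notin> S \<longrightarrow> v a = 0"
    by (rule summable_on_cong_neutral) (use that in auto)
  then show ?thesis by (auto simp: l2_def)
qed

lemma l2norm_eq_norm:
  assumes "v \<in> l2 S"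
  shows "l2norm S v = norm (Abs_ell2 v)"
proof -
  have v: "v \<in> l2 UNIV" "\<forall>a. a \<notin> S \<longrightarrow> v a = 0" using assms by (auto simp: l2_iff[of v S])
  have "(\<Sum>\<^sub>\<infinity>a\<in>S. (cmod (v a))\<^sup>2) = (\<Sum>\<^sub>\<infinity>a. (cmod (v a))\<^sup>2)"
    by (rule infsum_cong_neutral) (use v in auto)
  then show ?thesis using v(1) by (simp add: norm_ell2_eq l2norm_def Abs_ell2_inverse)
qed

text \<open>A type cannot depend on the set \<open>S\<close>, so a single Hilbert space over the
  whole index type is used and each \<open>l2 S\<close> becomes a closed subspace of it. Operators
  on different fibres thereby share one ambient space.\<close>

definition ell2_on :: "'a set \<Rightarrow> 'a ell2 set" where
  "ell2_on S = {x. \<forall>a. a \<notin> S \<longrightarrow> ell2_fun x a = 0}"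

lemma ell2_on_iff: "x \<in> ell2_on S \<longleftrightarrow> ell2_fun x \<in> l2 S"
  using ell2_fun[of x] l2_iff[of "ell2_fun x" S] by (auto simp: ell2_on_def)

lemma Abs_ell2_l2:
  assumes "v \<in> l2 S"
  shows "Abs_ell2 v \<in> ell2_on S" "ell2_fun (Abs_ell2 v) = v"
  using assms l2_iff[of v S] by (auto simp: ell2_on_def Abs_ell2_inverse)

lemma subspace_ell2_on: "subspace (ell2_on S)"
  by (auto simp: subspace_def ell2_on_def plus_ell2.rep_eq zero_ell2.rep_eq scaleR_ell2.rep_eq)

lemma tendsto_ell2_fun:
  assumes "X \<longlonglongrightarrow> x"
  shows "(\<lambda>n. ell2_fun (X n) a) \<longlonglongrightarrow> ell2_fun x a"
proof -
  have "(\<lambda>n. norm (X n - x)) \<longlonglongrightarrow> 0"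
    using assms by (simp add: LIM_zero tendsto_norm_zero)
  then have "(\<lambda>n. ell2_fun (X n) a - ell2_fun x a) \<longlonglongrightarrow> 0"
    by (rule Lim_null_comparison[rotated])
       (use coord_le_norm_ell2[of "X _ - x" a] in \<open>simp add: minus_ell2.rep_eq\<close>)
  then show ?thesis by (rule LIM_zero_cancel)
qed

lemma closed_ell2_on: "closed (ell2_on S)"
  unfolding closed_sequential_limits
proof (intro allI impI)
  fix X and x :: "'a ell2"
  assume X: "(\<forall>n. X n \<in> ell2_on S) \<and> X \<longlonglongrightarrow> x"
  have "ell2_fun x a = 0" if "a \<notin> S" for a
    using tendsto_ell2_fun[of X x a] X that LIMSEQ_unique[OF tendsto_const[of 0]] by (auto simp: ell2_on_def)
  then show "x \<in> ell2_on S" by (simp add: ell2_on_def)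
qed

lift_definition cmult_ell2 :: "complex \<Rightarrow> 'a ell2 \<Rightarrow> 'a ell2" is "\<lambda>c v a. c * v a"
  by (rule l2_UNIV_mult)

lemma cmult_ell2_on: "x \<in> ell2_on S \<Longrightarrow> cmult_ell2 c x \<in> ell2_on S"
  by (simp add: ell2_on_def cmult_ell2.rep_eq)

lemma norm_cmult_ell2: "norm (cmult_ell2 c x) = cmod c * norm x"
  unfolding norm_ell2_eq l2norm_def cmult_ell2.rep_eq norm_mult power_mult_distrib
  by (simp add: infsum_cmult_right' real_sqrt_mult)

lemma inner_cmult_ell2: "x \<bullet> cmult_ell2 c x = Re c * (norm x)\<^sup>2"
proof -
  have "z \<bullet> (c * z) = Re c * (cmod z)\<^sup>2" for z
    unfolding cmod_power2 by (simp add: inner_complex_def algebra_simps power2_eq_square)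
  then show ?thesis
    unfolding norm_ell2_power2 inner_ell2_def cmult_ell2.rep_eq by (simp add: infsum_cmult_right')
qed

lemma cmult_ell2_of_real: "cmult_ell2 (of_real r) x = r *\<^sub>R x"
  by transfer (simp add: scaleR_conv_of_real)

lemma cmult_ell2_simps:
  "cmult_ell2 c (x + y) = cmult_ell2 c x + cmult_ell2 c y"
  "cmult_ell2 c (x - y) = cmult_ell2 c x - cmult_ell2 c y"
  "cmult_ell2 c (cmult_ell2 d x) = cmult_ell2 d (cmult_ell2 c x)"
  by (transfer; simp add: fun_eq_iff algebra_simps)+

definition ell2_op :: "(('a \<Rightarrow> complex) \<Rightarrow> ('a \<Rightarrow> complex)) \<Rightarrow> 'a ell2 \<Rightarrow> 'a ell2" where
  "ell2_op T x = Abs_ell2 (T (ell2_fun x))"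

lemma ell2_fun_op:
  assumes "bdd_op S T" "x \<in> ell2_on S"
  shows "ell2_fun (ell2_op T x) = T (ell2_fun x)"
  using assms Abs_ell2_l2(2)[of "T (ell2_fun x)" S] by (simp add: ell2_op_def bdd_op_def ell2_on_iff)

lemma ell2_op_on:
  assumes "bdd_op S T" "x \<in> ell2_on S"
  shows "ell2_op T x \<in> ell2_on S"
  using assms Abs_ell2_l2(1)[of "T (ell2_fun x)" S] by (simp add: ell2_op_def bdd_op_def ell2_on_iff)

lemma ell2_op_linear:
  assumes T: "bdd_op S T" and x: "x \<in> ell2_on S" and y: "y \<in> ell2_on S"
  shows "ell2_op T (x + cmult_ell2 c y) = ell2_op T x + cmult_ell2 c (ell2_op T y)"
proof -
  have "x + cmult_ell2 c y \<in> ell2_on S"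
    using x y by (intro subspace_add[OF subspace_ell2_on] cmult_ell2_on)
  then show ?thesis
    using assms ell2_fun_inject[symmetric]
    by (simp add: ell2_fun_op[OF T] ell2_fun_inject[symmetric] plus_ell2.rep_eq cmult_ell2.rep_eq
        bdd_op_def ell2_on_iff)
qed

lemma ell2_op_diff:
  assumes "bdd_op S T" "x \<in> ell2_on S" "y \<in> ell2_on S"
  shows "ell2_op T (x - r *\<^sub>R y) = ell2_op T x - r *\<^sub>R ell2_op T y"
    "ell2_op T (x - y) = ell2_op T x - ell2_op T y"
  using ell2_op_linear[OF assms, of "of_real (- r)"] ell2_op_linear[OF assms, of "of_real (- 1)"]
  unfolding cmult_ell2_of_real by simp_all

lemma ell2_op_bounded:
  assumes "bdd_op S T"
  obtains C where "C > 0" "\<And>x. x \<in> ell2_on S \<Longrightarrow> norm (ell2_op T x) \<le> C * norm x"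
proof -
  obtain C where C: "\<forall>v\<in>l2 S. l2norm S (T v) \<le> C * l2norm S v"
    using assms by (auto simp: bdd_op_def)
  have "norm (ell2_op T x) \<le> max C 1 * norm x" if "x \<in> ell2_on S" for x
  proof -
    have v: "ell2_fun x \<in> l2 S" using that by (simp add: ell2_on_iff)
    then have "T (ell2_fun x) \<in> l2 S" using assms by (simp add: bdd_op_def)
    from l2norm_eq_norm[OF this] l2norm_eq_norm[OF v] C v
    have "norm (ell2_op T x) \<le> C * norm x" by (auto simp: ell2_op_def ell2_fun_inverse)
    also have "\<dots> \<le> max C 1 * norm x" by (intro mult_right_mono) auto
    finally show ?thesis .
  qed
  then show thesis by (rule that[of "max C 1", rotated]) auto
qed

text \<open>The inner product is a real part, so \<open>Im l\<close> does not enter the form of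
  \<open>T - l\<close>, which is coercive with constant \<open>m - Re l\<close>. Coercivity gives
  surjectivity by \<open>coercive_surjective\<close>, injectivity, and the bound
  \<open>1 / c\<close> for the inverse.\<close>

lemma not_in_spec:
  assumes T: "bdd_op S T" and m: "\<And>x. x \<in> ell2_on S \<Longrightarrow> m * (norm x)\<^sup>2 \<le> x \<bullet> ell2_op T x"
    and l: "Re l < m"
  shows "l \<notin> spec S T"
proof -
  let ?V = "ell2_on S"
  define c where "c = m - Re l"
  have c: "c > 0" using l by (simp add: c_def)
  define B where "B x = ell2_op T x - cmult_ell2 l x" for x
  have B_on: "B x \<in> ?V" if "x \<in> ?V" for x
    unfolding B_def using that by (intro subspace_diff[OF subspace_ell2_on] ell2_op_on[OF T] cmult_ell2_on)
  have B_lin: "B (x + cmult_ell2 d y) = B x + cmult_ell2 d (B y)" if "x \<in> ?V" "y \<in> ?V" for x y d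
    by (simp add: B_def ell2_op_linear[OF T that] cmult_ell2_simps)
  have B_diff: "B (x - y) = B x - B y" if "x \<in> ?V" "y \<in> ?V" for x y
    by (simp add: B_def ell2_op_diff[OF T that] cmult_ell2_simps)
  obtain C where C: "\<And>x. x \<in> ?V \<Longrightarrow> norm (ell2_op T x) \<le> C * norm x"
    using ell2_op_bounded[OF T] by blast
  have B_bound: "norm (B x) \<le> (C + cmod l) * norm x" if "x \<in> ?V" for x
    using norm_triangle_ineq4[of "ell2_op T x" "cmult_ell2 l x"] C[OF that]
    by (simp add: B_def norm_cmult_ell2 distrib_right)
  have B_coercive: "c * (norm x)\<^sup>2 \<le> x \<bullet> B x" if "x \<in> ?V" for x
    using m[OF that] by (simp add: B_def c_def inner_diff_right inner_cmult_ell2 left_diff_distrib)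
  have B_below: "c * norm x \<le> norm (B x)" if "x \<in> ?V" for x
  proof (cases "x = 0")
    case False
    have "c * norm x * norm x \<le> norm (B x) * norm x"
      using order_trans[OF B_coercive[OF that] norm_cauchy_schwarz[of x "B x"]]
      by (simp add: power2_eq_square algebra_simps)
    then show ?thesis using False by simp
  qed simp
  have B_inj: "x = y" if "x \<in> ?V" "y \<in> ?V" "B x = B y" for x y
  proof -
    have "c * norm (x - y) \<le> 0"
      using B_below[OF subspace_diff[OF subspace_ell2_on that(1,2)]] that B_diff by simp
    then show ?thesis using c by (simp add: mult_le_0_iff)
  qed
  have "\<exists>x\<in>?V. B x = y" if "y \<in> ?V" for y
    by (rule coercive_surjective[OF subspace_ell2_on closed_ell2_on B_on B_diff B_bound c B_coercive that])
  then obtain W where W: "\<And>y. y \<in> ?V \<Longrightarrow> W y \<in> ?V" "\<And>y. y \<in> ?V \<Longrightarrow> B (W y) = y" by metis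
  have WB: "W (B x) = x" if "x \<in> ?V" for x
    using B_inj[OF W(1)[OF B_on[OF that]] that] W(2)[OF B_on[OF that]] by blast
  define U where "U v = ell2_fun (W (Abs_ell2 v))" for v
  note abs = Abs_ell2_l2
  have U_l2: "U v \<in> l2 S" if "v \<in> l2 S" for v
    using W(1)[OF abs(1)[OF that]] by (simp add: U_def ell2_on_iff)
  have "bdd_op S U"
    unfolding bdd_op_def
  proof (intro conjI ballI allI U_l2)
    fix u v d assume u: "u \<in> l2 S" and v: "v \<in> l2 S"
    let ?x = "Abs_ell2 u" and ?y = "Abs_ell2 v"
    note xy = abs(1)[OF u] abs(1)[OF v]
    have "(\<lambda>a. u a + d * v a) = ell2_fun (?x + cmult_ell2 d ?y)"
      by (simp add: plus_ell2.rep_eq cmult_ell2.rep_eq abs[OF u] abs[OF v])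
    then have *: "Abs_ell2 (\<lambda>a. u a + d * v a) = ?x + cmult_ell2 d ?y"
      by (simp add: ell2_fun_inverse)
    have "W (?x + cmult_ell2 d ?y) = W ?x + cmult_ell2 d (W ?y)"
      by (rule B_inj) (use W xy in \<open>simp_all add: subspace_add[OF subspace_ell2_on] cmult_ell2_on B_lin\<close>)
    then show "U (\<lambda>a. u a + d * v a) = (\<lambda>a. U u a + d * U v a)"
      by (simp add: U_def * plus_ell2.rep_eq cmult_ell2.rep_eq)
  next
    show "\<exists>C. \<forall>v\<in>l2 S. l2norm S (U v) \<le> C * l2norm S v"
    proof (intro exI[of _ "1 / c"] ballI)
      fix v assume v: "v \<in> l2 S"
      have "c * norm (W (Abs_ell2 v)) \<le> norm (Abs_ell2 v)"
        using B_below[OF W(1)[OF abs(1)[OF v]]] W(2)[OF abs(1)[OF v]] by simp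
      moreover have "l2norm S (U v) = norm (W (Abs_ell2 v))"
        using l2norm_eq_norm[OF U_l2[OF v]] by (simp add: U_def ell2_fun_inverse)
      ultimately show "l2norm S (U v) \<le> 1 / c * l2norm S v"
        using c by (simp add: l2norm_eq_norm[OF v] field_simps)
    qed
  qed
  moreover have "U (\<lambda>a. T v a - l * v a) = v" if v: "v \<in> l2 S" for v
  proof -
    have "ell2_fun (B (Abs_ell2 v)) = (\<lambda>a. T v a - l * v a)"
      by (simp add: B_def minus_ell2.rep_eq cmult_ell2.rep_eq ell2_fun_op[OF T abs(1)[OF v]] abs[OF v])
    then have "Abs_ell2 (\<lambda>a. T v a - l * v a) = B (Abs_ell2 v)"
      by (metis ell2_fun_inverse)
    then show ?thesis by (simp add: U_def WB[OF abs(1)[OF v]] abs[OF v])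
  qed
  moreover have "(\<lambda>a. T (U v) a - l * U v a) = v" if v: "v \<in> l2 S" for v
  proof -
    let ?x = "W (Abs_ell2 v)"
    have x: "?x \<in> ?V" by (rule W(1)[OF abs(1)[OF v]])
    have "(\<lambda>a. T (U v) a - l * U v a) = ell2_fun (B ?x)"
      by (simp add: U_def B_def minus_ell2.rep_eq cmult_ell2.rep_eq ell2_fun_op[OF T x])
    also have "\<dots> = v" by (simp add: W(2)[OF abs(1)[OF v]] abs[OF v])
    finally show ?thesis .
  qed
  ultimately show ?thesis unfolding spec_def by blast
qed

text \<open>An inverse of \<open>T - m\<close> would bound \<open>norm (B x)\<close> from below, and
  positivity of \<open>B\<close> converts this into a form bound \<open>m + e\<close>, against the
  optimality of \<open>m\<close>.\<close>

lemma lower_bound_in_spec: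
  assumes T: "bdd_op S T"
    and sym: "\<And>x y. x \<in> ell2_on S \<Longrightarrow> y \<in> ell2_on S \<Longrightarrow> x \<bullet> ell2_op T y = ell2_op T x \<bullet> y"
    and m: "\<And>x. x \<in> ell2_on S \<Longrightarrow> m * (norm x)\<^sup>2 \<le> x \<bullet> ell2_op T x"
    and sharp: "\<And>c. (\<And>x. x \<in> ell2_on S \<Longrightarrow> c * (norm x)\<^sup>2 \<le> x \<bullet> ell2_op T x) \<Longrightarrow> c \<le> m"
  shows "of_real m \<in> spec S T"
proof (rule ccontr)
  let ?V = "ell2_on S"
  assume "of_real m \<notin> spec S T"
  then obtain U where U: "bdd_op S U"
    and UT: "\<And>v. v \<in> l2 S \<Longrightarrow> U (\<lambda>a. T v a - of_real m * v a) = v"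
    unfolding spec_def by blast
  define B where "B x = ell2_op T x - m *\<^sub>R x" for x
  have B_on: "B x \<in> ?V" if "x \<in> ?V" for x
    unfolding B_def using that
    by (intro subspace_diff[OF subspace_ell2_on] ell2_op_on[OF T] subspace_scale[OF subspace_ell2_on])
  obtain C where C0: "C > 0" and C: "\<And>x. x \<in> ?V \<Longrightarrow> norm (ell2_op T x) \<le> C * norm x"
    using ell2_op_bounded[OF T] by blast
  define D where "D = C + \<bar>m\<bar>"
  have D: "D > 0" using C0 by (simp add: D_def)
  have B_bound: "norm (B x) \<le> D * norm x" if "x \<in> ?V" for x
    using norm_triangle_ineq4[of "ell2_op T x" "m *\<^sub>R x"] C[OF that]
    by (simp add: B_def D_def distrib_right)
  have B_form: "(norm (B x))\<^sup>2 \<le> D * (x \<bullet> B x)" if "x \<in> ?V" for x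
  proof (rule norm_le_positive_form[OF subspace_ell2_on B_on _ B_bound D _ _ that])
    show "B (x - r *\<^sub>R y) = B x - r *\<^sub>R B y" if "x \<in> ?V" "y \<in> ?V" for x y r
      by (simp add: B_def ell2_op_diff[OF T that] algebra_simps)
    show "x \<bullet> B y = B x \<bullet> y" if "x \<in> ?V" "y \<in> ?V" for x y
      using sym[OF that] by (simp add: B_def inner_diff_left inner_diff_right)
    show "0 \<le> x \<bullet> B x" if "x \<in> ?V" for x
      using m[OF that] by (simp add: B_def inner_diff_right power2_norm_eq_inner)
  qed
  obtain K where K: "K > 0" "\<And>x. x \<in> ?V \<Longrightarrow> norm (ell2_op U x) \<le> K * norm x"
    using ell2_op_bounded[OF U] by blast
  have UB: "ell2_op U (B x) = x" if "x \<in> ?V" for x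
  proof -
    have "ell2_fun (B x) = (\<lambda>a. T (ell2_fun x) a - of_real m * ell2_fun x a)"
      by (simp add: B_def minus_ell2.rep_eq scaleR_ell2.rep_eq ell2_fun_op[OF T that] scaleR_conv_of_real)
    then show ?thesis
      using UT[of "ell2_fun x"] that by (simp add: ell2_op_def ell2_on_iff ell2_fun_inverse)
  qed
  \<comment> \<open>The inverse gives \<open>norm x \<le> K * norm (B x)\<close> and
    \<open>B_form\<close> gives \<open>(norm (B x))\<^sup>2 \<le> D * (x \<bullet> B x)\<close>;
    chained together they leave the factor \<open>K\<^sup>2 * D\<close>.\<close>
  define e where "e = 1 / (K\<^sup>2 * D)"
  have e: "e > 0" using K D by (simp add: e_def)
  have "(m + e) * (norm x)\<^sup>2 \<le> x \<bullet> ell2_op T x" if x: "x \<in> ?V" for x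
  proof -
    have "norm x \<le> K * norm (B x)" using K(2)[OF B_on[OF x]] UB[OF x] by simp
    then have "(norm x)\<^sup>2 \<le> (K * norm (B x))\<^sup>2" by (simp add: power_mono)
    also have "\<dots> \<le> K\<^sup>2 * (D * (x \<bullet> B x))"
      unfolding power_mult_distrib by (rule mult_left_mono[OF B_form[OF x]]) simp
    finally have "e * (norm x)\<^sup>2 \<le> x \<bullet> B x"
      using K D by (simp add: e_def field_simps)
    then show ?thesis
      by (simp add: B_def inner_diff_right power2_norm_eq_inner algebra_simps)
  qed
  from sharp[OF this] show False using e by simp
qed

text \<open>The optimal form bound is attained in the spectrum by
  \<open>lower_bound_in_spec\<close>, and nothing lies to its left by \<open>not_in_spec\<close>; so
  \<open>inf_sp\<close> is a true minimum. For empty \<open>S\<close> the spectrum is empty and its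
  \<open>Inf\<close> is a default value.\<close>

lemma le_inf_sp_iff:
  assumes T: "bdd_op S T" and S: "S \<noteq> {}"
    and sym: "\<And>x y. x \<in> ell2_on S \<Longrightarrow> y \<in> ell2_on S \<Longrightarrow> x \<bullet> ell2_op T y = ell2_op T x \<bullet> y"
  shows "c \<le> inf_sp S T \<longleftrightarrow> (\<forall>x\<in>ell2_on S. c * (norm x)\<^sup>2 \<le> x \<bullet> ell2_op T x)"
proof -
  let ?V = "ell2_on S"
  let ?R = "{x \<bullet> ell2_op T x | x. x \<in> ?V \<and> norm x = 1}"
  define m where "m = Inf ?R"
  obtain C where C: "\<And>x. x \<in> ?V \<Longrightarrow> norm (ell2_op T x) \<le> C * norm x"
    using ell2_op_bounded[OF T] by blast
  have "- C \<le> x \<bullet> ell2_op T x" if "x \<in> ?V" "norm x = 1" for x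
    using Cauchy_Schwarz_ineq2[of x "ell2_op T x"] C[OF that(1)] that(2) by simp
  then have bdd: "bdd_below ?R" by (intro bdd_belowI[of _ "- C"]) auto
  obtain s where s: "s \<in> S" using S by blast
  \<comment> \<open>A point mass, once normalised, shows that there are unit vectors, so that
    \<open>?R\<close> is nonempty and its \<open>Inf\<close> is meaningful.\<close>
  let ?d = "\<lambda>a. if a = s then 1 else 0 :: complex"
  have d: "?d \<in> l2 S"
  proof -
    have "?d \<in> l2 UNIV"
      unfolding l2_UNIV_iff by (rule finite_nonzero_values_imp_summable_on) simp
    then show ?thesis using s by (simp add: l2_iff[of ?d S])
  qed
  have "Abs_ell2 ?d \<noteq> 0"
    using Abs_ell2_l2(2)[OF d] by (auto simp: zero_ell2.rep_eq fun_eq_iff ell2_fun_inject[symmetric])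
  then obtain x0 where x0: "x0 \<in> ?V" "norm x0 = 1"
    using subspace_scale[OF subspace_ell2_on Abs_ell2_l2(1)[OF d], of "1 / norm (Abs_ell2 ?d)"] by fastforce
  then have ne: "?R \<noteq> {}" by blast
  have op0: "ell2_op T 0 = 0"
    using ell2_op_diff(2)[OF T, of 0 0] subspace_0[OF subspace_ell2_on[of S]] by simp
  have scale: "ell2_op T (r *\<^sub>R x) = r *\<^sub>R ell2_op T x" if "x \<in> ?V" for r x
    using ell2_op_diff(1)[OF T _ that, of 0 "- r"] subspace_0[OF subspace_ell2_on[of S]] op0 by simp
  have m: "m * (norm x)\<^sup>2 \<le> x \<bullet> ell2_op T x" if "x \<in> ?V" for x
  proof (cases "x = 0")
    case False
    let ?y = "(1 / norm x) *\<^sub>R x"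
    have "?y \<in> ?V" "norm ?y = 1" using that False by (auto simp: subspace_scale[OF subspace_ell2_on])
    then have "m \<le> ?y \<bullet> ell2_op T ?y" unfolding m_def by (intro cInf_lower bdd) blast
    also have "\<dots> = (x \<bullet> ell2_op T x) / (norm x)\<^sup>2"
      by (simp add: scale[OF that] power2_eq_square)
    finally show ?thesis using False by (simp add: field_simps)
  qed simp
  have sharp: "c \<le> m" if "\<And>x. x \<in> ?V \<Longrightarrow> c * (norm x)\<^sup>2 \<le> x \<bullet> ell2_op T x" for c
    unfolding m_def by (rule cInf_greatest[OF ne]) (use that in force)
  have "inf_sp S T = m"
    unfolding inf_sp_def
  proof (rule cInf_eq_minimum)
    show "m \<in> Re ` spec S T"
      using lower_bound_in_spec[OF T sym m sharp] by (metis Re_complex_of_real image_eqI)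
    show "m \<le> r" if "r \<in> Re ` spec S T" for r
      using not_in_spec[OF T m] that by force
  qed
  then show ?thesis
    using m sharp by (meson mult_right_mono order_trans zero_le_power2)
qed

section \<open>Negation, exchanging lower and upper spectral bounds\<close>

lemma bdd_op_uminus:
  assumes T: "bdd_op S T"
  shows "bdd_op S (\<lambda>v a. - T v a)"
proof -
  have "l2norm S (\<lambda>a. - w a) = l2norm S w" for w by (simp add: l2norm_def)
  then show ?thesis using T by (auto simp: bdd_op_def l2_def)
qed

lemma spec_uminus: "l \<in> spec S (\<lambda>v a. - T v a) \<longleftrightarrow> - l \<in> spec S T"
proof -
  have *: "- l \<notin> spec S T"
    if hyp: "l \<notin> spec S (\<lambda>v a. - T v a)" for l and T :: "('a \<Rightarrow> complex) \<Rightarrow> ('a \<Rightarrow> complex)"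
  proof -
    obtain U where U: "bdd_op S U"
      and 1: "\<And>v. v \<in> l2 S \<Longrightarrow> U (\<lambda>a. - T v a - l * v a) = v"
      and 2: "\<And>v. v \<in> l2 S \<Longrightarrow> (\<lambda>a. - T (U v) a - l * U v a) = v"
      using hyp unfolding spec_def by blast
    define U' where "U' v = U (\<lambda>a. - v a)" for v
    have neg: "(\<lambda>a. - v a) \<in> l2 S" if "v \<in> l2 S" for v using that by (simp add: l2_def)
    have nn: "l2norm S (\<lambda>a. - w a) = l2norm S w" for w by (simp add: l2norm_def)
    have "bdd_op S U'"
      unfolding bdd_op_def U'_def
    proof (intro conjI ballI allI)
      fix u v c assume uv: "u \<in> l2 S" "v \<in> l2 S"
      show "U (\<lambda>a. - (u a + c * v a)) = (\<lambda>a. U (\<lambda>a. - u a) a + c * U (\<lambda>a. - v a) a)"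
        using U neg[OF uv(1)] neg[OF uv(2)] unfolding bdd_op_def
        by (metis (no_types, lifting) ext minus_add_distrib mult_minus_right)
    next
      obtain C where "\<forall>v\<in>l2 S. l2norm S (U v) \<le> C * l2norm S v" using U by (auto simp: bdd_op_def)
      then show "\<exists>C. \<forall>v\<in>l2 S. l2norm S (U (\<lambda>a. - v a)) \<le> C * l2norm S v"
        using neg nn by metis
    qed (use U neg in \<open>simp add: bdd_op_def\<close>)
    moreover have "U' (\<lambda>a. T v a - (- l) * v a) = v" if "v \<in> l2 S" for v
      using 1[OF that] by (simp add: U'_def)
    moreover have "(\<lambda>a. T (U' v) a - (- l) * U' v a) = v" if "v \<in> l2 S" for v
    proof
      fix a
      show "T (U' v) a - (- l) * U' v a = v a"
        using fun_cong[OF 2[OF neg[OF that]], of a] by (simp add: U'_def algebra_simps eq_neg_iff_add_eq_0)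
    qed
    ultimately show ?thesis unfolding spec_def by blast
  qed
  show ?thesis
    using *[of l T] *[of "- l" "\<lambda>v a. - T v a"] by auto
qed

text \<open>The spectrum of the negated operator is the negated spectrum, and the real
  \<open>Inf\<close> is by definition the negated \<open>Sup\<close> of the negated set.\<close>

lemma sup_sp_uminus: "sup_sp S T = - inf_sp S (\<lambda>v a. - T v a)"
proof -
  have "spec S (\<lambda>v a. - T v a) = uminus ` spec S T"
    by (force simp: spec_uminus image_iff)
  then have "Re ` spec S (\<lambda>v a. - T v a) = uminus ` Re ` spec S T"
    by (simp add: image_image)
  then show ?thesis by (simp add: inf_sp_def sup_sp_def Inf_real_def image_image)
qed

section \<open>Operators given by matrix kernels\<close>

definition fin_ell2 :: "'a set \<Rightarrow> ('a \<Rightarrow> complex) \<Rightarrow> 'a ell2" where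
  "fin_ell2 F v = Abs_ell2 (\<lambda>a. if a \<in> F then v a else 0)"

lemma finite_support_l2:
  assumes "finite F" "F \<subseteq> S"
  shows "(\<lambda>a. if a \<in> F then v a else 0) \<in> l2 S"
proof -
  have "(\<lambda>a. if a \<in> F then v a else 0) \<in> l2 UNIV"
    unfolding l2_UNIV_iff
    by (rule finite_nonzero_values_imp_summable_on, rule finite_subset[OF _ assms(1)]) auto
  then show ?thesis using assms(2) by (auto simp: l2_iff[of _ S])
qed

lemma ell2_fun_fin:
  assumes "finite F"
  shows "ell2_fun (fin_ell2 F v) = (\<lambda>a. if a \<in> F then v a else 0)"
  unfolding fin_ell2_def using Abs_ell2_l2(2)[OF finite_support_l2[OF assms subset_UNIV]] .

lemma fin_ell2_on:
  assumes "finite F" "F \<subseteq> S"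
  shows "fin_ell2 F v \<in> ell2_on S"
  unfolding fin_ell2_def using Abs_ell2_l2(1)[OF finite_support_l2[OF assms]] .

lemma inner_fin_ell2:
  assumes "finite F"
  shows "fin_ell2 F u \<bullet> x = (\<Sum>a\<in>F. u a \<bullet> ell2_fun x a)"
proof -
  have "fin_ell2 F u \<bullet> x = (\<Sum>\<^sub>\<infinity>a\<in>F. u a \<bullet> ell2_fun x a)"
    unfolding inner_ell2_def ell2_fun_fin[OF assms] by (rule infsum_cong_neutral) auto
  then show ?thesis using assms by simp
qed

lemma norm_fin_ell2:
  assumes "finite F"
  shows "(norm (fin_ell2 F v))\<^sup>2 = (\<Sum>a\<in>F. (cmod (v a))\<^sup>2)"
  unfolding power2_norm_eq_inner inner_fin_ell2[OF assms] ell2_fun_fin[OF assms]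
  by (simp add: dot_square_norm)

lemma fin_ell2_dense:
  assumes "x \<in> ell2_on S"
  obtains F :: "nat \<Rightarrow> 'a set" where "\<And>n. finite (F n)" "\<And>n. F n \<subseteq> S"
    "(\<lambda>n. fin_ell2 (F n) (ell2_fun x)) \<longlonglongrightarrow> x"
proof -
  have "\<exists>F. finite F \<and> F \<subseteq> S \<and> norm (fin_ell2 F (ell2_fun x) - x) \<le> sqrt (1 / real (Suc n))" for n
  proof -
    let ?f = "\<lambda>a. (cmod (ell2_fun x a))\<^sup>2"
    obtain F where F: "finite F" "dist (sum ?f F) (infsum ?f UNIV) \<le> 1 / real (Suc n)"
      using infsum_finite_approximation[OF summable_ell2, of "1 / real (Suc n)" x] by auto
    let ?E = "F \<inter> S"
    have E: "finite ?E" using F by simp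
    have "sum ?f F = sum ?f ?E"
      by (rule sum.mono_neutral_right) (use F assms in \<open>auto simp: ell2_on_def\<close>)
    then have *: "(norm x)\<^sup>2 - sum ?f ?E \<le> 1 / real (Suc n)"
      using F(2) by (simp add: norm_ell2_power2 dist_real_def)
    have "(norm (fin_ell2 ?E (ell2_fun x) - x))\<^sup>2
        = (norm (fin_ell2 ?E (ell2_fun x)))\<^sup>2 - 2 * (fin_ell2 ?E (ell2_fun x) \<bullet> x) + (norm x)\<^sup>2"
      unfolding power2_norm_eq_inner by (simp add: inner_diff_left inner_diff_right inner_commute)
    also have "\<dots> = (norm x)\<^sup>2 - sum ?f ?E"
      unfolding norm_fin_ell2[OF E] inner_fin_ell2[OF E] by (simp add: dot_square_norm)
    finally have "(norm (fin_ell2 ?E (ell2_fun x) - x))\<^sup>2 \<le> 1 / real (Suc n)" using * by simp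
    then have "norm (fin_ell2 ?E (ell2_fun x) - x) \<le> sqrt (1 / real (Suc n))" by (rule real_le_rsqrt)
    then show ?thesis using E by (intro exI[of _ ?E]) auto
  qed
  then obtain F where F: "\<And>n. finite (F n)" "\<And>n. F n \<subseteq> S"
      "\<And>n. norm (fin_ell2 (F n) (ell2_fun x) - x) \<le> sqrt (1 / real (Suc n))"
    by metis
  have "(\<lambda>n. sqrt (1 / real (Suc n))) \<longlonglongrightarrow> sqrt 0"
    by (rule tendsto_real_sqrt[OF LIMSEQ_Suc[OF lim_1_over_n]])
  then have "(\<lambda>n. sqrt (1 / real (Suc n))) \<longlonglongrightarrow> 0" by simp
  then have "(\<lambda>n. fin_ell2 (F n) (ell2_fun x) - x) \<longlonglongrightarrow> 0"
    by (rule Lim_null_comparison[OF always_eventually, rotated]) (use F(3) in auto)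
  then show thesis by (intro that[OF F(1,2)]) (auto intro: LIM_zero_cancel)
qed

lemma ell2_op_tendsto:
  assumes T: "bdd_op S T" and X: "\<And>n. X n \<in> ell2_on S" "X \<longlonglongrightarrow> x"
  shows "(\<lambda>n. ell2_op T (X n)) \<longlonglongrightarrow> ell2_op T x"
proof -
  have x: "x \<in> ell2_on S"
    using closed_ell2_on[of S] X unfolding closed_sequential_limits by blast
  obtain C where C: "\<And>x. x \<in> ell2_on S \<Longrightarrow> norm (ell2_op T x) \<le> C * norm x"
    using ell2_op_bounded[OF T] by blast
  have "(\<lambda>n. C * norm (X n - x)) \<longlonglongrightarrow> C * 0"
    using X(2) by (intro tendsto_mult_left) (simp add: LIM_zero tendsto_norm_zero)
  then have "(\<lambda>n. C * norm (X n - x)) \<longlonglongrightarrow> 0" by simp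
  then have "(\<lambda>n. ell2_op T (X n) - ell2_op T x) \<longlonglongrightarrow> 0"
    by (rule Lim_null_comparison[OF always_eventually, rotated])
       (use C[OF subspace_diff[OF subspace_ell2_on X(1) x]] ell2_op_diff(2)[OF T X(1) x] in auto)
  then show ?thesis by (rule LIM_zero_cancel)
qed

text \<open>Only the values on point masses are recorded, since a norm limit of operators comes
  without a series formula. Boundedness makes these entries determine \<open>T\<close> on
  \<open>l2 S\<close>, see \<open>has_kernel_unique\<close>.\<close>

definition has_kernel :: "'a set \<Rightarrow> (('a \<Rightarrow> complex) \<Rightarrow> ('a \<Rightarrow> complex)) \<Rightarrow> ('a \<Rightarrow> 'a \<Rightarrow> complex) \<Rightarrow> bool"
  where "has_kernel S T k \<longleftrightarrow> bdd_op S T \<and> (\<forall>a\<in>S. \<forall>b\<in>S. T (\<lambda>c. if c = b then 1 else 0) a = k a b)"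

definition kform :: "('a \<Rightarrow> 'a \<Rightarrow> complex) \<Rightarrow> 'a set \<Rightarrow> ('a \<Rightarrow> complex) \<Rightarrow> real" where
  "kform k F v = (\<Sum>a\<in>F. \<Sum>b\<in>F. Re (cnj (v a) * k a b * v b))"

lemma bdd_op_linear:
  assumes "bdd_op S T" "u \<in> l2 S" "v \<in> l2 S"
  shows "T (\<lambda>a. u a + c * v a) = (\<lambda>a. T u a + c * T v a)"
  using assms by (simp add: bdd_op_def)

lemma l2_zero: "(\<lambda>a. 0) \<in> l2 S"
  by (simp add: l2_def)

lemma bdd_op_zero:
  assumes "bdd_op S T"
  shows "T (\<lambda>a. 0) = (\<lambda>a. 0)"
  using bdd_op_linear[OF assms l2_zero l2_zero, of "-1"] by (simp add: fun_eq_iff)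

lemma has_kernel_finite_support:
  assumes "has_kernel S T k" and "finite F" "F \<subseteq> S" and a: "a \<in> S"
  shows "T (\<lambda>a. if a \<in> F then v a else 0) a = (\<Sum>b\<in>F. k a b * v b)"
  using assms(2,3)
proof (induction F rule: finite_induct)
  case empty
  then show ?case using bdd_op_zero[of S T] assms(1) by (simp add: has_kernel_def)
next
  case (insert b F)
  let ?u = "\<lambda>a. if a \<in> F then v a else 0" and ?d = "\<lambda>c. if c = b then 1 else 0 :: complex"
  have T: "bdd_op S T" using assms(1) by (simp add: has_kernel_def)
  have u: "?u \<in> l2 S" by (rule finite_support_l2) (use insert in auto)
  have d: "?d \<in> l2 S" using finite_support_l2[of "{b}" S "\<lambda>_. 1"] insert by simp
  have "(\<lambda>a. if a \<in> insert b F then v a else 0) = (\<lambda>a. ?u a + v b * ?d a)"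
    using insert by (auto simp: fun_eq_iff)
  then have "T (\<lambda>a. if a \<in> insert b F then v a else 0) a = T ?u a + v b * T ?d a"
    using bdd_op_linear[OF T u d, of "v b"] by simp
  also have "\<dots> = (\<Sum>b\<in>F. k a b * v b) + v b * k a b"
    using insert assms(1) a by (simp add: has_kernel_def)
  finally show ?case using insert by simp
qed

lemma inner_fin_op:
  assumes k: "has_kernel S T k" and F: "finite F" "F \<subseteq> S" and E: "finite E" "E \<subseteq> S"
  shows "fin_ell2 F u \<bullet> ell2_op T (fin_ell2 E v) = (\<Sum>a\<in>F. \<Sum>b\<in>E. Re (cnj (u a) * k a b * v b))"
proof -
  have T: "bdd_op S T" using k by (simp add: has_kernel_def)
  have "fin_ell2 F u \<bullet> ell2_op T (fin_ell2 E v) = (\<Sum>a\<in>F. u a \<bullet> (\<Sum>b\<in>E. k a b * v b))"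
    unfolding inner_fin_ell2[OF F(1)] ell2_fun_op[OF T fin_ell2_on[OF E]] ell2_fun_fin[OF E(1)]
    by (intro sum.cong refl) (use has_kernel_finite_support[OF k E] F in \<open>simp add: subset_iff\<close>)
  also have "\<dots> = (\<Sum>a\<in>F. \<Sum>b\<in>E. Re (cnj (u a) * k a b * v b))"
    unfolding inner_sum_right by (intro sum.cong refl) (simp add: inner_complex_def algebra_simps)
  finally show ?thesis .
qed

lemma kform_eq_inner:
  assumes "has_kernel S T k" "finite F" "F \<subseteq> S"
  shows "kform k F v = fin_ell2 F v \<bullet> ell2_op T (fin_ell2 F v)"
  by (simp add: kform_def inner_fin_op[OF assms assms(2,3)])

lemma has_kernel_symmetric:
  assumes k: "has_kernel S T k" and herm: "\<And>a b. a \<in> S \<Longrightarrow> b \<in> S \<Longrightarrow> k b a = cnj (k a b)"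
    and x: "x \<in> ell2_on S" and y: "y \<in> ell2_on S"
  shows "x \<bullet> ell2_op T y = ell2_op T x \<bullet> y"
proof -
  have T: "bdd_op S T" using k by (simp add: has_kernel_def)
  obtain F where F: "\<And>n. finite (F n)" "\<And>n. F n \<subseteq> S" "(\<lambda>n. fin_ell2 (F n) (ell2_fun x)) \<longlonglongrightarrow> x"
    using fin_ell2_dense[OF x] by blast
  obtain E where E: "\<And>n. finite (E n)" "\<And>n. E n \<subseteq> S" "(\<lambda>n. fin_ell2 (E n) (ell2_fun y)) \<longlonglongrightarrow> y"
    using fin_ell2_dense[OF y] by blast
  let ?x = "\<lambda>n. fin_ell2 (F n) (ell2_fun x)" and ?y = "\<lambda>n. fin_ell2 (E n) (ell2_fun y)"
  have "?x n \<bullet> ell2_op T (?y n) = ell2_op T (?x n) \<bullet> ?y n" for n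
  proof -
    have "Re (cnj (ell2_fun x a) * k a b * ell2_fun y b) = Re (cnj (ell2_fun y b) * k b a * ell2_fun x a)"
      if "a \<in> F n" "b \<in> E n" for a b
    proof -
      have "cnj (ell2_fun x a) * k a b * ell2_fun y b = cnj (cnj (ell2_fun y b) * k b a * ell2_fun x a)"
        using herm[of a b] that F(2) E(2) by (auto simp: subset_iff)
      then show ?thesis by (simp only: cnj.sel(1))
    qed
    then show ?thesis
      unfolding inner_commute[of "ell2_op T (?x n)"] inner_fin_op[OF k F(1,2) E(1,2)]
        inner_fin_op[OF k E(1,2) F(1,2)] by (subst sum.swap) (auto intro!: sum.cong)
  qed
  moreover have "(\<lambda>n. ?x n \<bullet> ell2_op T (?y n)) \<longlonglongrightarrow> x \<bullet> ell2_op T y"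
    by (intro tendsto_inner F(3) ell2_op_tendsto[OF T _ E(3)] fin_ell2_on E)
  moreover have "(\<lambda>n. ell2_op T (?x n) \<bullet> ?y n) \<longlonglongrightarrow> ell2_op T x \<bullet> y"
    by (intro tendsto_inner E(3) ell2_op_tendsto[OF T _ F(3)] fin_ell2_on F)
  ultimately show ?thesis using LIMSEQ_unique by simp
qed

text \<open>Finitely supported vectors are dense and both sides are continuous, so the operator
  disappears and only finite sums of matrix entries remain.\<close>

lemma has_kernel_lower_bound_iff:
  assumes k: "has_kernel S T k"
  shows "(\<forall>x\<in>ell2_on S. c * (norm x)\<^sup>2 \<le> x \<bullet> ell2_op T x) \<longleftrightarrow>
    (\<forall>F v. finite F \<and> F \<subseteq> S \<longrightarrow> c * (\<Sum>a\<in>F. (cmod (v a))\<^sup>2) \<le> kform k F v)" (is "?L \<longleftrightarrow> ?R")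
proof
  assume ?L
  then show ?R
    using fin_ell2_on norm_fin_ell2 kform_eq_inner[OF k] by metis
next
  assume R: ?R
  have T: "bdd_op S T" using k by (simp add: has_kernel_def)
  show ?L
  proof
    fix x assume x: "x \<in> ell2_on S"
    obtain F where F: "\<And>n. finite (F n)" "\<And>n. F n \<subseteq> S" "(\<lambda>n. fin_ell2 (F n) (ell2_fun x)) \<longlonglongrightarrow> x"
      using fin_ell2_dense[OF x] by blast
    let ?x = "\<lambda>n. fin_ell2 (F n) (ell2_fun x)"
    have "c * (norm (?x n))\<^sup>2 \<le> ?x n \<bullet> ell2_op T (?x n)" for n
      using R F(1,2) unfolding norm_fin_ell2[OF F(1)] kform_eq_inner[OF k F(1,2), symmetric] by blast
    moreover have "(\<lambda>n. c * (norm (?x n))\<^sup>2) \<longlonglongrightarrow> c * (norm x)\<^sup>2"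
      by (intro tendsto_intros F(3))
    moreover have "(\<lambda>n. ?x n \<bullet> ell2_op T (?x n)) \<longlonglongrightarrow> x \<bullet> ell2_op T x"
      by (intro tendsto_inner F(3) ell2_op_tendsto[OF T _ F(3)] fin_ell2_on F)
    ultimately show "c * (norm x)\<^sup>2 \<le> x \<bullet> ell2_op T x"
      by (intro LIMSEQ_le) auto
  qed
qed

text \<open>On the right \<open>S\<close> occurs only through its finite subsets. For a fixed
  kernel, a larger \<open>S\<close> therefore admits fewer \<open>c\<close>; the monotonicity half
  of the theorem rests on this.\<close>

lemma le_inf_sp_kernel_iff:
  assumes k: "has_kernel S T k" and S: "S \<noteq> {}"
    and herm: "\<And>a b. a \<in> S \<Longrightarrow> b \<in> S \<Longrightarrow> k b a = cnj (k a b)"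
  shows "c \<le> inf_sp S T \<longleftrightarrow>
    (\<forall>F v. finite F \<and> F \<subseteq> S \<longrightarrow> c * (\<Sum>a\<in>F. (cmod (v a))\<^sup>2) \<le> kform k F v)"
proof -
  have "bdd_op S T" using k by (simp add: has_kernel_def)
  from le_inf_sp_iff[OF this S has_kernel_symmetric[OF k herm]] show ?thesis
    by (simp add: has_kernel_lower_bound_iff[OF k])
qed

lemma has_kernel_uminus:
  "has_kernel S T k \<Longrightarrow> has_kernel S (\<lambda>v a. - T v a) (\<lambda>a b. - k a b)"
  by (simp add: has_kernel_def bdd_op_uminus)

lemma kform_uminus: "kform (\<lambda>a b. - k a b) F v = - kform k F v"
  unfolding kform_def sum_negf[symmetric] by (intro sum.cong refl) simp

lemma sup_sp_kernel_le_iff: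
  assumes k: "has_kernel S T k" and S: "S \<noteq> {}"
    and herm: "\<And>a b. a \<in> S \<Longrightarrow> b \<in> S \<Longrightarrow> k b a = cnj (k a b)"
  shows "sup_sp S T \<le> c \<longleftrightarrow>
    (\<forall>F v. finite F \<and> F \<subseteq> S \<longrightarrow> kform k F v \<le> c * (\<Sum>a\<in>F. (cmod (v a))\<^sup>2))"
proof -
  have "sup_sp S T \<le> c \<longleftrightarrow> - c \<le> inf_sp S (\<lambda>v a. - T v a)"
    by (auto simp: sup_sp_uminus)
  also have "\<dots> \<longleftrightarrow> (\<forall>F v. finite F \<and> F \<subseteq> S \<longrightarrow> - c * (\<Sum>a\<in>F. (cmod (v a))\<^sup>2) \<le> kform (\<lambda>a b. - k a b) F v)"
    by (rule le_inf_sp_kernel_iff[OF has_kernel_uminus[OF k] S]) (metis herm complex_cnj_minus)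
  finally show ?thesis by (simp add: kform_uminus)
qed

text \<open>Supplies the uniqueness that the definite description in \<open>Hop\<close>
  requires.\<close>

lemma has_kernel_unique:
  assumes k: "has_kernel S T k" and k': "has_kernel S T' k" and v: "v \<in> l2 S"
  shows "T v = T' v"
proof -
  have T: "bdd_op S T" "bdd_op S T'" using k k' by (auto simp: has_kernel_def)
  let ?x = "Abs_ell2 v"
  have x: "?x \<in> ell2_on S" by (rule Abs_ell2_l2(1)[OF v])
  obtain F where F: "\<And>n. finite (F n)" "\<And>n. F n \<subseteq> S" "(\<lambda>n. fin_ell2 (F n) (ell2_fun ?x)) \<longlonglongrightarrow> ?x"
    using fin_ell2_dense[OF x] by blast
  let ?y = "\<lambda>n. fin_ell2 (F n) (ell2_fun ?x)"
  have y: "?y n \<in> ell2_on S" for n by (rule fin_ell2_on[OF F(1,2)])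
  have "ell2_op T (?y n) = ell2_op T' (?y n)" for n
  proof -
    have "T (ell2_fun (?y n)) a = T' (ell2_fun (?y n)) a" for a
    proof (cases "a \<in> S")
      case True
      show ?thesis
        unfolding ell2_fun_fin[OF F(1)] has_kernel_finite_support[OF k F(1,2) True]
          has_kernel_finite_support[OF k' F(1,2) True] by (rule refl)
    next
      case False
      have "T (ell2_fun (?y n)) \<in> l2 S" "T' (ell2_fun (?y n)) \<in> l2 S"
        using y[of n] T by (auto simp: bdd_op_def ell2_on_iff)
      then show ?thesis using False by (simp add: l2_def)
    qed
    then have "T (ell2_fun (?y n)) = T' (ell2_fun (?y n))" by (rule ext)
    then show ?thesis by (simp only: ell2_op_def)
  qed
  then have "ell2_op T ?x = ell2_op T' ?x"
    using ell2_op_tendsto[OF T(1) y F(3)] ell2_op_tendsto[OF T(2) y F(3)] LIMSEQ_unique by simp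
  then show ?thesis
    using ell2_fun_op[OF T(1) x] ell2_fun_op[OF T(2) x] Abs_ell2_l2(2)[OF v] by simp
qed

lemma bdd_op_diff:
  assumes T: "bdd_op S T" "bdd_op S T'"
  shows "bdd_op S (\<lambda>v a. T v a - T' v a)"
proof -
  have l2: "T v \<in> l2 S" "T' v \<in> l2 S" if "v \<in> l2 S" for v using that T by (auto simp: bdd_op_def)
  have eq: "Abs_ell2 (\<lambda>a. u a - v a) = Abs_ell2 u - Abs_ell2 v" and in_l2: "(\<lambda>a. u a - v a) \<in> l2 S"
    if uv: "u \<in> l2 S" "v \<in> l2 S" for u v
  proof -
    have *: "ell2_fun (Abs_ell2 u - Abs_ell2 v) = (\<lambda>a. u a - v a)"
      by (simp add: minus_ell2.rep_eq Abs_ell2_l2(2)[OF uv(1)] Abs_ell2_l2(2)[OF uv(2)])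
    then show "Abs_ell2 (\<lambda>a. u a - v a) = Abs_ell2 u - Abs_ell2 v"
      by (metis ell2_fun_inverse)
    have "Abs_ell2 u - Abs_ell2 v \<in> ell2_on S"
      using uv by (intro subspace_diff[OF subspace_ell2_on] Abs_ell2_l2)
    then show "(\<lambda>a. u a - v a) \<in> l2 S" by (simp add: ell2_on_iff *)
  qed
  obtain C where C: "\<forall>v\<in>l2 S. l2norm S (T v) \<le> C * l2norm S v" using T by (auto simp: bdd_op_def)
  obtain C' where C': "\<forall>v\<in>l2 S. l2norm S (T' v) \<le> C' * l2norm S v" using T by (auto simp: bdd_op_def)
  show ?thesis
    unfolding bdd_op_def
  proof (intro conjI ballI allI)
    show "(\<lambda>a. T v a - T' v a) \<in> l2 S" if "v \<in> l2 S" for v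
      by (rule in_l2[OF l2[OF that]])
    show "(\<lambda>a. T (\<lambda>a. u a + c * v a) a - T' (\<lambda>a. u a + c * v a) a) =
        (\<lambda>a. T u a - T' u a + c * (T v a - T' v a))" if "u \<in> l2 S" "v \<in> l2 S" for u v c
      by (simp add: bdd_op_linear[OF T(1) that] bdd_op_linear[OF T(2) that] fun_eq_iff algebra_simps)
    show "\<exists>C. \<forall>v\<in>l2 S. l2norm S (\<lambda>a. T v a - T' v a) \<le> C * l2norm S v"
    proof (intro exI[of _ "C + C'"] ballI)
      fix v assume v: "v \<in> l2 S"
      have "l2norm S (\<lambda>a. T v a - T' v a) = norm (Abs_ell2 (T v) - Abs_ell2 (T' v))"
        by (simp add: l2norm_eq_norm[OF in_l2[OF l2[OF v]]] eq[OF l2[OF v]])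
      also have "\<dots> \<le> l2norm S (T v) + l2norm S (T' v)"
        unfolding l2norm_eq_norm[OF l2(1)[OF v]] l2norm_eq_norm[OF l2(2)[OF v]]
        by (rule norm_triangle_ineq4)
      also have "\<dots> \<le> (C + C') * l2norm S v"
        using C C' v by (simp add: distrib_right add_mono)
      finally show "l2norm S (\<lambda>a. T v a - T' v a) \<le> (C + C') * l2norm S v" .
    qed
  qed
qed

section \<open>Operator norms\<close>

lemma l2norm_nonneg: "0 \<le> l2norm S v"
  by (simp add: l2norm_def infsum_nonneg)

lemma opnorm_le:
  assumes "\<And>v. v \<in> l2 S \<Longrightarrow> l2norm S (T v) \<le> C * l2norm S v" "0 \<le> C"
  shows "opnorm S T \<le> C"
  unfolding opnorm_def
proof (rule cSup_least)
  show "{l2norm S (T v) |v. v \<in> l2 S \<and> l2norm S v \<le> 1} \<noteq> {}"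
    using l2_zero[of S] by (force simp: l2norm_def)
  show "r \<le> C" if r: "r \<in> {l2norm S (T v) |v. v \<in> l2 S \<and> l2norm S v \<le> 1}" for r
  proof -
    obtain v where "v \<in> l2 S" "l2norm S v \<le> 1" "r = l2norm S (T v)" using r by auto
    then show ?thesis
      using assms(1)[of v] mult_left_mono[of "l2norm S v" 1 C] assms(2) by simp
  qed
qed

lemma l2norm_le_opnorm:
  assumes T: "bdd_op S T" and v: "v \<in> l2 S"
  shows "l2norm S (T v) \<le> opnorm S T * l2norm S v"
proof (cases "l2norm S v = 0")
  case True
  obtain C where "\<forall>v\<in>l2 S. l2norm S (T v) \<le> C * l2norm S v" using T by (auto simp: bdd_op_def)
  then show ?thesis using v True by force
next
  case False
  then have pos: "l2norm S v > 0" using l2norm_nonneg[of S v] by simp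
  define r where "r = 1 / l2norm S v"
  have r: "r > 0" "r * l2norm S v = 1" using pos by (auto simp: r_def)
  obtain C where C: "\<forall>v\<in>l2 S. l2norm S (T v) \<le> C * l2norm S v" using T by (auto simp: bdd_op_def)
  have scale: "l2norm S (\<lambda>a. of_real r * w a) = r * l2norm S w" for w
    unfolding l2norm_def norm_mult power_mult_distrib using r(1)
    by (simp add: infsum_cmult_right' real_sqrt_mult)
  let ?w = "\<lambda>a. of_real r * v a"
  have w: "?w \<in> l2 S"
    using v l2_UNIV_mult[of v "of_real r"] l2_iff[of v S] l2_iff[of ?w S] by simp
  have Tw: "T ?w = (\<lambda>a. of_real r * T v a)"
    using bdd_op_linear[OF T l2_zero v, of "of_real r"] bdd_op_zero[OF T] by simp
  have bdd: "bdd_above {l2norm S (T v) |v. v \<in> l2 S \<and> l2norm S v \<le> 1}"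
  proof (rule bdd_aboveI)
    fix t assume "t \<in> {l2norm S (T v) |v. v \<in> l2 S \<and> l2norm S v \<le> 1}"
    then obtain u where u: "u \<in> l2 S" "l2norm S u \<le> 1" "t = l2norm S (T u)" by auto
    have "t \<le> C * l2norm S u" using C u by blast
    also have "\<dots> \<le> \<bar>C\<bar> * 1" using u(2) l2norm_nonneg[of S u] by (intro mult_mono) auto
    finally show "t \<le> \<bar>C\<bar>" by simp
  qed
  have "l2norm S (T ?w) \<le> opnorm S T"
    unfolding opnorm_def by (rule cSup_upper[OF _ bdd]) (use w r(2) scale[of v] in auto)
  then have "r * l2norm S (T v) \<le> opnorm S T" by (simp add: Tw scale)
  then show ?thesis using pos by (simp add: r_def field_simps)
qed

section \<open>Banded matrices and the Schur bound\<close>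

definition kop :: "'a set \<Rightarrow> ('a \<Rightarrow> 'a \<Rightarrow> complex) \<Rightarrow> ('a \<Rightarrow> complex) \<Rightarrow> 'a \<Rightarrow> complex" where
  "kop S k v = (\<lambda>a. if a \<in> S then (\<Sum>\<^sub>\<infinity>b\<in>S. k a b * v b) else 0)"

text \<open>\<open>B\<close> bounds the entries and \<open>p\<close> the number of nonzero entries
  in each row and column. Both constants are explicit because one pair must later serve all fibres
  simultaneously.\<close>

definition banded :: "'a set \<Rightarrow> real \<Rightarrow> nat \<Rightarrow> ('a \<Rightarrow> 'a \<Rightarrow> complex) \<Rightarrow> bool" where
  "banded S B p k \<longleftrightarrow> 0 \<le> B \<and> (\<forall>a\<in>S. \<forall>b\<in>S. cmod (k a b) \<le> B) \<and>
     (\<forall>a\<in>S. finite {b\<in>S. k a b \<noteq> 0} \<and> card {b\<in>S. k a b \<noteq> 0} \<le> p) \<and>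
     (\<forall>b\<in>S. finite {a\<in>S. k a b \<noteq> 0} \<and> card {a\<in>S. k a b \<noteq> 0} \<le> p)"

lemma kop_eq_sum:
  assumes "banded S B p k" "a \<in> S"
  shows "kop S k v a = (\<Sum>b\<in>{b\<in>S. k a b \<noteq> 0}. k a b * v b)"
proof -
  have "(\<Sum>\<^sub>\<infinity>b\<in>S. k a b * v b) = (\<Sum>\<^sub>\<infinity>b\<in>{b\<in>S. k a b \<noteq> 0}. k a b * v b)"
    by (rule infsum_cong_neutral) auto
  then show ?thesis using assms by (simp add: kop_def banded_def)
qed

text \<open>Elementary Schur test: Cauchy-Schwarz on a row with at most \<open>p\<close> nonzero
  entries costs one factor \<open>p\<close>, and after exchanging the sums every column is met at
  most \<open>p\<close> times, which costs the other.\<close>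

lemma kop_sum_bound:
  assumes k: "banded S B p k" and v: "v \<in> l2 S" and F: "finite F"
  shows "(\<Sum>a\<in>F. (cmod (kop S k v a))\<^sup>2) \<le> (B * real p * l2norm S v)\<^sup>2"
proof -
  have B: "0 \<le> B" using k by (simp add: banded_def)
  define N where "N a = {b\<in>S. k a b \<noteq> 0}" for a
  \<comment> \<open>All columns met by the rows in \<open>F\<close>: one finite index set common to
    all rows, so that the two sums can be exchanged.\<close>
  define E where "E = (\<Union>a\<in>F \<inter> S. N a)"
  have N: "finite (N a)" "card (N a) \<le> p" if "a \<in> S" for a
    using k that by (auto simp: banded_def N_def)
  have E: "finite E" "E \<subseteq> S" using F N by (auto simp: E_def N_def)
  have pt: "(cmod (kop S k v a))\<^sup>2 \<le> B\<^sup>2 * real p * (\<Sum>b\<in>E. if k a b \<noteq> 0 then (cmod (v b))\<^sup>2 else 0)"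
    if a: "a \<in> F \<inter> S" for a
  proof -
    have aS: "a \<in> S" using a by simp
    have "cmod (kop S k v a) \<le> (\<Sum>b\<in>N a. B * cmod (v b))"
      unfolding kop_eq_sum[OF k aS] N_def
      by (rule sum_norm_le) (use k aS in \<open>auto simp: norm_mult banded_def intro!: mult_right_mono\<close>)
    then have "(cmod (kop S k v a))\<^sup>2 \<le> (\<Sum>b\<in>N a. B * cmod (v b))\<^sup>2"
      by (simp add: power_mono)
    also have "\<dots> \<le> (\<Sum>b\<in>N a. (B * cmod (v b))\<^sup>2) * real (card (N a))"
      by (rule sum_squared_le_sum_of_squares)
    also have "\<dots> \<le> (\<Sum>b\<in>N a. (B * cmod (v b))\<^sup>2) * real p"
      using N(2)[OF aS] by (intro mult_left_mono) (auto intro: sum_nonneg)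
    also have "\<dots> = B\<^sup>2 * real p * (\<Sum>b\<in>N a. (cmod (v b))\<^sup>2)"
      by (simp add: power_mult_distrib sum_distrib_left[symmetric])
    also have "(\<Sum>b\<in>N a. (cmod (v b))\<^sup>2) = (\<Sum>b\<in>E. if k a b \<noteq> 0 then (cmod (v b))\<^sup>2 else 0)"
      by (rule sum.mono_neutral_cong_left[OF E(1)]) (use a in \<open>auto simp: E_def N_def\<close>)
    finally show ?thesis .
  qed
  have col: "(\<Sum>a\<in>F \<inter> S. if k a b \<noteq> 0 then (cmod (v b))\<^sup>2 else 0) \<le> real p * (cmod (v b))\<^sup>2"
    if b: "b \<in> E" for b
  proof -
    have "(\<Sum>a\<in>F \<inter> S. if k a b \<noteq> 0 then (cmod (v b))\<^sup>2 else 0)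
        = real (card {a\<in>F \<inter> S. k a b \<noteq> 0}) * (cmod (v b))\<^sup>2"
      using F by (simp add: sum.If_cases Int_def)
    also have "\<dots> \<le> real p * (cmod (v b))\<^sup>2"
    proof (intro mult_right_mono)
      have "card {a\<in>F \<inter> S. k a b \<noteq> 0} \<le> card {a\<in>S. k a b \<noteq> 0}"
        using k b E(2) by (intro card_mono) (auto simp: banded_def)
      also have "\<dots> \<le> p" using k b E(2) by (auto simp: banded_def)
      finally show "real (card {a\<in>F \<inter> S. k a b \<noteq> 0}) \<le> real p" by simp
    qed simp
    finally show ?thesis .
  qed
  have "(\<Sum>a\<in>F. (cmod (kop S k v a))\<^sup>2) = (\<Sum>a\<in>F \<inter> S. (cmod (kop S k v a))\<^sup>2)"
    by (rule sum.mono_neutral_right) (use F in \<open>auto simp: kop_def\<close>)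
  also have "\<dots> \<le> (\<Sum>a\<in>F \<inter> S. B\<^sup>2 * real p * (\<Sum>b\<in>E. if k a b \<noteq> 0 then (cmod (v b))\<^sup>2 else 0))"
    by (rule sum_mono[OF pt])
  also have "\<dots> = B\<^sup>2 * real p * (\<Sum>b\<in>E. \<Sum>a\<in>F \<inter> S. if k a b \<noteq> 0 then (cmod (v b))\<^sup>2 else 0)"
    by (subst sum.swap) (simp add: sum_distrib_left)
  also have "\<dots> \<le> B\<^sup>2 * real p * (\<Sum>b\<in>E. real p * (cmod (v b))\<^sup>2)"
    by (intro mult_left_mono sum_mono col) auto
  also have "\<dots> = (B * real p)\<^sup>2 * (\<Sum>b\<in>E. (cmod (v b))\<^sup>2)"
    by (simp add: sum_distrib_left[symmetric] power2_eq_square algebra_simps)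
  also have "\<dots> \<le> (B * real p)\<^sup>2 * (l2norm S v)\<^sup>2"
  proof (intro mult_left_mono)
    show "(\<Sum>b\<in>E. (cmod (v b))\<^sup>2) \<le> (l2norm S v)\<^sup>2"
      using sum_le_norm_ell2[OF E(1), of "Abs_ell2 v"]
      by (simp add: Abs_ell2_l2(2)[OF v] l2norm_eq_norm[OF v])
  qed simp
  finally show ?thesis by (simp add: power_mult_distrib)
qed

lemma kop_bounded:
  assumes k: "banded S B p k" and v: "v \<in> l2 S"
  shows "kop S k v \<in> l2 S" "l2norm S (kop S k v) \<le> B * real p * l2norm S v"
proof -
  have B: "0 \<le> B" using k by (simp add: banded_def)
  have "kop S k v \<in> l2 UNIV"
    by (rule l2_UNIV_I[OF kop_sum_bound[OF k v]])
  moreover have "\<forall>a. a \<notin> S \<longrightarrow> kop S k v a = 0" by (simp add: kop_def)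
  ultimately show l: "kop S k v \<in> l2 S" using l2_iff by blast
  show "l2norm S (kop S k v) \<le> B * real p * l2norm S v"
    unfolding l2norm_eq_norm[OF l]
  proof (rule norm_ell2_le)
    show "0 \<le> B * real p * l2norm S v" by (intro mult_nonneg_nonneg B l2norm_nonneg) simp
  qed (use kop_sum_bound[OF k v] in \<open>simp add: Abs_ell2_l2(2)[OF l]\<close>)
qed

lemma kop_has_kernel:
  assumes k: "banded S B p k"
  shows "has_kernel S (kop S k) k"
proof -
  have "kop S k (\<lambda>a. u a + c * v a) = (\<lambda>a. kop S k u a + c * kop S k v a)" for u v c
  proof
    fix a
    show "kop S k (\<lambda>a. u a + c * v a) a = kop S k u a + c * kop S k v a"
    proof (cases "a \<in> S")
      case True
      show ?thesis
        unfolding kop_eq_sum[OF k True] by (simp add: sum_distrib_left sum.distrib algebra_simps)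
    qed (simp add: kop_def)
  qed
  then have "bdd_op S (kop S k)"
    unfolding bdd_op_def using kop_bounded[OF k] by blast
  moreover have "kop S k (\<lambda>c. if c = b then 1 else 0) a = k a b" if "a \<in> S" "b \<in> S" for a b
  proof -
    have "(\<Sum>c\<in>{c\<in>S. k a c \<noteq> 0}. k a c * (if c = b then 1 else 0))
        = (\<Sum>c\<in>{c\<in>S. k a c \<noteq> 0}. if c = b then k a c else 0)"
      by (intro sum.cong) auto
    also have "\<dots> = k a b"
      using k that by (subst sum.delta) (auto simp: banded_def)
    finally show ?thesis unfolding kop_eq_sum[OF k that(1)] .
  qed
  ultimately show ?thesis by (simp add: has_kernel_def)
qed

lemma has_kernel_form_bound:
  assumes k: "has_kernel S T k" and F: "finite F" "F \<subseteq> S"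
    and C: "\<And>v. v \<in> l2 S \<Longrightarrow> l2norm S (T v) \<le> C * l2norm S v"
  shows "\<bar>kform k F v\<bar> \<le> C * (\<Sum>a\<in>F. (cmod (v a))\<^sup>2)"
proof -
  have T: "bdd_op S T" using k by (simp add: has_kernel_def)
  let ?x = "fin_ell2 F v"
  have x: "?x \<in> ell2_on S" by (rule fin_ell2_on[OF F])
  then have l: "ell2_fun ?x \<in> l2 S" by (simp add: ell2_on_iff)
  then have "T (ell2_fun ?x) \<in> l2 S" using T by (simp add: bdd_op_def)
  then have "norm (ell2_op T ?x) \<le> C * norm ?x"
    using C[OF l] by (simp add: l2norm_eq_norm[OF l] l2norm_eq_norm ell2_op_def ell2_fun_inverse)
  then have "norm ?x * norm (ell2_op T ?x) \<le> norm ?x * (C * norm ?x)"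
    by (rule mult_left_mono) simp
  also have "\<dots> = C * (norm ?x)\<^sup>2" by (simp add: power2_eq_square)
  finally show ?thesis
    unfolding kform_eq_inner[OF k F] norm_fin_ell2[OF F(1), symmetric]
    using Cauchy_Schwarz_ineq2[of ?x "ell2_op T ?x"] by linarith
qed

lemma banded_form_bound:
  assumes "banded F B p k" "finite F"
  shows "\<bar>kform k F v\<bar> \<le> B * real p * (\<Sum>a\<in>F. (cmod (v a))\<^sup>2)"
  by (rule has_kernel_form_bound[OF kop_has_kernel[OF assms(1)] assms(2) order_refl kop_bounded(2)[OF assms(1)]])

text \<open>Completeness of the space of bounded operators. The Cauchy condition is stated vector by
  vector, which is the shape in which the reduced norm delivers it.\<close>

lemma bdd_op_limit:
  assumes R: "\<And>n. bdd_op S (R n)"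
    and cauchy: "\<And>e. e > 0 \<Longrightarrow> \<exists>n0. \<forall>m\<ge>n0. \<forall>n\<ge>n0. \<forall>v\<in>l2 S.
      l2norm S (\<lambda>a. R m v a - R n v a) \<le> e * l2norm S v"
  shows "\<exists>T. bdd_op S T \<and> (\<forall>v. v \<notin> l2 S \<longrightarrow> T v = (\<lambda>a. 0)) \<and>
    (\<lambda>n. opnorm S (\<lambda>v a. R n v a - T v a)) \<longlonglongrightarrow> 0"
proof -
  have Rl2: "R n v \<in> l2 S" if "v \<in> l2 S" for n v using R that by (auto simp: bdd_op_def)
  have diff: "l2norm S (\<lambda>a. R m v a - R n v a) = norm (Abs_ell2 (R m v) - Abs_ell2 (R n v))"
    if "v \<in> l2 S" for m n v
  proof -
    have "(\<lambda>a. R m v a - R n v a) \<in> l2 S"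
      using bdd_op_diff[OF R R] that by (auto simp: bdd_op_def)
    moreover have "ell2_fun (Abs_ell2 (R m v) - Abs_ell2 (R n v)) = (\<lambda>a. R m v a - R n v a)"
      by (simp add: minus_ell2.rep_eq Abs_ell2_l2(2)[OF Rl2[OF that]])
    ultimately show ?thesis
      using l2norm_eq_norm[of "\<lambda>a. R m v a - R n v a" S]
        ell2_fun_inverse[of "Abs_ell2 (R m v) - Abs_ell2 (R n v)"] by simp
  qed
  define L where "L v = lim (\<lambda>n. Abs_ell2 (R n v))" for v
  have L: "(\<lambda>n. Abs_ell2 (R n v)) \<longlonglongrightarrow> L v" if v: "v \<in> l2 S" for v
  proof -
    have "Cauchy (\<lambda>n. Abs_ell2 (R n v))"
    proof (rule CauchyI)
      fix e :: real assume e: "e > 0"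
      \<comment> \<open>The summand 1 avoids division by zero for a vector of norm 0 and makes
        \<open>d * l2norm S v < e\<close> strict.\<close>
      define d where "d = e / (l2norm S v + 1)"
      have pos: "l2norm S v + 1 > 0" using l2norm_nonneg[of S v] by simp
      have "d > 0" using e pos by (simp add: d_def)
      then obtain n0 where n0: "\<forall>m\<ge>n0. \<forall>n\<ge>n0. \<forall>v\<in>l2 S. l2norm S (\<lambda>a. R m v a - R n v a) \<le> d * l2norm S v"
        using cauchy by blast
      have "d * l2norm S v < e"
        using e pos by (simp add: d_def divide_simps distrib_left)
      then have "norm (Abs_ell2 (R m v) - Abs_ell2 (R n v)) < e" if "m \<ge> n0" "n \<ge> n0" for m n
        using n0[rule_format, OF that v] diff[OF v, of m n] by linarith
      then show "\<exists>M. \<forall>m\<ge>M. \<forall>n\<ge>M. norm (Abs_ell2 (R m v) - Abs_ell2 (R n v)) < e" by blast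
    qed
    then show ?thesis
      unfolding L_def by (simp add: Cauchy_convergent_iff convergent_LIMSEQ_iff)
  qed
  have L_on: "L v \<in> ell2_on S" if "v \<in> l2 S" for v
    by (rule closed_sequentially[OF closed_ell2_on _ L[OF that]]) (rule Abs_ell2_l2(1)[OF Rl2[OF that]])
  \<comment> \<open>The value 0 outside \<open>l2 S\<close> matches the normalisation in
    \<open>Hop\<close>.\<close>
  define T where "T v = (if v \<in> l2 S then ell2_fun (L v) else (\<lambda>a. 0))" for v
  have Tv: "T v = ell2_fun (L v)" if "v \<in> l2 S" for v using that by (simp add: T_def)
  have Tl2: "T v \<in> l2 S" if "v \<in> l2 S" for v using L_on[OF that] by (simp add: Tv[OF that] ell2_on_iff)
  have pt: "(\<lambda>n. R n v a) \<longlonglongrightarrow> T v a" if "v \<in> l2 S" for v a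
    using tendsto_ell2_fun[OF L[OF that], of a] by (simp add: Tv[OF that] Abs_ell2_l2(2)[OF Rl2[OF that]])
  have conv: "l2norm S (\<lambda>a. R n v a - T v a) \<le> e * l2norm S v"
    if v: "v \<in> l2 S" and n: "n \<ge> n0"
      and n0: "\<forall>m\<ge>n0. \<forall>n\<ge>n0. \<forall>v\<in>l2 S. l2norm S (\<lambda>a. R m v a - R n v a) \<le> e * l2norm S v" for n n0 v e
  proof -
    have eq: "ell2_fun (Abs_ell2 (R n v) - L v) = (\<lambda>a. R n v a - T v a)"
      by (simp add: minus_ell2.rep_eq Abs_ell2_l2(2)[OF Rl2[OF v]] Tv[OF v])
    moreover have "Abs_ell2 (R n v) - L v \<in> ell2_on S"
      by (intro subspace_diff[OF subspace_ell2_on] L_on v Abs_ell2_l2(1) Rl2)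
    ultimately have "(\<lambda>a. R n v a - T v a) \<in> l2 S" by (simp add: ell2_on_iff)
    from l2norm_eq_norm[OF this] have "l2norm S (\<lambda>a. R n v a - T v a) = norm (Abs_ell2 (R n v) - L v)"
      unfolding eq[symmetric] by (simp add: ell2_fun_inverse)
    also have "\<dots> \<le> e * l2norm S v"
    proof (rule LIMSEQ_le_const2)
      show "(\<lambda>m. norm (Abs_ell2 (R n v) - Abs_ell2 (R m v))) \<longlonglongrightarrow> norm (Abs_ell2 (R n v) - L v)"
        by (intro tendsto_intros L v)
      have "norm (Abs_ell2 (R n v) - Abs_ell2 (R m v)) \<le> e * l2norm S v" if "m \<ge> n0" for m
        using n0[rule_format, OF n that v] diff[OF v, of n m] by linarith
      then show "\<exists>N. \<forall>m\<ge>N. norm (Abs_ell2 (R n v) - Abs_ell2 (R m v)) \<le> e * l2norm S v" by blast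
    qed
    finally show ?thesis .
  qed
  have "bdd_op S T"
    unfolding bdd_op_def
  proof (intro conjI ballI allI Tl2)
    fix u v c assume uv: "u \<in> l2 S" "v \<in> l2 S"
    have "(\<lambda>a. c * v a) \<in> l2 S"
      using uv(2) l2_UNIV_mult[of v c] l2_iff[of v S] l2_iff[of "\<lambda>a. c * v a" S] by simp
    then have w: "(\<lambda>a. u a + c * v a) \<in> l2 S"
      using uv(1) l2_UNIV_add[of u "\<lambda>a. c * v a"] l2_iff[of u S] l2_iff[of "\<lambda>a. c * v a" S]
        l2_iff[of "\<lambda>a. u a + c * v a" S] by simp
    show "T (\<lambda>a. u a + c * v a) = (\<lambda>a. T u a + c * T v a)"
    proof
      fix a
      have "(\<lambda>n. R n (\<lambda>a. u a + c * v a) a) \<longlonglongrightarrow> T u a + c * T v a"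
        unfolding bdd_op_linear[OF R uv] by (intro tendsto_intros pt uv)
      then show "T (\<lambda>a. u a + c * v a) a = T u a + c * T v a"
        using pt[OF w] LIMSEQ_unique by blast
    qed
  next
    obtain n0 where n0: "\<forall>m\<ge>n0. \<forall>n\<ge>n0. \<forall>v\<in>l2 S. l2norm S (\<lambda>a. R m v a - R n v a) \<le> 1 * l2norm S v"
      using cauchy[of 1] by auto
    obtain C where C: "\<forall>v\<in>l2 S. l2norm S (R n0 v) \<le> C * l2norm S v" using R[of n0] by (auto simp: bdd_op_def)
    show "\<exists>C. \<forall>v\<in>l2 S. l2norm S (T v) \<le> C * l2norm S v"
    proof (intro exI[of _ "C + 1"] ballI)
      fix v assume v: "v \<in> l2 S"
      have eq: "ell2_fun (Abs_ell2 (R n0 v) - L v) = (\<lambda>a. R n0 v a - T v a)"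
        by (simp add: minus_ell2.rep_eq Abs_ell2_l2(2)[OF Rl2[OF v]] Tv[OF v])
      have "Abs_ell2 (R n0 v) - L v \<in> ell2_on S"
        by (intro subspace_diff[OF subspace_ell2_on] L_on v Abs_ell2_l2(1) Rl2)
      then have "(\<lambda>a. R n0 v a - T v a) \<in> l2 S" by (simp add: ell2_on_iff eq)
      from l2norm_eq_norm[OF this] conv[OF v order_refl n0]
      have 1: "norm (Abs_ell2 (R n0 v) - L v) \<le> l2norm S v"
        unfolding eq[symmetric] by (simp add: ell2_fun_inverse)
      have "l2norm S (T v) = norm (L v)"
        using l2norm_eq_norm[OF Tl2[OF v]] by (simp add: Tv[OF v] ell2_fun_inverse)
      also have "\<dots> \<le> norm (Abs_ell2 (R n0 v)) + norm (Abs_ell2 (R n0 v) - L v)"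
        using norm_triangle_ineq4[of "Abs_ell2 (R n0 v)" "Abs_ell2 (R n0 v) - L v"] by simp
      also have "\<dots> \<le> C * l2norm S v + l2norm S v"
        using 1 C[rule_format, OF v] l2norm_eq_norm[OF Rl2[OF v], of n0] by linarith
      finally show "l2norm S (T v) \<le> (C + 1) * l2norm S v" by (simp add: distrib_right)
    qed
  qed
  moreover have "T v = (\<lambda>a. 0)" if "v \<notin> l2 S" for v using that by (simp add: T_def)
  moreover have "(\<lambda>n. opnorm S (\<lambda>v a. R n v a - T v a)) \<longlonglongrightarrow> 0"
  proof (rule LIMSEQ_I)
    fix e :: real assume e: "e > 0"
    obtain n0 where n0: "\<forall>m\<ge>n0. \<forall>n\<ge>n0. \<forall>v\<in>l2 S. l2norm S (\<lambda>a. R m v a - R n v a) \<le> e/2 * l2norm S v"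
      using cauchy[of "e/2"] e by auto
    have "norm (opnorm S (\<lambda>v a. R n v a - T v a) - 0) < e" if "n \<ge> n0" for n
    proof -
      let ?D = "\<lambda>v a. R n v a - T v a"
      have "opnorm S ?D \<le> e/2"
        by (rule opnorm_le) (use conv[OF _ that n0] e in auto)
      \<comment> \<open>A real \<open>Sup\<close> dominates its members only if the set is bounded
        above; the member used is the one given by the zero vector.\<close>
      moreover have "0 \<le> opnorm S ?D"
      proof -
        have "bdd_above {l2norm S (?D v) |v. v \<in> l2 S \<and> l2norm S v \<le> 1}"
        proof (rule bdd_aboveI[of _ "e/2"])
          fix t assume "t \<in> {l2norm S (?D v) |v. v \<in> l2 S \<and> l2norm S v \<le> 1}"
          then obtain v where v: "v \<in> l2 S" "l2norm S v \<le> 1" "t = l2norm S (?D v)" by auto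
          then have "t \<le> e/2 * l2norm S v" using conv[OF _ that n0] by blast
          also have "\<dots> \<le> e/2 * 1" using v e by (intro mult_left_mono) auto
          finally show "t \<le> e/2" by simp
        qed
        moreover have "l2norm S (?D (\<lambda>a. 0)) \<in> {l2norm S (?D v) |v. v \<in> l2 S \<and> l2norm S v \<le> 1}"
          using l2_zero[of S] by (force simp: l2norm_def)
        ultimately have "l2norm S (?D (\<lambda>a. 0)) \<le> opnorm S ?D"
          unfolding opnorm_def by (intro cSup_upper)
        then show ?thesis using l2norm_nonneg[of S "?D (\<lambda>a. 0)"] by linarith
      qed
      ultimately show ?thesis using e by simp
    qed
    then show "\<exists>no. \<forall>n\<ge>no. norm (opnorm S (\<lambda>v a. R n v a - T v a) - 0) < e" by blast
  qed
  ultimately show ?thesis by blast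
qed

text \<open>For \<open>v\<close> supported in \<open>S\<close>, the smaller operator is the
  compression of the larger one: its output agrees with that of \<open>kop S' k\<close> on
  \<open>S\<close>, and dropping the remaining coordinates cannot raise the norm.\<close>

lemma kop_restrict_norm:
  assumes S: "S \<subseteq> S'" and k: "banded S' B p k" and k0: "banded S B p k" and v: "v \<in> l2 S"
  shows "l2norm S (kop S k v) \<le> l2norm S' (kop S' k v)"
proof -
  have v': "v \<in> l2 S'" using v S l2_iff[of v S] l2_iff[of v S'] by auto
  have v0: "\<And>b. b \<notin> S \<Longrightarrow> v b = 0" using v by (simp add: l2_def)
  have eq: "kop S k v a = kop S' k v a" if "a \<in> S" for a
  proof -
    have "(\<Sum>\<^sub>\<infinity>b\<in>S. k a b * v b) = (\<Sum>\<^sub>\<infinity>b\<in>S'. k a b * v b)"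
      by (rule infsum_cong_neutral) (use S v0 in auto)
    then show ?thesis using that S by (auto simp: kop_def)
  qed
  note l = kop_bounded(1)[OF k0 v] and l' = kop_bounded(1)[OF k v']
  have le: "(cmod (kop S k v a))\<^sup>2 \<le> (cmod (kop S' k v a))\<^sup>2" for a
    using eq[of a] by (cases "a \<in> S") (auto simp: kop_def)
  show ?thesis
    unfolding l2norm_eq_norm[OF l]
  proof (rule norm_ell2_le)
    fix F :: "'a set" assume F: "finite F"
    have "(\<Sum>a\<in>F. (cmod (kop S k v a))\<^sup>2) \<le> (\<Sum>a\<in>F. (cmod (kop S' k v a))\<^sup>2)"
      by (rule sum_mono[OF le])
    also have "\<dots> \<le> (l2norm S' (kop S' k v))\<^sup>2"
      using sum_le_norm_ell2[OF F, of "Abs_ell2 (kop S' k v)"]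
      by (simp add: Abs_ell2_l2(2)[OF l'] l2norm_eq_norm[OF l'])
    finally show "(\<Sum>a\<in>F. (cmod (ell2_fun (Abs_ell2 (kop S k v)) a))\<^sup>2) \<le> (l2norm S' (kop S' k v))\<^sup>2"
      by (simp add: Abs_ell2_l2(2)[OF l])
  qed (rule l2norm_nonneg)
qed

lemma kop_diff:
  assumes "banded S B p k" "banded S B' p' k'"
  shows "kop S (\<lambda>a b. k a b - k' a b) v = (\<lambda>a. kop S k v a - kop S k' v a)"
proof
  fix a
  show "kop S (\<lambda>a b. k a b - k' a b) v a = kop S k v a - kop S k' v a"
  proof (cases "a \<in> S")
    case True
    let ?E = "{b\<in>S. k a b \<noteq> 0} \<union> {b\<in>S. k' a b \<noteq> 0}"
    have E: "finite ?E" using assms True by (auto simp: banded_def)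
    have *: "(\<Sum>\<^sub>\<infinity>b\<in>S. w b * v b) = (\<Sum>b\<in>?E. w b * v b)"
      if "\<And>b. b \<in> S - ?E \<Longrightarrow> w b = 0" for w
    proof -
      have "(\<Sum>\<^sub>\<infinity>b\<in>S. w b * v b) = (\<Sum>\<^sub>\<infinity>b\<in>?E. w b * v b)"
        by (rule infsum_cong_neutral) (use that in auto)
      then show ?thesis using E by simp
    qed
    have "(\<Sum>\<^sub>\<infinity>b\<in>S. (k a b - k' a b) * v b) = (\<Sum>\<^sub>\<infinity>b\<in>S. k a b * v b) - (\<Sum>\<^sub>\<infinity>b\<in>S. k' a b * v b)"
      by (subst (1 2 3) *) (auto simp: left_diff_distrib sum_subtractf)
    then show ?thesis using True by (simp add: kop_def)
  qed (simp add: kop_def)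
qed

lemma opnorm_tendsto_pointwise:
  assumes R: "\<And>n. bdd_op S (R n)" and T: "bdd_op S T"
    and lim: "(\<lambda>n. opnorm S (\<lambda>v a. R n v a - T v a)) \<longlonglongrightarrow> 0" and v: "v \<in> l2 S"
  shows "(\<lambda>n. R n v a) \<longlonglongrightarrow> T v a"
proof -
  have D: "bdd_op S (\<lambda>v a. R n v a - T v a)" for n by (rule bdd_op_diff[OF R T])
  have bound: "cmod (R n v a - T v a) \<le> opnorm S (\<lambda>v a. R n v a - T v a) * l2norm S v" for n
  proof -
    have l: "(\<lambda>a. R n v a - T v a) \<in> l2 S" using D[of n] v by (auto simp: bdd_op_def)
    have "cmod (R n v a - T v a) \<le> l2norm S (\<lambda>a. R n v a - T v a)"
      using coord_le_norm_ell2[of "Abs_ell2 (\<lambda>a. R n v a - T v a)" a]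
      unfolding l2norm_eq_norm[OF l] Abs_ell2_l2(2)[OF l] .
    also have "\<dots> \<le> opnorm S (\<lambda>v a. R n v a - T v a) * l2norm S v"
      by (rule l2norm_le_opnorm[OF D v])
    finally show ?thesis .
  qed
  have lim0: "(\<lambda>n. opnorm S (\<lambda>v a. R n v a - T v a) * l2norm S v) \<longlonglongrightarrow> 0"
    using tendsto_mult_right[OF lim, of "l2norm S v"] by simp
  have "(\<lambda>n. R n v a - T v a) \<longlonglongrightarrow> 0"
    by (rule Lim_null_comparison[OF always_eventually lim0]) (use bound in auto)
  then show ?thesis by (rule LIM_zero_cancel)
qed

lemma kform_diff: "kform (\<lambda>a b. k a b - k' a b) F v = kform k F v - kform k' F v"
  unfolding kform_def sum_subtractf[symmetric] by (intro sum.cong refl) (simp add: algebra_simps)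

section \<open>Groupoid kernels\<close>

text \<open>Second countability lets the compactness arguments run with sequences: compact sets are
  sequentially compact, and a compact set has a suitable sequence of neighbourhoods.\<close>

locale manageable_groupoid =
  fixes G :: "('g::{t2_space, second_countable_topology}) groupoid"
  assumes manageable: "manageable G"
begin

abbreviation "d \<equiv> gdom G"
abbreviation "r \<equiv> grng G"
abbreviation "X \<equiv> unit_space G"

definition quot :: "'g \<Rightarrow> 'g \<Rightarrow> 'g" where
  "quot a b = gmult G a (ginv G b)"

definition fib :: "'g \<Rightarrow> 'g set" where
  "fib x = {a. d a = x}"

text \<open>The matrix of convolution by \<open>f\<close>. It mentions neither the fibre nor the set
  \<open>N\<close>, so passing to another \<open>N\<close> only changes the index set.\<close>

definition gker :: "('g \<Rightarrow> complex) \<Rightarrow> 'g \<Rightarrow> 'g \<Rightarrow> complex" where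
  "gker f a b = f (quot a b)"

section \<open>Algebra of quotients in the groupoid\<close>

lemma is_groupoid: "is_groupoid G"
  using manageable by (simp add: manageable_def)

lemma unit_simps [simp]: "r (r a) = r a" "d (r a) = r a" "r (d a) = d a" "d (d a) = d a"
  using is_groupoid by (auto simp: is_groupoid_def)

lemma mult_rd:
  "d a = r b \<Longrightarrow> r (gmult G a b) = r a" "d a = r b \<Longrightarrow> d (gmult G a b) = d b"
  using is_groupoid by (auto simp: is_groupoid_def)

lemma mult_assoc:
  "d a = r b \<Longrightarrow> d b = r c \<Longrightarrow> gmult G (gmult G a b) c = gmult G a (gmult G b c)"
  using is_groupoid by (auto simp: is_groupoid_def)

lemma mult_unit [simp]: "gmult G (r a) a = a" "gmult G a (d a) = a"
  using is_groupoid by (auto simp: is_groupoid_def)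

lemma inv_simps [simp]: "r (ginv G a) = d a" "d (ginv G a) = r a"
  "gmult G a (ginv G a) = r a" "gmult G (ginv G a) a = d a"
  using is_groupoid by (auto simp: is_groupoid_def)

lemma inv_unique:
  assumes "d a = r b" "gmult G a b = r a"
  shows "b = ginv G a"
proof -
  have "b = gmult G (gmult G (ginv G a) a) b" using assms by simp
  also have "\<dots> = gmult G (ginv G a) (r a)" using assms mult_assoc[of "ginv G a" a b] by simp
  also have "\<dots> = ginv G a" using mult_unit(2)[of "ginv G a"] by simp
  finally show ?thesis .
qed

lemma inv_inv [simp]: "ginv G (ginv G a) = a"
  using inv_unique[of "ginv G a" a] by simp

lemma quot_rd: "d a = d b \<Longrightarrow> r (quot a b) = r a" "d a = d b \<Longrightarrow> d (quot a b) = r b"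
  using mult_rd[of a "ginv G b"] by (auto simp: quot_def)

lemma mult_quot:
  assumes "d a = d z" "d z = d b"
  shows "gmult G (quot a z) (quot z b) = quot a b"
proof -
  have "gmult G (quot a z) (quot z b) = gmult G a (gmult G (ginv G z) (gmult G z (ginv G b)))"
    unfolding quot_def using assms mult_rd(1)[of z "ginv G b"]
      mult_assoc[of a "ginv G z" "gmult G z (ginv G b)"] by simp
  also have "gmult G (ginv G z) (gmult G z (ginv G b)) = gmult G (d z) (ginv G b)"
    using assms mult_assoc[of "ginv G z" z "ginv G b"] by simp
  also have "\<dots> = ginv G b" using assms mult_unit(1)[of "ginv G b"] by simp
  finally show ?thesis by (simp add: quot_def)
qed

lemma quot_self [simp]: "quot a a = r a"
  by (simp add: quot_def)

lemma inv_quot: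
  assumes "d a = d b"
  shows "ginv G (quot a b) = quot b a"
proof (rule inv_unique[symmetric])
  show "d (quot a b) = r (quot b a)" using assms by (simp add: quot_rd)
  show "gmult G (quot a b) (quot b a) = r (quot a b)" using assms by (simp add: quot_rd mult_quot)
qed

text \<open>Right translation invariance of all kernels \<open>gker f\<close>: a form on the fibre
  of \<open>d z\<close> equals the translated form on the fibre of \<open>r z\<close>.\<close>

lemma quot_quot:
  assumes "d a = d z" "d b = d z"
  shows "quot (quot a z) (quot b z) = quot a b"
proof -
  have "quot (quot a z) (quot b z) = gmult G (quot a z) (quot z b)"
    using inv_quot[of b z] assms by (simp add: quot_def[of "quot a z"])
  also have "\<dots> = quot a b" by (rule mult_quot) (use assms in auto)
  finally show ?thesis .
qed

lemma quot_mult: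
  assumes "d a = d b"
  shows "gmult G (quot a b) b = a"
  using mult_assoc[of a "ginv G b" b] assms mult_unit(2)[of a] by (simp add: quot_def)

lemma quot_inj_left: "d a = d b \<Longrightarrow> d a' = d b \<Longrightarrow> quot a b = quot a' b \<Longrightarrow> a = a'"
  by (metis quot_mult)

lemma quot_inj_right: "d b = d a \<Longrightarrow> d b' = d a \<Longrightarrow> quot a b = quot a b' \<Longrightarrow> b = b'"
  using inv_quot quot_inj_left by metis

lemma d_in_X [simp]: "d a \<in> X" and r_in_X [simp]: "r a \<in> X"
  unfolding unit_space_def using unit_simps(3) by (metis rangeI)+

lemma X_unit: "x \<in> X \<Longrightarrow> r x = x" "x \<in> X \<Longrightarrow> d x = x"
  by (auto simp: unit_space_def)

section \<open>Compact sets and their intersections with fibres\<close>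

lemma continuous_d: "continuous_on UNIV d" and continuous_r: "continuous_on UNIV r"
  and continuous_inv: "continuous_on UNIV (ginv G)"
  and continuous_mult: "continuous_on {(a,b). d a = r b} (\<lambda>(a,b). gmult G a b)"
  and compact_X: "compact X"
  using manageable by (auto simp: manageable_def)

lemma local_injectivity: "\<exists>U. open U \<and> a \<in> U \<and> inj_on d U"
proof -
  have "etale G" using manageable by (simp add: manageable_def)
  then obtain U where U: "open U" "a \<in> U"
    "homeomorphic_map (top_of_set U) (top_of_set (d ` U)) d"
    unfolding etale_def by blast
  then have "inj_on d U" by (simp add: homeomorphic_eq_everything_map)
  with U show ?thesis by blast
qed

text \<open>Finitely many open sets on which \<open>d\<close> is injective cover \<open>K\<close>,
  and each contains at most one point of a given fibre. Their number is a bound for all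
  fibres.\<close>

lemma compact_fiber_card:
  assumes "compact K"
  shows "\<exists>p. \<forall>x. finite {a\<in>K. d a = x} \<and> card {a\<in>K. d a = x} \<le> p"
proof -
  obtain U where U: "\<And>a. open (U a)" "\<And>a. a \<in> U a" "\<And>a. inj_on d (U a)"
    using local_injectivity by metis
  obtain A where A: "A \<subseteq> K" "finite A" "K \<subseteq> (\<Union>a\<in>A. U a)"
    by (rule compactE_image[OF assms, of K U]) (use U in auto)
  have "finite {a\<in>K. d a = x} \<and> card {a\<in>K. d a = x} \<le> card A" for x
  proof -
    have "\<forall>a\<in>{a\<in>K. d a = x}. \<exists>c\<in>A. a \<in> U c" using A by auto
    then obtain s where s: "\<And>a. a \<in> K \<Longrightarrow> d a = x \<Longrightarrow> s a \<in> A \<and> a \<in> U (s a)"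
      by (metis (mono_tags, lifting) mem_Collect_eq)
    have inj: "inj_on s {a\<in>K. d a = x}"
    proof (rule inj_onI)
      fix a b assume ab: "a \<in> {a\<in>K. d a = x}" "b \<in> {a\<in>K. d a = x}" "s a = s b"
      then have "a \<in> U (s a)" "b \<in> U (s a)" "d a = d b" using s by force+
      then show "a = b" using U(3) by (auto dest: inj_onD)
    qed
    have sub: "s ` {a\<in>K. d a = x} \<subseteq> A" using s by auto
    show ?thesis
      using inj_on_finite[OF inj sub A(2)] card_inj_on_le[OF inj sub A(2)] by simp
  qed
  then show ?thesis by blast
qed

lemma compact_range_fiber_card:
  assumes "compact K"
  shows "\<exists>p. \<forall>x. finite {a\<in>K. r a = x} \<and> card {a\<in>K. r a = x} \<le> p"
proof -
  have "compact (ginv G ` K)"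
    by (rule compact_continuous_image[OF continuous_on_subset[OF continuous_inv] assms]) simp
  then obtain p where p: "\<And>x. finite {a\<in>ginv G ` K. d a = x}" "\<And>x. card {a\<in>ginv G ` K. d a = x} \<le> p"
    using compact_fiber_card by blast
  have "finite {a\<in>K. r a = x} \<and> card {a\<in>K. r a = x} \<le> p" for x
  proof -
    have inj: "inj_on (ginv G) {a\<in>K. r a = x}" by (rule inj_onI) (metis inv_inv)
    have sub: "ginv G ` {a\<in>K. r a = x} \<subseteq> {a\<in>ginv G ` K. d a = x}" by auto
    show ?thesis
      using inj_on_finite[OF inj sub p(1)] order_trans[OF card_inj_on_le[OF inj sub p(1)] p(2)] by simp
  qed
  then show ?thesis by blast
qed

text \<open>Here \<open>f\<close> is an arbitrary two-variable kernel supported where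
  \<open>quot a b\<close> lies in \<open>K\<close>, and \<open>S\<close> any part of a fibre; the
  localisation applies it to a weighted kernel on a finite set. The constant \<open>p\<close>
  depends on \<open>K\<close> alone.\<close>

lemma banded_gker:
  assumes "compact K"
  shows "\<exists>p. \<forall>S x B f. S \<subseteq> fib x \<longrightarrow> 0 \<le> B \<longrightarrow> (\<forall>a\<in>S. \<forall>b\<in>S. cmod (f a b) \<le> B) \<longrightarrow>
    (\<forall>a\<in>S. \<forall>b\<in>S. f a b \<noteq> 0 \<longrightarrow> quot a b \<in> K) \<longrightarrow> banded S B p f"
proof -
  obtain p1 where p1: "\<And>x. finite {a\<in>K. d a = x}" "\<And>x. card {a\<in>K. d a = x} \<le> p1"
    using compact_fiber_card[OF assms] by blast
  obtain p2 where p2: "\<And>x. finite {a\<in>K. r a = x}" "\<And>x. card {a\<in>K. r a = x} \<le> p2"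
    using compact_range_fiber_card[OF assms] by blast
  show ?thesis
  proof (intro exI[of _ "max p1 p2"] allI impI)
    fix S x B and f :: "'g \<Rightarrow> 'g \<Rightarrow> complex"
    assume S: "S \<subseteq> fib x" and B: "0 \<le> B" and bd: "\<forall>a\<in>S. \<forall>b\<in>S. cmod (f a b) \<le> B"
      and supp: "\<forall>a\<in>S. \<forall>b\<in>S. f a b \<noteq> 0 \<longrightarrow> quot a b \<in> K"
    have dS: "\<And>a. a \<in> S \<Longrightarrow> d a = x" using S by (auto simp: fib_def)
    have row: "finite {b\<in>S. f a b \<noteq> 0} \<and> card {b\<in>S. f a b \<noteq> 0} \<le> max p1 p2" if a: "a \<in> S" for a
    proof -
      have inj: "inj_on (quot a) {b\<in>S. f a b \<noteq> 0}"
      proof (rule inj_onI)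
        fix b b' assume "b \<in> {b\<in>S. f a b \<noteq> 0}" "b' \<in> {b\<in>S. f a b \<noteq> 0}" "quot a b = quot a b'"
        then show "b = b'" using quot_inj_right[of b a b'] dS[of b] dS[of b'] dS[OF a] by simp
      qed
      have sub: "quot a ` {b\<in>S. f a b \<noteq> 0} \<subseteq> {c\<in>K. r c = r a}"
        using supp a dS by (auto simp: quot_rd)
      show ?thesis
        using inj_on_finite[OF inj sub p2(1)] order_trans[OF card_inj_on_le[OF inj sub p2(1)] p2(2)] by simp
    qed
    have col: "finite {a\<in>S. f a b \<noteq> 0} \<and> card {a\<in>S. f a b \<noteq> 0} \<le> max p1 p2" if b: "b \<in> S" for b
    proof -
      have inj: "inj_on (\<lambda>a. quot a b) {a\<in>S. f a b \<noteq> 0}"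
      proof (rule inj_onI)
        fix a a' assume "a \<in> {a\<in>S. f a b \<noteq> 0}" "a' \<in> {a\<in>S. f a b \<noteq> 0}" "quot a b = quot a' b"
        then show "a = a'" using quot_inj_left[of a b a'] dS[of a] dS[of a'] dS[OF b] by simp
      qed
      have sub: "(\<lambda>a. quot a b) ` {a\<in>S. f a b \<noteq> 0} \<subseteq> {c\<in>K. d c = r b}"
        using supp b dS by (auto simp: quot_rd)
      show ?thesis
        using inj_on_finite[OF inj sub p1(1)] order_trans[OF card_inj_on_le[OF inj sub p1(1)] p1(2)] by simp
    qed
    show "banded S B (max p1 p2) f"
      unfolding banded_def using B bd row col by blast
  qed
qed

section \<open>Regular representations of compactly supported functions\<close>

lemma XiN_X [simp]: "XiN G X = UNIV"
  by (auto simp: XiN_def)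

lemma fiberN_X [simp]: "fiberN G X x = fib x"
  by (simp add: fiberN_def fib_def)

lemma fiberN_subset: "fiberN G N x \<subseteq> fib x"
  by (auto simp: fiberN_def fib_def)

lemma quot_fiberN: "a \<in> fiberN G N x \<Longrightarrow> b \<in> fiberN G N x \<Longrightarrow> quot a b \<in> XiN G N"
  by (auto simp: fiberN_def XiN_def quot_rd)

lemma Cc_bounded:
  fixes f :: "'g \<Rightarrow> 'b::real_normed_vector"
  assumes "f \<in> Cc_on S"
  shows "\<exists>K B. compact K \<and> K \<subseteq> S \<and> 0 \<le> B \<and> (\<forall>a\<in>S. norm (f a) \<le> B) \<and> (\<forall>a\<in>S. f a \<noteq> 0 \<longrightarrow> a \<in> K)"
proof -
  obtain K where K: "compact K" "K \<subseteq> S" "\<forall>a\<in>S - K. f a = 0" and c: "continuous_on S f"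
    using assms by (auto simp: Cc_on_def)
  have "bounded (f ` K)"
    by (intro compact_imp_bounded compact_continuous_image continuous_on_subset[OF c] K)
  then obtain B where B: "B > 0" "\<forall>y\<in>f ` K. norm y \<le> B" by (auto simp: bounded_pos)
  have "norm (f a) \<le> B" if "a \<in> S" for a
    using that B K by (cases "a \<in> K") auto
  then show ?thesis using B K by (intro exI[of _ K] exI[of _ B]) auto
qed

text \<open>The constants are the same for all \<open>x\<close>, which makes the supremum in
  \<open>red_norm\<close> a supremum of a bounded set.\<close>

lemma Cc_banded:
  assumes "f \<in> Cc_on (XiN G N)"
  shows "\<exists>B p. \<forall>x. banded (fiberN G N x) B p (gker f)"
proof -
  obtain K B where K: "compact K" "0 \<le> B" "\<forall>a\<in>XiN G N. norm (f a) \<le> B"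
    "\<forall>a\<in>XiN G N. f a \<noteq> 0 \<longrightarrow> a \<in> K"
    using Cc_bounded[OF assms] by blast
  obtain p where p: "\<forall>S x B f. S \<subseteq> fib x \<longrightarrow> 0 \<le> B \<longrightarrow> (\<forall>a\<in>S. \<forall>b\<in>S. cmod (f a b) \<le> B) \<longrightarrow>
    (\<forall>a\<in>S. \<forall>b\<in>S. f a b \<noteq> 0 \<longrightarrow> quot a b \<in> K) \<longrightarrow> banded S B p f"
    using banded_gker[OF K(1)] by blast
  have "banded (fiberN G N x) B p (gker f)" for x
    by (rule p[rule_format, OF fiberN_subset K(2)]) (use K quot_fiberN in \<open>auto simp: gker_def\<close>)
  then show ?thesis by blast
qed

lemma reg_rep_eq_kop: "reg_rep G N x f = kop (fiberN G N x) (gker f)"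
  by (simp add: reg_rep_def kop_def gker_def quot_def fun_eq_iff)

lemma Cc_diff:
  fixes f g :: "'g \<Rightarrow> complex"
  assumes "f \<in> Cc_on S" "g \<in> Cc_on S"
  shows "(\<lambda>a. f a - g a) \<in> Cc_on S"
proof -
  obtain K where K: "compact K" "K \<subseteq> S" "\<forall>a\<in>S - K. f a = 0" and c: "continuous_on S f"
    using assms(1) by (auto simp: Cc_on_def)
  obtain L where L: "compact L" "L \<subseteq> S" "\<forall>a\<in>S - L. g a = 0" and c': "continuous_on S g"
    using assms(2) by (auto simp: Cc_on_def)
  have "compact (K \<union> L) \<and> K \<union> L \<subseteq> S \<and> (\<forall>a\<in>S - (K \<union> L). f a - g a = 0)"
    using K L by (auto simp: compact_Un)
  then show ?thesis using continuous_on_diff[OF c c'] unfolding Cc_on_def by blast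
qed

lemma opnorm_le_red_norm:
  assumes f: "f \<in> Cc_on UNIV" and x: "x \<in> X"
  shows "opnorm (fib x) (kop (fib x) (gker f)) \<le> red_norm G X f"
proof -
  have f': "f \<in> Cc_on (XiN G X)" using f by simp
  obtain B p where "\<And>x. banded (fiberN G X x) B p (gker f)"
    using Cc_banded[OF f'] by blast
  then have b: "\<And>x. banded (fib x) B p (gker f)" by simp
  have "opnorm (fib x) (kop (fib x) (gker f)) \<le> B * real p" for x
    by (rule opnorm_le[OF kop_bounded(2)[OF b]]) (use b[of x] in \<open>auto simp: banded_def\<close>)
  then have "bdd_above {opnorm (fiberN G X x) (reg_rep G X x f) | x. x \<in> X}"
    by (intro bdd_aboveI[of _ "B * real p"]) (auto simp: reg_rep_eq_kop)
  then show ?thesis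
    unfolding red_norm_def by (intro cSup_upper) (use x in \<open>auto simp: reg_rep_eq_kop\<close>)
qed

text \<open>The norm taken over the full fibres also controls compressions to parts of fibres. A
  sequence that is Cauchy in \<open>red_norm\<close> over \<open>X\<close> is thus Cauchy on every
  \<open>fiberN G N x\<close> with \<open>x \<in> X\<close>.\<close>

lemma kop_le_red_norm:
  assumes f: "f \<in> Cc_on UNIV" and x: "x \<in> X" and S: "S \<subseteq> fib x" and v: "v \<in> l2 S"
  shows "l2norm S (kop S (gker f) v) \<le> red_norm G X f * l2norm S v"
proof -
  have f': "f \<in> Cc_on (XiN G X)" using f by simp
  obtain B p where b0: "\<And>x. banded (fiberN G X x) B p (gker f)"
    using Cc_banded[OF f'] by blast
  then have b: "banded (fib x) B p (gker f)" by simp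
  have bS: "banded S B p (gker f)"
  proof -
    have "finite {b\<in>S. gker f a b \<noteq> 0} \<and> card {b\<in>S. gker f a b \<noteq> 0} \<le> p"
      and "finite {b\<in>S. gker f b a \<noteq> 0} \<and> card {b\<in>S. gker f b a \<noteq> 0} \<le> p" if "a \<in> S" for a
    proof -
      have sub: "{b\<in>S. gker f a b \<noteq> 0} \<subseteq> {b\<in>fib x. gker f a b \<noteq> 0}"
        "{b\<in>S. gker f b a \<noteq> 0} \<subseteq> {b\<in>fib x. gker f b a \<noteq> 0}" using S by auto
      have fin: "finite {b\<in>fib x. gker f a b \<noteq> 0}" "card {b\<in>fib x. gker f a b \<noteq> 0} \<le> p"
        "finite {b\<in>fib x. gker f b a \<noteq> 0}" "card {b\<in>fib x. gker f b a \<noteq> 0} \<le> p"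
        using b that S by (auto simp: banded_def subset_iff)
      show "finite {b\<in>S. gker f a b \<noteq> 0} \<and> card {b\<in>S. gker f a b \<noteq> 0} \<le> p"
        using finite_subset[OF sub(1) fin(1)] order_trans[OF card_mono[OF fin(1) sub(1)] fin(2)] by simp
      show "finite {b\<in>S. gker f b a \<noteq> 0} \<and> card {b\<in>S. gker f b a \<noteq> 0} \<le> p"
        using finite_subset[OF sub(2) fin(3)] order_trans[OF card_mono[OF fin(3) sub(2)] fin(4)] by simp
    qed
    moreover have "0 \<le> B" "\<forall>a\<in>S. \<forall>b\<in>S. cmod (gker f a b) \<le> B"
      using b S by (auto simp: banded_def subset_iff)
    ultimately show ?thesis unfolding banded_def by blast
  qed
  have v': "v \<in> l2 (fib x)" using v S l2_iff[of v S] l2_iff[of v "fib x"] by auto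
  have T: "bdd_op (fib x) (kop (fib x) (gker f))"
    using kop_has_kernel[OF b] by (simp add: has_kernel_def)
  have "l2norm S (kop S (gker f) v) \<le> l2norm (fib x) (kop (fib x) (gker f) v)"
    by (rule kop_restrict_norm[OF S b bS v])
  also have "\<dots> \<le> opnorm (fib x) (kop (fib x) (gker f)) * l2norm (fib x) v"
    by (rule l2norm_le_opnorm[OF T v'])
  also have "\<dots> \<le> red_norm G X f * l2norm (fib x) v"
    by (intro mult_right_mono opnorm_le_red_norm[OF f x] l2norm_nonneg)
  also have "l2norm (fib x) v = l2norm S v"
    by (simp add: l2norm_eq_norm[OF v] l2norm_eq_norm[OF v'])
  finally show ?thesis .
qed

lemma closed_XiN:
  assumes "closed N"
  shows "closed (XiN G N)"
proof -
  have "XiN G N = r -` N \<inter> d -` N" by (auto simp: XiN_def)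
  then show ?thesis
    using assms continuous_r continuous_d by (simp add: closed_Int closed_vimage)
qed

lemma Cc_restrict:
  fixes f :: "'g \<Rightarrow> complex"
  assumes f: "f \<in> Cc_on UNIV" and N: "closed N"
  shows "f \<in> Cc_on (XiN G N)"
proof -
  obtain K where K: "compact K" "\<forall>a\<in>UNIV - K. f a = 0" and c: "continuous_on UNIV f"
    using f by (auto simp: Cc_on_def)
  have "compact (K \<inter> XiN G N)" by (rule compact_Int_closed[OF K(1) closed_XiN[OF N]])
  moreover have "\<forall>a\<in>XiN G N - K \<inter> XiN G N. f a = 0" using K by auto
  ultimately show ?thesis
    using continuous_on_subset[OF c] unfolding Cc_on_def by blast
qed

section \<open>Operators and forms of elements of the groupoid algebra\<close>

lemma gker_diff: "gker (\<lambda>a. f a - g a) = (\<lambda>a b. gker f a b - gker g a b)"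
  by (simp add: gker_def fun_eq_iff)

text \<open>Unfolds the definite description in \<open>Hop\<close>. Existence comes from the
  approximants of \<open>h\<close> restricted to \<open>XiN G N\<close>; uniqueness holds because
  norm convergence forces the matrix entries of any candidate to be those of
  \<open>h\<close>.\<close>

lemma Hop_has_kernel:
  assumes h: "h \<in> Cstar G" and N: "closed N" "N \<subseteq> X" and x: "x \<in> N"
  shows "has_kernel (fiberN G N x) (Hop G N h x) (gker h)"
proof -
  let ?S = "fiberN G N x"
  define P where "P T \<longleftrightarrow> bdd_op ?S T \<and> (\<forall>v. v \<notin> l2 ?S \<longrightarrow> T v = (\<lambda>a. 0)) \<and>
      (\<exists>g. (\<forall>n. g n \<in> Cc_on (XiN G N)) \<and> (\<forall>a\<in>XiN G N. (\<lambda>n. g n a) \<longlonglongrightarrow> h a) \<and>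
           (\<lambda>n. opnorm ?S (\<lambda>v a. reg_rep G N x (g n) v a - T v a)) \<longlonglongrightarrow> 0)" for T
  have kernel: "has_kernel ?S T (gker h)" if PT: "P T" for T
  proof -
    obtain g where g: "\<And>n. g n \<in> Cc_on (XiN G N)" "\<And>a. a \<in> XiN G N \<Longrightarrow> (\<lambda>n. g n a) \<longlonglongrightarrow> h a"
      "(\<lambda>n. opnorm ?S (\<lambda>v a. reg_rep G N x (g n) v a - T v a)) \<longlonglongrightarrow> 0" and T: "bdd_op ?S T"
      using PT unfolding P_def by blast
    have ker: "has_kernel ?S (reg_rep G N x (g n)) (gker (g n))" for n
      unfolding reg_rep_eq_kop using Cc_banded[OF g(1)[of n]] kop_has_kernel by blast
    have R: "bdd_op ?S (reg_rep G N x (g n))" for n using ker[of n] by (simp add: has_kernel_def)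
    have "T (\<lambda>c. if c = b then 1 else 0) a = gker h a b" if ab: "a \<in> ?S" "b \<in> ?S" for a b
    proof -
      have d: "(\<lambda>c. if c = b then 1 else 0) \<in> l2 ?S"
        using finite_support_l2[of "{b}" ?S "\<lambda>_. 1"] ab by simp
      have "(\<lambda>n. reg_rep G N x (g n) (\<lambda>c. if c = b then 1 else 0) a) \<longlonglongrightarrow> T (\<lambda>c. if c = b then 1 else 0) a"
        by (rule opnorm_tendsto_pointwise[OF R T g(3) d])
      moreover have "reg_rep G N x (g n) (\<lambda>c. if c = b then 1 else 0) a = gker (g n) a b" for n
        using ker[of n] ab by (simp add: has_kernel_def)
      moreover have "(\<lambda>n. gker (g n) a b) \<longlonglongrightarrow> gker h a b"
        unfolding gker_def by (rule g(2)[OF quot_fiberN[OF ab]])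
      ultimately show ?thesis using LIMSEQ_unique by simp
    qed
    then show ?thesis using T by (simp add: has_kernel_def)
  qed
  \<comment> \<open>Two candidates may stem from different sequences \<open>g\<close>, yet they have
    the same matrix on \<open>l2\<close> and vanish off it.\<close>
  have unique: "T = T'" if "P T" "P T'" for T T'
  proof
    fix v
    show "T v = T' v"
    proof (cases "v \<in> l2 ?S")
      case True
      then show ?thesis using has_kernel_unique[OF kernel[OF that(1)] kernel[OF that(2)]] by blast
    next
      case False
      then show ?thesis using that by (simp add: P_def)
    qed
  qed
  obtain f where f: "\<And>n. f n \<in> Cc_on UNIV"
    and cauchy: "\<And>e. e > 0 \<Longrightarrow> \<exists>n0. \<forall>m\<ge>n0. \<forall>n\<ge>n0. red_norm G X (\<lambda>a. f m a - f n a) < e"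
    and lim: "\<And>a. (\<lambda>n. f n a) \<longlonglongrightarrow> h a"
    using h unfolding Cstar_def by blast
  have fN: "f n \<in> Cc_on (XiN G N)" for n by (rule Cc_restrict[OF f N(1)])
  have ban: "\<exists>B p. banded ?S B p (gker (f n))" for n
    using Cc_banded[OF fN[of n]] by blast
  have R: "bdd_op ?S (reg_rep G N x (f n))" for n
    using ban[of n] kop_has_kernel unfolding reg_rep_eq_kop has_kernel_def by blast
  have C: "\<exists>n0. \<forall>m\<ge>n0. \<forall>n\<ge>n0. \<forall>v\<in>l2 ?S.
      l2norm ?S (\<lambda>a. reg_rep G N x (f m) v a - reg_rep G N x (f n) v a) \<le> e * l2norm ?S v"
    if e: "e > 0" for e
  proof -
    obtain n0 where n0: "\<forall>m\<ge>n0. \<forall>n\<ge>n0. red_norm G X (\<lambda>a. f m a - f n a) < e"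
      using cauchy[OF e] by blast
    have "l2norm ?S (\<lambda>a. reg_rep G N x (f m) v a - reg_rep G N x (f n) v a) \<le> e * l2norm ?S v"
      if mn: "m \<ge> n0" "n \<ge> n0" and v: "v \<in> l2 ?S" for m n v
    proof -
      obtain B p B' p' where "banded ?S B p (gker (f m))" "banded ?S B' p' (gker (f n))"
        using ban by metis
      then have "(\<lambda>a. reg_rep G N x (f m) v a - reg_rep G N x (f n) v a)
          = kop ?S (gker (\<lambda>a. f m a - f n a)) v"
        unfolding reg_rep_eq_kop gker_diff by (simp add: kop_diff)
      then have "l2norm ?S (\<lambda>a. reg_rep G N x (f m) v a - reg_rep G N x (f n) v a)
          \<le> red_norm G X (\<lambda>a. f m a - f n a) * l2norm ?S v"
        using kop_le_red_norm[OF Cc_diff[OF f f] _ fiberN_subset v] x N(2) by auto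
      also have "\<dots> \<le> e * l2norm ?S v"
        using n0[rule_format, OF mn] by (intro mult_right_mono l2norm_nonneg) simp
      finally show ?thesis .
    qed
    then show ?thesis by blast
  qed
  from bdd_op_limit[of ?S "\<lambda>n. reg_rep G N x (f n)", OF R C]
  obtain T where T: "bdd_op ?S T" "\<forall>v. v \<notin> l2 ?S \<longrightarrow> T v = (\<lambda>a. 0)"
    "(\<lambda>n. opnorm ?S (\<lambda>v a. reg_rep G N x (f n) v a - T v a)) \<longlonglongrightarrow> 0"
    by blast
  have PT: "P T" unfolding P_def using T fN lim by blast
  have "Hop G N h x = (THE T. P T)" unfolding Hop_def P_def ..
  also have "\<dots> = T" by (rule the_equality[where P = P, OF PT unique[OF _ PT]])
  finally show ?thesis using kernel[OF PT] by simp
qed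

text \<open>One \<open>f\<close> serves all fibres and all finite supports: it is a late member of
  the Cauchy sequence, and its distance to later members is measured in the norm that is a supremum
  over all fibres.\<close>

lemma Cstar_form_approx:
  assumes h: "h \<in> Cstar G" and e: "e > 0"
  shows "\<exists>f\<in>Cc_on UNIV. \<forall>x F v. finite F \<longrightarrow> F \<subseteq> fib x \<longrightarrow>
      \<bar>kform (gker f) F v - kform (gker h) F v\<bar> \<le> e * (\<Sum>a\<in>F. (cmod (v a))\<^sup>2)"
proof -
  obtain f where f: "\<And>n. f n \<in> Cc_on UNIV"
    and cauchy: "\<And>e. e > 0 \<Longrightarrow> \<exists>n0. \<forall>m\<ge>n0. \<forall>n\<ge>n0. red_norm G X (\<lambda>a. f m a - f n a) < e"
    and lim: "\<And>a. (\<lambda>n. f n a) \<longlonglongrightarrow> h a"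
    using h unfolding Cstar_def by blast
  obtain n0 where n0: "\<forall>m\<ge>n0. \<forall>n\<ge>n0. red_norm G X (\<lambda>a. f m a - f n a) < e"
    using cauchy[OF e] by blast
  have "\<bar>kform (gker (f n0)) F v - kform (gker h) F v\<bar> \<le> e * (\<Sum>a\<in>F. (cmod (v a))\<^sup>2)"
    if F: "finite F" "F \<subseteq> fib x" for x F v
  proof (cases "F = {}")
    case False
    then have x: "x \<in> X" using F by (auto simp: fib_def)
    have "\<bar>kform (gker (f n0)) F v - kform (gker (f m)) F v\<bar> \<le> e * (\<Sum>a\<in>F. (cmod (v a))\<^sup>2)"
      if m: "m \<ge> n0" for m
    proof -
      let ?g = "\<lambda>a. f n0 a - f m a"
      have g: "?g \<in> Cc_on UNIV" by (rule Cc_diff[OF f f])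
      then have "?g \<in> Cc_on (XiN G X)" by simp
      then obtain B p where "\<And>x. banded (fiberN G X x) B p (gker ?g)" using Cc_banded by blast
      then have "banded (fib x) B p (gker ?g)" by simp
      then have "has_kernel (fib x) (kop (fib x) (gker ?g)) (gker ?g)" by (rule kop_has_kernel)
      then have "\<bar>kform (gker ?g) F v\<bar> \<le> e * (\<Sum>a\<in>F. (cmod (v a))\<^sup>2)"
      proof (rule has_kernel_form_bound[OF _ F])
        fix v assume v: "v \<in> l2 (fib x)"
        have "l2norm (fib x) (kop (fib x) (gker ?g) v) \<le> red_norm G X ?g * l2norm (fib x) v"
          by (rule kop_le_red_norm[OF g x order_refl v])
        also have "\<dots> \<le> e * l2norm (fib x) v"
          using n0[rule_format, OF order_refl m] by (intro mult_right_mono l2norm_nonneg) simp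
        finally show "l2norm (fib x) (kop (fib x) (gker ?g) v) \<le> e * l2norm (fib x) v" .
      qed
      then show ?thesis by (simp add: gker_diff kform_diff)
    qed
    \<comment> \<open>For a fixed finite \<open>F\<close> only finitely many entries occur, so
      pointwise convergence to \<open>h\<close> is enough.\<close>
    moreover have "(\<lambda>m. \<bar>kform (gker (f n0)) F v - kform (gker (f m)) F v\<bar>)
        \<longlonglongrightarrow> \<bar>kform (gker (f n0)) F v - kform (gker h) F v\<bar>"
      unfolding kform_def gker_def by (intro tendsto_intros lim)
    ultimately show ?thesis by (intro LIMSEQ_le_const2) auto
  qed (simp add: kform_def)
  then show ?thesis using f[of n0] by blast
qed

lemma Cc_form_bound:
  assumes f: "f \<in> Cc_on UNIV"
  shows "\<exists>C\<ge>0. \<forall>x F v. finite F \<longrightarrow> F \<subseteq> fib x \<longrightarrow>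
    \<bar>kform (gker f) F v\<bar> \<le> C * (\<Sum>a\<in>F. (cmod (v a))\<^sup>2)"
proof -
  have "f \<in> Cc_on (XiN G X)" using f by simp
  then obtain B p where "\<And>x. banded (fiberN G X x) B p (gker f)" using Cc_banded by blast
  then have b: "\<And>x. banded (fib x) B p (gker f)" by simp
  \<comment> \<open>Nonnegativity of \<open>B\<close> is part of \<open>banded\<close>, so any fibre
    whatever can be instantiated here.\<close>
  have "0 \<le> B * real p" using b[of undefined] by (simp add: banded_def)
  moreover have "\<bar>kform (gker f) F v\<bar> \<le> B * real p * (\<Sum>a\<in>F. (cmod (v a))\<^sup>2)"
    if "finite F" "F \<subseteq> fib x" for x F v
    by (rule has_kernel_form_bound[OF kop_has_kernel[OF b] that kop_bounded(2)[OF b]])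
  ultimately show ?thesis by blast
qed

end

lemma kform_reindex:
  assumes "bij_betw e I F"
  shows "kform k F v = (\<Sum>i\<in>I. \<Sum>j\<in>I. Re (cnj (v (e i)) * k (e i) (e j) * v (e j)))"
  unfolding kform_def by (simp only: sum.reindex_bij_betw[OF assms, symmetric])

context manageable_groupoid
begin

section \<open>Localisation of forms by amenability\<close>

text \<open>Cut-offs are indexed by \<open>z\<close> in a fibre of \<open>d\<close>, whereas
  amenability speaks of sums over a fibre of \<open>r\<close>. This bijection translates one into
  the other.\<close>

lemma bij_betw_quot:
  assumes "d a = x"
  shows "bij_betw (quot a) (fib x) {b. r b = r a}"
proof (rule bij_betwI')
  show "quot a z = quot a z' \<longleftrightarrow> z = z'" if "z \<in> fib x" "z' \<in> fib x" for z z'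
    using quot_inj_right[of z a z'] that assms by (auto simp: fib_def)
  show "quot a z \<in> {b. r b = r a}" if "z \<in> fib x" for z
    using that assms by (simp add: fib_def quot_rd)
  show "\<exists>z\<in>fib x. b = quot a z" if "b \<in> {b. r b = r a}" for b
  proof
    \<comment> \<open>This is the product of the inverse of \<open>b\<close> with \<open>a\<close>,
      written as a quotient so that the rules for \<open>quot\<close> apply.\<close>
    let ?z = "quot (ginv G b) (ginv G a)"
    have rb: "r b = r a" using that by simp
    have "d ?z = d a" using rb quot_rd(2)[of "ginv G b" "ginv G a"] by simp
    then show "?z \<in> fib x" using assms by (simp add: fib_def)
    have "quot a ?z = gmult G a (quot (ginv G a) (ginv G b))"
      using inv_quot[of "ginv G b" "ginv G a"] rb by (simp add: quot_def[of a])
    also have "\<dots> = gmult G (gmult G a (ginv G a)) b"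
      using mult_assoc[of a "ginv G a" b] rb by (simp add: quot_def)
    also have "\<dots> = b" using rb mult_unit(1)[of b] by simp
    finally show "b = quot a ?z" by simp
  qed
qed

lemma sum_quot_eq_infsum:
  fixes \<psi> :: "'g \<Rightarrow> real"
  assumes Z: "finite Z" "Z \<subseteq> fib x" and a: "d a = x"
    and zero: "\<And>z. z \<in> fib x - Z \<Longrightarrow> \<psi> (quot a z) = 0"
  shows "(\<Sum>z\<in>Z. \<psi> (quot a z)) = infsum \<psi> {b. r b = r a}"
proof -
  have "infsum \<psi> {b. r b = r a} = (\<Sum>\<^sub>\<infinity>z\<in>fib x. \<psi> (quot a z))"
    by (rule infsum_reindex_bij_betw[OF bij_betw_quot[OF a], symmetric])
  also have "\<dots> = (\<Sum>\<^sub>\<infinity>z\<in>Z. \<psi> (quot a z))"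
    by (rule infsum_cong_neutral) (use Z zero in auto)
  finally show ?thesis using Z by simp
qed

text \<open>One member of the amenability sequence, late enough for both uniform limits. Compactness
  of \<open>X\<close> makes the first limit uniform over all units.\<close>

lemma approximate_mean:
  assumes L: "compact L" and \<delta>: "\<delta> > 0"
  shows "\<exists>(\<phi> :: 'g \<Rightarrow> real) K. compact K \<and> (\<forall>a. 0 \<le> \<phi> a) \<and> (\<forall>a. a \<notin> K \<longrightarrow> \<phi> a = 0) \<and>
    (\<forall>x\<in>X. \<bar>infsum \<phi> {a. r a = x} - 1\<bar> \<le> \<delta>) \<and>
    (\<forall>b\<in>L. \<bar>infsum (\<lambda>a. \<bar>\<phi> (gmult G (ginv G b) a) - \<phi> a\<bar>) {a. r a = r b}\<bar> \<le> \<delta>)"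
proof -
  have "amenable_etale G" using manageable by (simp add: manageable_def)
  then obtain f :: "nat \<Rightarrow> 'g \<Rightarrow> real" where f: "\<forall>n. f n \<in> Cc_on UNIV \<and> (\<forall>a. f n a \<ge> 0)"
    and 1: "\<forall>K. compact K \<and> K \<subseteq> X \<longrightarrow>
        uniform_limit K (\<lambda>n x. infsum (f n) {a. r a = x}) (\<lambda>x. 1) sequentially"
    and 2: "\<forall>L. compact L \<longrightarrow>
        uniform_limit L (\<lambda>n b. infsum (\<lambda>a. \<bar>f n (gmult G (ginv G b) a) - f n a\<bar>)
                                   {a. r a = r b}) (\<lambda>b. 0) sequentially"
    unfolding amenable_etale_def by blast
  have "\<forall>\<^sub>F n in sequentially. \<forall>x\<in>X. dist (infsum (f n) {a. r a = x}) 1 < \<delta>"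
    using 1[rule_format, of X] compact_X uniform_limitD[OF _ \<delta>] by blast
  moreover have "\<forall>\<^sub>F n in sequentially. \<forall>b\<in>L.
      dist (infsum (\<lambda>a. \<bar>f n (gmult G (ginv G b) a) - f n a\<bar>) {a. r a = r b}) 0 < \<delta>"
    using uniform_limitD[OF 2[rule_format, OF L] \<delta>] .
  ultimately have "\<forall>\<^sub>F n in sequentially. (\<forall>x\<in>X. dist (infsum (f n) {a. r a = x}) 1 < \<delta>) \<and>
     (\<forall>b\<in>L. dist (infsum (\<lambda>a. \<bar>f n (gmult G (ginv G b) a) - f n a\<bar>) {a. r a = r b}) 0 < \<delta>)"
    by (rule eventually_conj)
  then obtain n where n: "\<forall>x\<in>X. dist (infsum (f n) {a. r a = x}) 1 < \<delta>"
    "\<forall>b\<in>L. dist (infsum (\<lambda>a. \<bar>f n (gmult G (ginv G b) a) - f n a\<bar>) {a. r a = r b}) 0 < \<delta>"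
    using eventually_happens'[OF sequentially_bot] by blast
  have "f n \<in> Cc_on UNIV" using f by blast
  then obtain K where K: "compact K" "\<forall>a\<in>UNIV - K. f n a = 0"
    unfolding Cc_on_def by auto
  have "\<forall>x\<in>X. \<bar>infsum (f n) {a. r a = x} - 1\<bar> \<le> \<delta>"
    using n(1) by (force simp: dist_real_def)
  moreover have "\<forall>b\<in>L. \<bar>infsum (\<lambda>a. \<bar>f n (gmult G (ginv G b) a) - f n a\<bar>) {a. r a = r b}\<bar> \<le> \<delta>"
    using n(2) by (force simp: dist_real_def)
  ultimately show ?thesis using K f by (intro exI[of _ "f n"] exI[of _ K] conjI) auto
qed

text \<open>The premise allows every base point \<open>y\<close> and restricts only supports and
  ranges, because the translated cut-offs sit over base points \<open>r z\<close> on which nothing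
  is known. The square roots make the squared cut-offs add up to the mean, and \<open>K\<close> is
  chosen before \<open>M\<close> is quantified.\<close>

lemma localization:
  assumes f: "f \<in> Cc_on UNIV" and e: "e > 0"
  shows "\<exists>K. compact K \<and> (\<forall>M.
    (\<forall>y F v. finite F \<longrightarrow> F \<subseteq> K \<longrightarrow> F \<subseteq> fib y \<longrightarrow> r ` F \<subseteq> M \<longrightarrow>
      c * (\<Sum>a\<in>F. (cmod (v a))\<^sup>2) \<le> kform (gker f) F v) \<longrightarrow>
    (\<forall>x F v. finite F \<longrightarrow> F \<subseteq> fib x \<longrightarrow> r ` F \<subseteq> M \<longrightarrow>
      (c - e) * (\<Sum>a\<in>F. (cmod (v a))\<^sup>2) \<le> kform (gker f) F v))"
proof -
  obtain L B where L: "compact L" "0 \<le> B" "\<forall>a. cmod (f a) \<le> B" "\<forall>a. f a \<noteq> 0 \<longrightarrow> a \<in> L"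
    using Cc_bounded[OF f] by auto
  obtain p where p: "\<forall>S x B f. S \<subseteq> fib x \<longrightarrow> 0 \<le> B \<longrightarrow> (\<forall>a\<in>S. \<forall>b\<in>S. cmod (f a b) \<le> B) \<longrightarrow>
    (\<forall>a\<in>S. \<forall>b\<in>S. f a b \<noteq> 0 \<longrightarrow> quot a b \<in> L) \<longrightarrow> banded S B p f"
    using banded_gker[OF L(1)] by blast
  \<comment> \<open>Two errors proportional to \<open>\<delta>\<close> occur:
    \<open>\<bar>c\<bar> * \<delta>\<close> since the mean has total mass only near 1, and
    \<open>2 * \<delta> * B * real p\<close> since it is only nearly invariant. The summand 1 keeps
    \<open>D\<close> positive.\<close>
  define D where "D = \<bar>c\<bar> + 2 * B * real p + 1"
  have D: "D > 0" using L(2) by (simp add: D_def add_nonneg_pos)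
  define \<delta> where "\<delta> = e / D"
  have \<delta>: "\<delta> > 0" using e D by (simp add: \<delta>_def)
  have \<delta>e: "\<bar>c\<bar> * \<delta> + 2 * \<delta> * B * real p \<le> e"
  proof -
    have "\<bar>c\<bar> * \<delta> + 2 * \<delta> * B * real p = (D - 1) * \<delta>" by (simp add: D_def algebra_simps)
    also have "\<dots> \<le> D * \<delta>" using \<delta> by (intro mult_right_mono) auto
    also have "\<dots> = e" using D by (simp add: \<delta>_def)
    finally show ?thesis .
  qed
  obtain \<phi> :: "'g \<Rightarrow> real" and K where K: "compact K" and \<phi>0: "\<And>a. 0 \<le> \<phi> a"
    and \<phi>K: "\<And>a. a \<notin> K \<Longrightarrow> \<phi> a = 0"
    and mean: "\<And>x. x \<in> X \<Longrightarrow> \<bar>infsum \<phi> {a. r a = x} - 1\<bar> \<le> \<delta>"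
    and inv: "\<And>b. b \<in> L \<Longrightarrow> \<bar>infsum (\<lambda>a. \<bar>\<phi> (gmult G (ginv G b) a) - \<phi> a\<bar>) {a. r a = r b}\<bar> \<le> \<delta>"
    using approximate_mean[OF L(1) \<delta>] by blast
  have main: "(c - e) * (\<Sum>a\<in>F. (cmod (v a))\<^sup>2) \<le> kform (gker f) F v"
    if hyp: "\<forall>y F v. finite F \<longrightarrow> F \<subseteq> K \<longrightarrow> F \<subseteq> fib y \<longrightarrow> r ` F \<subseteq> M \<longrightarrow>
        c * (\<Sum>a\<in>F. (cmod (v a))\<^sup>2) \<le> kform (gker f) F v"
      and F: "finite F" "F \<subseteq> fib x" and FM: "r ` F \<subseteq> M" for M x F v
  proof -
    have dF: "d a = x" if "a \<in> F" for a using F(2) that by (auto simp: fib_def)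
    \<comment> \<open>All \<open>z\<close> whose cut-off can be nonzero somewhere on
      \<open>F\<close>. There are finitely many, so the infinite sums of the amenability condition
      become finite ones.\<close>
    define Z where "Z = (\<Union>a\<in>F. {z\<in>fib x. quot a z \<in> K})"
    have Zfib: "Z \<subseteq> fib x" by (auto simp: Z_def)
    have "finite {z\<in>fib x. quot a z \<in> K}" if "a \<in> F" for a
    proof (rule inj_on_finite)
      show "inj_on (quot a) {z\<in>fib x. quot a z \<in> K}"
        using bij_betw_imp_inj_on[OF bij_betw_quot[OF dF[OF that]]] by (rule inj_on_subset) auto
      show "quot a ` {z\<in>fib x. quot a z \<in> K} \<subseteq> {b\<in>K. r b = r a}"
        using bij_betw_imp_surj_on[OF bij_betw_quot[OF dF[OF that]]] by auto
      show "finite {b\<in>K. r b = r a}" using compact_range_fiber_card[OF K] by blast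
    qed
    then have Z: "finite Z" using F(1) by (simp add: Z_def)
    have outside: "\<phi> (quot a z) = 0" if "a \<in> F" "z \<in> fib x - Z" for a z
      by (rule \<phi>K) (use that in \<open>auto simp: Z_def\<close>)
    define g where "g a z = sqrt (\<phi> (quot a z))" for a z
    define q where "q a b = Re (cnj (v a) * gker f a b * v b)" for a b
    \<comment> \<open>After summing the localised forms over \<open>z\<close>, the entry
      \<open>q a b\<close> carries the overlap \<open>s a b\<close> of the weights at
      \<open>a\<close> and \<open>b\<close>; it has to be near 1 wherever \<open>gker f a b\<close>
      is nonzero.\<close>
    define s where "s a b = (\<Sum>z\<in>Z. g a z * g b z)" for a b
    have Re_of_real_mult: "Re (of_real t * y) = t * Re y" for t y by simp
    have gsq: "g a z * g a z = \<phi> (quot a z)" for a z using \<phi>0 by (simp add: g_def)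
    have local: "c * (\<Sum>a\<in>F. \<phi> (quot a z) * (cmod (v a))\<^sup>2) \<le> (\<Sum>a\<in>F. \<Sum>b\<in>F. g a z * g b z * q a b)"
      if z: "z \<in> Z" for z
    proof -
      have dz: "d z = x" using z Zfib by (auto simp: fib_def)
      define E where "E = {a\<in>F. quot a z \<in> K}"
      have E: "finite E" "E \<subseteq> F" using F by (auto simp: E_def)
      have g0: "g a z = 0" if "a \<in> F - E" for a
        using that \<phi>K by (simp add: g_def E_def)
      let ?F = "(\<lambda>a. quot a z) ` E"
      \<comment> \<open>The cut-off translated by the inverse of \<open>z\<close>: at
        \<open>quot a z\<close> it takes the value \<open>g a z\<close> times \<open>v a\<close>,
        because \<open>quot a z\<close> times \<open>z\<close> is \<open>a\<close>.\<close>
      let ?w = "\<lambda>b. of_real (sqrt (\<phi> b)) * v (gmult G b z)"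
      have bij: "bij_betw (\<lambda>a. quot a z) E ?F"
      proof (rule bij_betw_imageI[OF _ refl], rule inj_onI)
        fix a a' assume "a \<in> E" "a' \<in> E" "quot a z = quot a' z"
        then show "a = a'" using quot_inj_left[of a z a'] dF E(2) dz by auto
      qed
      have w: "?w (quot a z) = of_real (g a z) * v a" if "a \<in> E" for a
        using quot_mult[of a z] dF[of a] that E(2) dz by (auto simp: g_def)
      have "c * (\<Sum>b\<in>?F. (cmod (?w b))\<^sup>2) \<le> kform (gker f) ?F ?w"
      proof (rule hyp[rule_format])
        show "?F \<subseteq> fib (r z)" using quot_rd(2) dF E(2) dz by (auto simp: fib_def)
        have "r (quot a z) = r a" if "a \<in> E" for a
          using quot_rd(1)[of a z] dF[of a] dz that E(2) by auto
        then show "r ` ?F \<subseteq> M" using FM E(2) by auto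
      qed (use E in \<open>auto simp: E_def\<close>)
      also have "(\<Sum>b\<in>?F. (cmod (?w b))\<^sup>2) = (\<Sum>a\<in>E. (cmod (of_real (g a z) * v a))\<^sup>2)"
        unfolding sum.reindex_bij_betw[OF bij, symmetric] by (intro sum.cong refl) (simp only: w)
      also have "\<dots> = (\<Sum>a\<in>E. \<phi> (quot a z) * (cmod (v a))\<^sup>2)"
        by (intro sum.cong refl) (simp add: norm_mult power_mult_distrib g_def \<phi>0)
      also have "\<dots> = (\<Sum>a\<in>F. \<phi> (quot a z) * (cmod (v a))\<^sup>2)"
        by (rule sum.mono_neutral_left[OF F(1) E(2)]) (auto simp: E_def \<phi>K)
      also have "kform (gker f) ?F ?w = (\<Sum>a\<in>E. \<Sum>b\<in>E. g a z * g b z * q a b)"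
        unfolding kform_reindex[OF bij]
      proof (intro sum.cong refl)
        fix a b assume ab: "a \<in> E" "b \<in> E"
        have "d a = d z" "d b = d z" using ab E(2) dF dz by auto
        then have "gker f (quot a z) (quot b z) = gker f a b" by (simp add: gker_def quot_quot)
        then have "cnj (?w (quot a z)) * gker f (quot a z) (quot b z) * ?w (quot b z)
            = of_real (g a z * g b z) * (cnj (v a) * gker f a b * v b)"
          unfolding w[OF ab(1)] w[OF ab(2)] by simp
        then show "Re (cnj (?w (quot a z)) * gker f (quot a z) (quot b z) * ?w (quot b z))
            = g a z * g b z * q a b" by (simp only: q_def Re_of_real_mult)
      qed
      also have "\<dots> = (\<Sum>a\<in>F. \<Sum>b\<in>E. g a z * g b z * q a b)"
        by (rule sum.mono_neutral_left[OF F(1) E(2)]) (simp add: g0)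
      also have "\<dots> = (\<Sum>a\<in>F. \<Sum>b\<in>F. g a z * g b z * q a b)"
        by (intro sum.cong refl sum.mono_neutral_left[OF F(1) E(2)]) (simp add: g0)
      finally show ?thesis .
    qed
    have sum\<phi>: "(\<Sum>z\<in>Z. \<phi> (quot a z)) = infsum \<phi> {b. r b = r a}" if "a \<in> F" for a
      by (rule sum_quot_eq_infsum[OF Z Zfib dF[OF that]]) (rule outside[OF that])
    have near1: "\<bar>(\<Sum>z\<in>Z. \<phi> (quot a z)) - 1\<bar> \<le> \<delta>" if "a \<in> F" for a
      unfolding sum\<phi>[OF that] by (rule mean) simp
    \<comment> \<open>Polarisation writes \<open>s a b\<close> as half of the two masses minus the
      sum of \<open>(g a z - g b z)\<^sup>2\<close>. By the inequality between the squared
      difference of two roots and the difference of their squares, that sum is at most the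
      invariance defect \<delta>. The total error is 3/2 \<delta>, rounded up to 2 \<delta>.\<close>
    have s1: "\<bar>s a b - 1\<bar> \<le> 2 * \<delta>" if ab: "a \<in> F" "b \<in> F" and nz: "quot a b \<in> L" for a b
    proof -
      let ?\<psi> = "\<lambda>c. \<bar>\<phi> (gmult G (ginv G (quot a b)) c) - \<phi> c\<bar>"
      have shift: "gmult G (ginv G (quot a b)) (quot a z) = quot b z" if "z \<in> fib x" for z
        using that inv_quot[of a b] mult_quot[of b a z] dF[OF ab(1)] dF[OF ab(2)] by (simp add: fib_def)
      have "(\<Sum>z\<in>Z. ?\<psi> (quot a z)) = infsum ?\<psi> {c. r c = r a}"
        by (rule sum_quot_eq_infsum[OF Z Zfib dF[OF ab(1)]]) (use shift outside ab in auto)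
      moreover have "r (quot a b) = r a" using dF ab by (simp add: quot_rd)
      ultimately have "(\<Sum>z\<in>Z. ?\<psi> (quot a z)) \<le> \<delta>" using inv[OF nz] by simp
      moreover have "(\<Sum>z\<in>Z. ?\<psi> (quot a z)) = (\<Sum>z\<in>Z. \<bar>\<phi> (quot b z) - \<phi> (quot a z)\<bar>)"
        by (intro sum.cong refl) (use shift Zfib in auto)
      ultimately have var: "(\<Sum>z\<in>Z. \<bar>\<phi> (quot b z) - \<phi> (quot a z)\<bar>) \<le> \<delta>" by simp
      have sq: "(g a z - g b z)\<^sup>2 \<le> \<bar>\<phi> (quot b z) - \<phi> (quot a z)\<bar>" for z
      proof -
        have pos: "0 \<le> g a z" "0 \<le> g b z" using \<phi>0 by (auto simp: g_def)
        have "(g a z - g b z)\<^sup>2 = \<bar>g a z - g b z\<bar> * \<bar>g a z - g b z\<bar>" by (simp add: power2_eq_square)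
        also have "\<dots> \<le> \<bar>g a z - g b z\<bar> * \<bar>g a z + g b z\<bar>"
          using pos by (intro mult_left_mono) auto
        also have "\<dots> = \<bar>g a z * g a z - g b z * g b z\<bar>"
          unfolding abs_mult[symmetric] by (simp add: algebra_simps)
        finally show ?thesis by (simp add: gsq abs_minus_commute)
      qed
      let ?V = "\<Sum>z\<in>Z. (g a z - g b z)\<^sup>2"
      have V: "0 \<le> ?V" "?V \<le> \<delta>"
        using order_trans[OF sum_mono[OF sq] var] by (auto intro: sum_nonneg)
      have "s a b = (\<Sum>z\<in>Z. (\<phi> (quot a z) + \<phi> (quot b z) - (g a z - g b z)\<^sup>2) / 2)"
        unfolding s_def
        by (intro sum.cong refl) (simp add: gsq[symmetric] power2_eq_square algebra_simps)
      also have "\<dots> = ((\<Sum>z\<in>Z. \<phi> (quot a z)) + (\<Sum>z\<in>Z. \<phi> (quot b z)) - ?V) / 2"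
        unfolding sum_divide_distrib[symmetric] sum_subtractf sum.distrib ..
      finally show ?thesis using near1[OF ab(1)] near1[OF ab(2)] V \<delta> by (simp add: abs_le_iff)
    qed
    \<comment> \<open>The kernel by which the sum of the localised forms differs from the original
      form. It is small where \<open>quot a b\<close> lies in \<open>L\<close> and zero elsewhere,
      so the Schur bound applies.\<close>
    define k' where "k' a b = of_real (s a b - 1) * gker f a b" for a b
    have "banded F (2 * \<delta> * B) p k'"
    proof (rule p[rule_format, OF F(2)])
      show "0 \<le> 2 * \<delta> * B" using \<delta> L(2) by simp
      show "quot a b \<in> L" if "a \<in> F" "b \<in> F" "k' a b \<noteq> 0" for a b
        using that L(4) by (auto simp: k'_def gker_def)
      show "cmod (k' a b) \<le> 2 * \<delta> * B" if "a \<in> F" "b \<in> F" for a b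
      proof (cases "quot a b \<in> L")
        case True
        then show ?thesis
          using mult_mono[OF s1[OF that True] L(3)[rule_format, of "quot a b"]] \<delta>
          by (simp only: k'_def gker_def norm_mult norm_of_real) simp
      next
        case False
        then have "f (quot a b) = 0" using L(4) by blast
        then show ?thesis using \<delta> L(2) by (simp add: k'_def gker_def)
      qed
    qed
    then have err: "\<bar>kform k' F v\<bar> \<le> 2 * \<delta> * B * real p * (\<Sum>a\<in>F. (cmod (v a))\<^sup>2)"
      by (rule banded_form_bound[OF _ F(1)])
    have "(\<Sum>a\<in>F. \<Sum>b\<in>F. s a b * q a b) = kform (gker f) F v + kform k' F v"
      unfolding kform_def sum.distrib[symmetric]
    proof (intro sum.cong refl)
      fix a b
      have "cnj (v a) * k' a b * v b = of_real (s a b - 1) * (cnj (v a) * gker f a b * v b)"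
        by (simp add: k'_def algebra_simps)
      then have eq: "Re (cnj (v a) * k' a b * v b) = (s a b - 1) * q a b"
        by (simp only: q_def Re_of_real_mult)
      show "s a b * q a b = Re (cnj (v a) * gker f a b * v b) + Re (cnj (v a) * k' a b * v b)"
        unfolding eq q_def[symmetric] by (simp add: algebra_simps)
    qed
    moreover have "c * (\<Sum>a\<in>F. (\<Sum>z\<in>Z. \<phi> (quot a z)) * (cmod (v a))\<^sup>2) \<le> (\<Sum>a\<in>F. \<Sum>b\<in>F. s a b * q a b)"
    proof -
      have "(\<Sum>a\<in>F. (\<Sum>z\<in>Z. \<phi> (quot a z)) * (cmod (v a))\<^sup>2) = (\<Sum>z\<in>Z. \<Sum>a\<in>F. \<phi> (quot a z) * (cmod (v a))\<^sup>2)"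
        unfolding sum_distrib_right by (rule sum.swap)
      then have "c * (\<Sum>a\<in>F. (\<Sum>z\<in>Z. \<phi> (quot a z)) * (cmod (v a))\<^sup>2)
          = (\<Sum>z\<in>Z. c * (\<Sum>a\<in>F. \<phi> (quot a z) * (cmod (v a))\<^sup>2))"
        by (simp add: sum_distrib_left)
      also have "\<dots> \<le> (\<Sum>z\<in>Z. \<Sum>a\<in>F. \<Sum>b\<in>F. g a z * g b z * q a b)"
        by (rule sum_mono[OF local])
      also have "\<dots> = (\<Sum>a\<in>F. \<Sum>z\<in>Z. \<Sum>b\<in>F. g a z * g b z * q a b)" by (rule sum.swap)
      also have "\<dots> = (\<Sum>a\<in>F. \<Sum>b\<in>F. \<Sum>z\<in>Z. g a z * g b z * q a b)"
        by (intro sum.cong refl sum.swap)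
      also have "\<dots> = (\<Sum>a\<in>F. \<Sum>b\<in>F. s a b * q a b)"
        by (simp add: s_def sum_distrib_right)
      finally show ?thesis .
    qed
    \<comment> \<open>Replaces the total mass by 1. The absolute value of \<open>c\<close> appears
      because \<open>c\<close> may be negative, in which case excess mass is what hurts.\<close>
    moreover have "(c - \<bar>c\<bar> * \<delta>) * (\<Sum>a\<in>F. (cmod (v a))\<^sup>2)
        \<le> c * (\<Sum>a\<in>F. (\<Sum>z\<in>Z. \<phi> (quot a z)) * (cmod (v a))\<^sup>2)"
      unfolding sum_distrib_left
    proof (rule sum_mono)
      fix a assume a: "a \<in> F"
      have "\<bar>c\<bar> * \<bar>(\<Sum>z\<in>Z. \<phi> (quot a z)) - 1\<bar> \<le> \<bar>c\<bar> * \<delta>"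
        by (rule mult_left_mono[OF near1[OF a]]) simp
      then have "\<bar>c * (\<Sum>z\<in>Z. \<phi> (quot a z)) - c\<bar> \<le> \<bar>c\<bar> * \<delta>"
        unfolding abs_mult[symmetric] by (simp add: algebra_simps)
      then have "c - \<bar>c\<bar> * \<delta> \<le> c * (\<Sum>z\<in>Z. \<phi> (quot a z))" by linarith
      then have "(c - \<bar>c\<bar> * \<delta>) * (cmod (v a))\<^sup>2 \<le> c * (\<Sum>z\<in>Z. \<phi> (quot a z)) * (cmod (v a))\<^sup>2"
        by (rule mult_right_mono) simp
      then show "(c - \<bar>c\<bar> * \<delta>) * (cmod (v a))\<^sup>2 \<le> c * ((\<Sum>z\<in>Z. \<phi> (quot a z)) * (cmod (v a))\<^sup>2)"
        by (simp only: mult.assoc)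
    qed
    moreover have "(\<bar>c\<bar> * \<delta> + 2 * \<delta> * B * real p) * (\<Sum>a\<in>F. (cmod (v a))\<^sup>2) \<le> e * (\<Sum>a\<in>F. (cmod (v a))\<^sup>2)"
      by (rule mult_right_mono[OF \<delta>e]) (simp add: sum_nonneg)
    ultimately show ?thesis using err by (simp add: left_diff_distrib distrib_right)
  qed
  show ?thesis
    by (intro exI[of _ K] conjI allI impI K, rule main)
qed

end

section \<open>Semicontinuity of localised forms\<close>

lemma finite_family_subsequence:
  fixes C :: "'b::first_countable_topology set"
  assumes "finite I" "compact C" and P: "\<And>i n. i \<in> I \<Longrightarrow> P i n \<in> C"
  shows "\<exists>s l. strict_mono (s :: nat \<Rightarrow> nat) \<and> (\<forall>i\<in>I. l i \<in> C \<and> (\<lambda>n. P i (s n)) \<longlonglongrightarrow> l i)"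
  using assms(1) P
proof (induction I rule: finite_induct)
  case empty
  then show ?case by (intro exI[of _ id]) (simp add: strict_mono_def)
next
  case (insert j I)
  obtain s l where s: "strict_mono (s :: nat \<Rightarrow> nat)" and l: "\<forall>i\<in>I. l i \<in> C \<and> (\<lambda>n. P i (s n)) \<longlonglongrightarrow> l i"
    using insert.IH insert.prems by blast
  have Pj: "\<forall>n. P j (s n) \<in> C" using insert.prems by blast
  obtain l' t where t: "l' \<in> C" "strict_mono (t :: nat \<Rightarrow> nat)" "((\<lambda>n. P j (s n)) \<circ> t) \<longlonglongrightarrow> l'"
    by (rule seq_compactE[OF compact_imp_seq_compact[OF \<open>compact C\<close>] Pj])
  have "(\<lambda>n. P i (s (t n))) \<longlonglongrightarrow> l i" if "i \<in> I" for i
    using LIMSEQ_subseq_LIMSEQ[OF _ t(2), of "\<lambda>n. P i (s n)" "l i"] l that by (simp add: o_def)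
  moreover have "strict_mono (s \<circ> t)" using s t(2) by (rule strict_mono_o)
  ultimately show ?case
    using t l insert.hyps
    by (intro exI[of _ "s \<circ> t"] exI[of _ "l(j := l')"]) (auto simp: o_def)
qed

text \<open>Each \<open>U n\<close> removes closures of basic open sets that miss \<open>N\<close>.
  A point outside \<open>N\<close> has a basic neighbourhood whose closure misses \<open>N\<close>,
  by Hausdorff separation, so it cannot be approached through the \<open>U n\<close>. The index map
  \<open>s\<close> allows for subsequences.\<close>

lemma compact_neighbourhood_sequence:
  fixes N :: "'b::{t2_space, second_countable_topology} set"
  assumes N: "compact N"
  shows "\<exists>U :: nat \<Rightarrow> 'b set. (\<forall>n. open (U n) \<and> N \<subseteq> U n) \<and>
    (\<forall>z l s. strict_mono (s :: nat \<Rightarrow> nat) \<longrightarrow> (\<forall>n. z n \<in> U (s n)) \<longrightarrow> z \<longlonglongrightarrow> l \<longrightarrow> l \<in> N)"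
proof -
  obtain B :: "'b set set" where B: "countable B" "topological_basis B"
    using ex_countable_basis by blast
  \<comment> \<open>The empty set is added so that \<open>C\<close> is nonempty and can be
    enumerated by \<open>from_nat_into\<close>.\<close>
  define C where "C = insert {} {V\<in>B. closure V \<inter> N = {}}"
  have C: "countable C" "C \<noteq> {}" using B(1) by (auto simp: C_def)
  define V where "V = from_nat_into C"
  have V: "closure (V i) \<inter> N = {}" for i
    using from_nat_into[OF C(2), of i] by (auto simp: V_def C_def)
  define U where "U n = - (\<Union>i\<le>n. closure (V i))" for n :: nat
  have "l \<in> N" if s: "strict_mono (s :: nat \<Rightarrow> nat)" and z: "\<And>n. z n \<in> U (s n)" and lim: "z \<longlonglongrightarrow> l" for z l s
  proof (rule ccontr)
    assume "l \<notin> N"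
    then have disj: "disjnt {l} N" by simp
    have haus: "Hausdorff_space (euclidean :: 'b topology)"
      unfolding Hausdorff_space_def using hausdorff by (auto simp: disjnt_def)
    have cpt: "compactin euclidean {l}" "compactin euclidean N" using N by simp_all
    obtain A A' where "openin euclidean A" "openin euclidean A'" "{l} \<subseteq> A" "N \<subseteq> A'" "disjnt A A'"
      by (rule Hausdorff_space_compact_separation[OF haus cpt disj])
    then have A: "open A" "open A'" "l \<in> A" "N \<subseteq> A'" "disjnt A A'" by simp_all
    obtain W where W: "W \<in> B" "l \<in> W" "W \<subseteq> A" using topological_basisE[OF B(2) A(1,3)] by blast
    have "closure W \<subseteq> - A'"
      using W(3) A(2,5) by (intro closure_minimal) (auto simp: disjnt_def)
    then have "W \<in> C" using W(1) A(4) by (auto simp: C_def)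
    then obtain i where i: "V i = W" using from_nat_into_surj[OF C(1)] by (metis V_def)
    have "open W" using topological_basis_open[OF B(2) W(1)] .
    then have "\<forall>\<^sub>F n in sequentially. z n \<in> W" by (rule topological_tendstoD[OF lim _ W(2)])
    then obtain n where n: "n \<ge> i" "z n \<in> W" unfolding eventually_sequentially by (metis nle_le)
    \<comment> \<open>The sets \<open>U n\<close> decrease, so the closure removed at stage
      \<open>i\<close> is still missing at stage \<open>s n\<close>.\<close>
    have "i \<le> s n" using n(1) seq_suble[OF s, of n] by simp
    moreover have "z n \<in> closure (V i)" using n(2) i closure_subset by blast
    ultimately show False using z[of n] by (auto simp: U_def)
  qed
  moreover have "open (U n)" for n unfolding U_def by (intro open_Compl closed_UN) auto
  moreover have "N \<subseteq> U n" for n using V by (auto simp: U_def)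
  ultimately show ?thesis by (intro exI[of _ U]) blast
qed

context manageable_groupoid
begin

text \<open>Multiplication is continuous only on composable pairs; equality of domains along the
  sequence and in the limit keeps everything inside that set.\<close>

lemma tendsto_quot:
  assumes a: "a \<longlonglongrightarrow> a'" and b: "b \<longlonglongrightarrow> b'" and ab: "\<And>n. d (a n) = d (b n)" and ab': "d a' = d b'"
  shows "(\<lambda>n. quot (a n) (b n)) \<longlonglongrightarrow> quot a' b'"
proof -
  have "(\<lambda>n. ginv G (b n)) \<longlonglongrightarrow> ginv G b'"
    using continuous_on_tendsto_compose[OF continuous_inv b] by simp
  then have "(\<lambda>n. (a n, ginv G (b n))) \<longlonglongrightarrow> (a', ginv G b')" by (rule tendsto_Pair[OF a])
  from continuous_on_tendsto_compose[OF continuous_mult this] show ?thesis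
    using ab ab' by (simp add: quot_def)
qed

text \<open>With the cardinality fixed, a failing vector is a \<open>k\<close>-tuple in the compact
  set \<open>K \<times> cball 0 1\<close>, so failures over shrinking neighbourhoods subconverge.
  Their limit is a unit vector over a point of \<open>N\<close> with form at most
  \<open>c - e\<close>, which contradicts the bound \<open>c\<close> there.\<close>

lemma form_semicontinuity_card:
  assumes f: "continuous_on UNIV f" and K: "compact K" and N: "closed N" "N \<subseteq> X" "invariant G N"
    and low: "\<And>y F v. y \<in> N \<Longrightarrow> finite F \<Longrightarrow> F \<subseteq> fiberN G N y \<Longrightarrow>
      c * (\<Sum>a\<in>F. (cmod (v a))\<^sup>2) \<le> kform (gker f) F v"
    and e: "e > 0"
  shows "\<exists>U. open U \<and> N \<subseteq> U \<and> (\<forall>y F v. finite F \<longrightarrow> card F = k \<longrightarrow> F \<subseteq> K \<longrightarrow> F \<subseteq> fib y \<longrightarrow> r ` F \<subseteq> U \<longrightarrow>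
      (c - e) * (\<Sum>a\<in>F. (cmod (v a))\<^sup>2) \<le> kform (gker f) F v)"
proof (rule ccontr)
  assume neg: "\<not> ?thesis"
  have cN: "compact N" using compact_Int_closed[OF compact_X N(1)] N(2) by (simp add: Int_absorb1)
  obtain U :: "nat \<Rightarrow> 'g set" where U: "\<And>n. open (U n)" "\<And>n. N \<subseteq> U n"
    and Ulim: "\<forall>z l s. strict_mono (s :: nat \<Rightarrow> nat) \<longrightarrow> (\<forall>n. z n \<in> U (s n)) \<longrightarrow> z \<longlonglongrightarrow> l \<longrightarrow> l \<in> N"
    using compact_neighbourhood_sequence[OF cN] by blast
  \<comment> \<open>A failure over \<open>U n\<close>, enumerated and normalised to norm 1, so that
    the weights stay in the unit disc and the limit cannot be zero.\<close>
  define Q where "Q n \<epsilon> w y \<longleftrightarrow> inj_on \<epsilon> {..<k} \<and> (\<forall>i<k. \<epsilon> i \<in> K \<and> d (\<epsilon> i) = y \<and> r (\<epsilon> i) \<in> U n) \<and>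
      (\<Sum>i<k. (cmod (w i))\<^sup>2) = 1 \<and>
      (\<Sum>i<k. \<Sum>j<k. Re (cnj (w i) * f (quot (\<epsilon> i) (\<epsilon> j)) * w j)) \<le> c - e" for n \<epsilon> w y
  have "\<exists>\<epsilon> w y. Q n \<epsilon> w y" for n
  proof -
    have "\<not> (\<forall>y F v. finite F \<longrightarrow> card F = k \<longrightarrow> F \<subseteq> K \<longrightarrow> F \<subseteq> fib y \<longrightarrow> r ` F \<subseteq> U n \<longrightarrow>
      (c - e) * (\<Sum>a\<in>F. (cmod (v a))\<^sup>2) \<le> kform (gker f) F v)" (is "\<not> ?B")
    proof
      assume ?B
      with U have "open (U n) \<and> N \<subseteq> U n \<and> ?B" by (intro conjI)
      then have "\<exists>U. open U \<and> N \<subseteq> U \<and> (\<forall>y F v. finite F \<longrightarrow> card F = k \<longrightarrow> F \<subseteq> K \<longrightarrow> F \<subseteq> fib y \<longrightarrow> r ` F \<subseteq> U \<longrightarrow>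
        (c - e) * (\<Sum>a\<in>F. (cmod (v a))\<^sup>2) \<le> kform (gker f) F v)" by (rule exI)
      then show False using neg by contradiction
    qed
    then obtain y F v where F: "finite F" "card F = k" "F \<subseteq> K" "F \<subseteq> fib y" "r ` F \<subseteq> U n"
      and bad: "\<not> (c - e) * (\<Sum>a\<in>F. (cmod (v a))\<^sup>2) \<le> kform (gker f) F v"
      by blast
    obtain \<epsilon> where \<epsilon>: "bij_betw \<epsilon> {..<k} F"
      using ex_bij_betw_nat_finite[OF F(1)] F(2) by (auto simp: atLeast0LessThan)
    define t where "t = (\<Sum>a\<in>F. (cmod (v a))\<^sup>2)"
    \<comment> \<open>For the zero vector both sides of the inequality are 0, so it is no
      counterexample and normalisation is possible.\<close>
    have "t \<noteq> 0"
    proof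
      assume t0: "t = 0"
      then have "v a = 0" if "a \<in> F" for a
        using F(1) that by (simp add: t_def sum_nonneg_eq_0_iff)
      then have "kform (gker f) F v = 0" by (simp add: kform_def)
      with bad t0 show False by (simp add: t_def)
    qed
    then have t: "t > 0" by (simp add: t_def sum_nonneg less_le)
    define w where "w i = of_real (1 / sqrt t) * v (\<epsilon> i)" for i
    have \<epsilon>F: "\<epsilon> i \<in> F" if "i < k" for i using \<epsilon> that by (auto simp: bij_betw_def)
    have "(\<Sum>i<k. (cmod (w i))\<^sup>2) = (\<Sum>i<k. 1 / t * (cmod (v (\<epsilon> i)))\<^sup>2)"
      using t by (simp add: w_def norm_mult norm_divide power_mult_distrib power_divide)
    also have "\<dots> = 1 / t * (\<Sum>a\<in>F. (cmod (v a))\<^sup>2)"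
      by (simp only: sum_distrib_left sum.reindex_bij_betw[OF \<epsilon>, of "\<lambda>a. 1 / t * (cmod (v a))\<^sup>2"])
    also have "\<dots> = 1" using t by (simp add: t_def[symmetric])
    finally have w1: "(\<Sum>i<k. (cmod (w i))\<^sup>2) = 1" .
    have Re_of_real_mult: "Re (of_real x * z) = x * Re z" for x z by simp
    have "Re (cnj (w i) * f (quot (\<epsilon> i) (\<epsilon> j)) * w j)
        = 1 / t * Re (cnj (v (\<epsilon> i)) * gker f (\<epsilon> i) (\<epsilon> j) * v (\<epsilon> j))" for i j
    proof -
      have "complex_of_real (1 / sqrt t) * of_real (1 / sqrt t) = of_real (1 / t)"
        using t by (simp flip: of_real_mult)
      then have "cnj (w i) * f (quot (\<epsilon> i) (\<epsilon> j)) * w j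
          = of_real (1 / t) * (cnj (v (\<epsilon> i)) * gker f (\<epsilon> i) (\<epsilon> j) * v (\<epsilon> j))"
        by (simp add: w_def gker_def mult_ac flip: of_real_mult)
      then show ?thesis by (simp only: Re_of_real_mult)
    qed
    then have "(\<Sum>i<k. \<Sum>j<k. Re (cnj (w i) * f (quot (\<epsilon> i) (\<epsilon> j)) * w j)) = 1 / t * kform (gker f) F v"
      by (simp only: kform_reindex[OF \<epsilon>] sum_distrib_left)
    also have "\<dots> \<le> c - e"
      using bad t by (simp add: t_def[symmetric] field_simps)
    finally have form: "(\<Sum>i<k. \<Sum>j<k. Re (cnj (w i) * f (quot (\<epsilon> i) (\<epsilon> j)) * w j)) \<le> c - e" .
    have "\<forall>i<k. \<epsilon> i \<in> K \<and> d (\<epsilon> i) = y \<and> r (\<epsilon> i) \<in> U n"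
      using \<epsilon>F F(3-5) by (auto simp: fib_def)
    then have "Q n \<epsilon> w y"
      unfolding Q_def using w1 form bij_betw_imp_inj_on[OF \<epsilon>] by (intro conjI)
    then show ?thesis by blast
  qed
  then obtain \<epsilon> w y where Q: "\<And>n. Q n (\<epsilon> n) (w n) (y n)" by metis
  have inj: "inj_on (\<epsilon> n) {..<k}" for n using Q[of n] by (simp add: Q_def)
  have \<epsilon>: "\<epsilon> n i \<in> K" "d (\<epsilon> n i) = y n" "r (\<epsilon> n i) \<in> U n" if "i < k" for n i
    using Q[of n] that by (auto simp: Q_def)
  have w1: "(\<Sum>i<k. (cmod (w n i))\<^sup>2) = 1" for n using Q[of n] by (simp add: Q_def)
  have bad: "(\<Sum>i<k. \<Sum>j<k. Re (cnj (w n i) * f (quot (\<epsilon> n i) (\<epsilon> n j)) * w n j)) \<le> c - e" for n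
    using Q[of n] unfolding Q_def by blast
  have "w n i \<in> cball 0 1" if "i < k" for n i
  proof -
    have "(cmod (w n i))\<^sup>2 \<le> (\<Sum>i<k. (cmod (w n i))\<^sup>2)"
      by (rule member_le_sum) (use that in auto)
    then show ?thesis using w1[of n] by (simp add: power2_le_iff_abs_le abs_square_le_1)
  qed
  then obtain s l where s: "strict_mono (s :: nat \<Rightarrow> nat)"
    and l: "\<forall>i\<in>{..<k}. l i \<in> K \<times> cball 0 1 \<and> (\<lambda>n. (\<epsilon> (s n) i, w (s n) i)) \<longlonglongrightarrow> l i"
    using finite_family_subsequence[of "{..<k}" "K \<times> cball (0::complex) 1" "\<lambda>i n. (\<epsilon> n i, w n i)"]
      K \<epsilon>(1) by (auto simp: compact_Times)
  define a where "a i = fst (l i)" for i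
  define z where "z i = snd (l i)" for i
  have a: "(\<lambda>n. \<epsilon> (s n) i) \<longlonglongrightarrow> a i" and z: "(\<lambda>n. w (s n) i) \<longlonglongrightarrow> z i" if "i < k" for i
    using tendsto_fst[of _ "l i"] tendsto_snd[of _ "l i"] l that by (force simp: a_def z_def)+
  have da_lim: "(\<lambda>n. y (s n)) \<longlonglongrightarrow> d (a i)" if "i < k" for i
    using continuous_on_tendsto_compose[OF continuous_d a[OF that]] \<epsilon>(2)[OF that] by simp
  have raN: "r (a i) \<in> N" if "i < k" for i
    by (rule Ulim[rule_format, OF s, of "\<lambda>n. r (\<epsilon> (s n) i)"])
       (use \<epsilon>(3)[OF that] continuous_on_tendsto_compose[OF continuous_r a[OF that]] in simp_all)
  \<comment> \<open>For \<open>k = 0\<close> the weights would sum to 0 instead of 1; a first point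
    is needed to name the base \<open>y0\<close>.\<close>
  have k0: "0 < k" using w1[of 0] by (cases k) auto
  define y0 where "y0 = d (a 0)"
  have da: "d (a i) = y0" if "i < k" for i
    unfolding y0_def using LIMSEQ_unique[OF da_lim[OF that] da_lim[OF k0]] .
  \<comment> \<open>Invariance is applied to the inverse of \<open>a 0\<close>, whose domain
    \<open>r (a 0)\<close> lies in \<open>N\<close> and whose range is \<open>y0\<close>. Nothing
    was known about the base points \<open>y n\<close> themselves.\<close>
  have y0N: "y0 \<in> N"
    using N(3) raN[OF k0] unfolding invariant_def y0_def by (metis inv_simps(1,2))
  \<comment> \<open>Points of one fibre cannot merge in the limit: eventually both would lie in an
    open set on which \<open>d\<close> is injective. Hence the limit support again has
    \<open>k\<close> points and its form is the limit of the forms.\<close>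
  have inj_a: "inj_on a {..<k}"
  proof (rule inj_onI)
    fix i j assume ij: "i \<in> {..<k}" "j \<in> {..<k}" and eq: "a i = a j"
    obtain W where W: "open W" "a i \<in> W" "inj_on d W" using local_injectivity by blast
    have "\<forall>\<^sub>F n in sequentially. \<epsilon> (s n) i \<in> W" "\<forall>\<^sub>F n in sequentially. \<epsilon> (s n) j \<in> W"
      using topological_tendstoD[OF a W(1)] W(2) ij eq by auto
    then have "\<forall>\<^sub>F n in sequentially. \<epsilon> (s n) i \<in> W \<and> \<epsilon> (s n) j \<in> W" by (rule eventually_conj)
    then obtain n where n: "\<epsilon> (s n) i \<in> W" "\<epsilon> (s n) j \<in> W"
      using eventually_happens'[OF sequentially_bot] by blast
    have "d (\<epsilon> (s n) i) = d (\<epsilon> (s n) j)" using \<epsilon>(2) ij by simp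
    then have "\<epsilon> (s n) i = \<epsilon> (s n) j" using inj_onD[OF W(3)] n by blast
    then show "i = j" using inj_onD[OF inj] ij by blast
  qed
  let ?F = "a ` {..<k}"
  have bij: "bij_betw a {..<k} ?F" using inj_a by (rule bij_betw_imageI) simp
  define v where "v b = z (the_inv_into {..<k} a b)" for b
  have v: "v (a i) = z i" if "i < k" for i
    using that inj_a by (simp add: v_def the_inv_into_f_f)
  have "c * (\<Sum>b\<in>?F. (cmod (v b))\<^sup>2) \<le> kform (gker f) ?F v"
  proof (rule low[OF y0N])
    show "?F \<subseteq> fiberN G N y0" using raN da y0N by (auto simp: fiberN_def XiN_def)
  qed simp
  also have "kform (gker f) ?F v = (\<Sum>i<k. \<Sum>j<k. Re (cnj (z i) * f (quot (a i) (a j)) * z j))"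
    unfolding kform_reindex[OF bij] by (intro sum.cong refl) (simp add: v gker_def)
  also have "\<dots> \<le> c - e"
  proof (rule LIMSEQ_le_const2)
    show "(\<lambda>n. \<Sum>i<k. \<Sum>j<k. Re (cnj (w (s n) i) * f (quot (\<epsilon> (s n) i) (\<epsilon> (s n) j)) * w (s n) j))
        \<longlonglongrightarrow> (\<Sum>i<k. \<Sum>j<k. Re (cnj (z i) * f (quot (a i) (a j)) * z j))"
    proof (intro tendsto_sum tendsto_Re tendsto_mult tendsto_cnj z)
      fix i j assume ij: "i \<in> {..<k}" "j \<in> {..<k}"
      have "(\<lambda>n. quot (\<epsilon> (s n) i) (\<epsilon> (s n) j)) \<longlonglongrightarrow> quot (a i) (a j)"
        by (rule tendsto_quot) (use ij a da \<epsilon>(2) in auto)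
      then show "(\<lambda>n. f (quot (\<epsilon> (s n) i) (\<epsilon> (s n) j))) \<longlonglongrightarrow> f (quot (a i) (a j))"
        using continuous_on_tendsto_compose[OF f] by simp
    qed auto
  qed (use bad in blast)
  also have "(\<Sum>b\<in>?F. (cmod (v b))\<^sup>2) = (\<Sum>i<k. (cmod (z i))\<^sup>2)"
    unfolding sum.reindex_bij_betw[OF bij, symmetric] by (intro sum.cong refl) (simp add: v)
  also have "\<dots> = 1"
  proof (rule LIMSEQ_unique)
    show "(\<lambda>n. \<Sum>i<k. (cmod (w (s n) i))\<^sup>2) \<longlonglongrightarrow> (\<Sum>i<k. (cmod (z i))\<^sup>2)"
      by (intro tendsto_sum tendsto_power tendsto_norm z) auto
    show "(\<lambda>n. \<Sum>i<k. (cmod (w (s n) i))\<^sup>2) \<longlonglongrightarrow> 1" by (simp add: w1)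
  qed
  finally show False using e by simp
qed

text \<open>Inside \<open>K\<close> a fibre has at most \<open>p\<close> points, so only the
  cardinalities up to \<open>p\<close> occur and finitely many neighbourhoods are
  intersected.\<close>

lemma form_semicontinuity_compact:
  assumes f: "continuous_on UNIV f" and K: "compact K" and N: "closed N" "N \<subseteq> X" "invariant G N"
    and low: "\<And>y F v. y \<in> N \<Longrightarrow> finite F \<Longrightarrow> F \<subseteq> fiberN G N y \<Longrightarrow>
      c * (\<Sum>a\<in>F. (cmod (v a))\<^sup>2) \<le> kform (gker f) F v"
    and e: "e > 0"
  shows "\<exists>U. open U \<and> N \<subseteq> U \<and> (\<forall>y F v. finite F \<longrightarrow> F \<subseteq> K \<longrightarrow> F \<subseteq> fib y \<longrightarrow> r ` F \<subseteq> U \<longrightarrow>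
      (c - e) * (\<Sum>a\<in>F. (cmod (v a))\<^sup>2) \<le> kform (gker f) F v)"
proof -
  obtain p where p: "\<forall>x. finite {a\<in>K. d a = x} \<and> card {a\<in>K. d a = x} \<le> p"
    using compact_fiber_card[OF K] by blast
  have "\<forall>k. \<exists>U. open U \<and> N \<subseteq> U \<and>
      (\<forall>y F v. finite F \<longrightarrow> card F = k \<longrightarrow> F \<subseteq> K \<longrightarrow> F \<subseteq> fib y \<longrightarrow> r ` F \<subseteq> U \<longrightarrow>
        (c - e) * (\<Sum>a\<in>F. (cmod (v a))\<^sup>2) \<le> kform (gker f) F v)"
    by (intro allI form_semicontinuity_card[OF f K N _ e] low)
  from choice[OF this] obtain U where "\<forall>k. open (U k) \<and> N \<subseteq> U k \<and>
      (\<forall>y F v. finite F \<longrightarrow> card F = k \<longrightarrow> F \<subseteq> K \<longrightarrow> F \<subseteq> fib y \<longrightarrow> r ` F \<subseteq> U k \<longrightarrow>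
        (c - e) * (\<Sum>a\<in>F. (cmod (v a))\<^sup>2) \<le> kform (gker f) F v)" ..
  then have U: "\<And>k. open (U k)" "\<And>k. N \<subseteq> U k"
    "\<And>k. \<forall>y F v. finite F \<longrightarrow> card F = k \<longrightarrow> F \<subseteq> K \<longrightarrow> F \<subseteq> fib y \<longrightarrow> r ` F \<subseteq> U k \<longrightarrow>
        (c - e) * (\<Sum>a\<in>F. (cmod (v a))\<^sup>2) \<le> kform (gker f) F v"
    by auto
  show ?thesis
  proof (intro exI[of _ "\<Inter>k\<le>p. U k"] conjI allI impI)
    show "open (\<Inter>k\<le>p. U k)" using U(1) by (intro open_INT) auto
    show "N \<subseteq> (\<Inter>k\<le>p. U k)" using U(2) by blast
    fix y F and v :: "'g \<Rightarrow> complex"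
    assume F: "finite F" "F \<subseteq> K" "F \<subseteq> fib y" "r ` F \<subseteq> (\<Inter>k\<le>p. U k)"
    have "card F \<le> card {a\<in>K. d a = y}"
      using F(2,3) p by (intro card_mono) (auto simp: fib_def)
    then have "card F \<le> p" using p order_trans by blast
    then show "(c - e) * (\<Sum>a\<in>F. (cmod (v a))\<^sup>2) \<le> kform (gker f) F v"
      using F by (intro U(3)[rule_format, of F "card F" y]) auto
  qed
qed

text \<open>The tolerance is spent in quarters: passing from \<open>h\<close> to \<open>f\<close>,
  semicontinuity on \<open>K\<close>, localisation, and returning from \<open>f\<close> to
  \<open>h\<close>. Approximability is taken as the premise so that the same statement can be
  applied to the negated \<open>h\<close>.\<close>

lemma form_semicontinuity:
  assumes approx: "\<And>e. e > 0 \<Longrightarrow> \<exists>f\<in>Cc_on UNIV. \<forall>x F v. finite F \<longrightarrow> F \<subseteq> fib x \<longrightarrow>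
      \<bar>kform (gker f) F v - kform (gker h) F v\<bar> \<le> e * (\<Sum>a\<in>F. (cmod (v a))\<^sup>2)"
    and N: "closed N" "N \<subseteq> X" "invariant G N"
    and low: "\<And>y F v. y \<in> N \<Longrightarrow> finite F \<Longrightarrow> F \<subseteq> fiberN G N y \<Longrightarrow>
      c * (\<Sum>a\<in>F. (cmod (v a))\<^sup>2) \<le> kform (gker h) F v"
    and e: "e > 0"
  shows "\<exists>U. open U \<and> N \<subseteq> U \<and> (\<forall>M x F v. M \<subseteq> U \<longrightarrow> finite F \<longrightarrow> F \<subseteq> fiberN G M x \<longrightarrow>
      (c - e) * (\<Sum>a\<in>F. (cmod (v a))\<^sup>2) \<le> kform (gker h) F v)"
proof -
  obtain f where f: "f \<in> Cc_on UNIV" and fh: "\<forall>x F v. finite F \<longrightarrow> F \<subseteq> fib x \<longrightarrow>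
      \<bar>kform (gker f) F v - kform (gker h) F v\<bar> \<le> e/4 * (\<Sum>a\<in>F. (cmod (v a))\<^sup>2)"
    using approx[of "e/4"] e by auto
  have fc: "continuous_on UNIV f" using f by (simp add: Cc_on_def)
  have e4: "e / 4 > 0" using e by simp
  \<comment> \<open>\<open>K\<close> is obtained here for every possible set of ranges, with the
    constant that semicontinuity will provide; the neighbourhood \<open>U\<close> is chosen for this
    \<open>K\<close> afterwards.\<close>
  obtain K where K: "compact K" and loc: "\<forall>M.
    (\<forall>y F v. finite F \<longrightarrow> F \<subseteq> K \<longrightarrow> F \<subseteq> fib y \<longrightarrow> r ` F \<subseteq> M \<longrightarrow>
      (c - e/4 - e/4) * (\<Sum>a\<in>F. (cmod (v a))\<^sup>2) \<le> kform (gker f) F v) \<longrightarrow>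
    (\<forall>x F v. finite F \<longrightarrow> F \<subseteq> fib x \<longrightarrow> r ` F \<subseteq> M \<longrightarrow>
      (c - e/4 - e/4 - e/4) * (\<Sum>a\<in>F. (cmod (v a))\<^sup>2) \<le> kform (gker f) F v)"
    using localization[OF f e4, of "c - e/4 - e/4"] by blast
  have lowf: "(c - e/4) * (\<Sum>a\<in>F. (cmod (v a))\<^sup>2) \<le> kform (gker f) F v"
    if "y \<in> N" "finite F" "F \<subseteq> fiberN G N y" for y F v
  proof -
    have "F \<subseteq> fib y" using that(3) fiberN_subset by blast
    then show ?thesis
      using fh[rule_format, OF that(2), of y v] low[OF that, of v] unfolding left_diff_distrib by linarith
  qed
  have "\<exists>U. open U \<and> N \<subseteq> U \<and> (\<forall>y F v. finite F \<longrightarrow> F \<subseteq> K \<longrightarrow> F \<subseteq> fib y \<longrightarrow> r ` F \<subseteq> U \<longrightarrow>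
      (c - e/4 - e/4) * (\<Sum>a\<in>F. (cmod (v a))\<^sup>2) \<le> kform (gker f) F v)"
    by (rule form_semicontinuity_compact[OF fc K N _ e4]) (rule lowf)
  then obtain U where U: "open U" "N \<subseteq> U" and Uf: "\<forall>y F v. finite F \<longrightarrow> F \<subseteq> K \<longrightarrow> F \<subseteq> fib y \<longrightarrow> r ` F \<subseteq> U \<longrightarrow>
      (c - e/4 - e/4) * (\<Sum>a\<in>F. (cmod (v a))\<^sup>2) \<le> kform (gker f) F v"
    by blast
  have main: "(c - e) * (\<Sum>a\<in>F. (cmod (v a))\<^sup>2) \<le> kform (gker h) F v"
    if M: "M \<subseteq> U" and F: "finite F" "F \<subseteq> fiberN G M x" for M x F v
  proof -
    have Fx: "F \<subseteq> fib x" using F(2) fiberN_subset by blast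
    have rF: "r ` F \<subseteq> U" using F(2) M by (auto simp: fiberN_def XiN_def)
    have "(c - e/4 - e/4 - e/4) * (\<Sum>a\<in>F. (cmod (v a))\<^sup>2) \<le> kform (gker f) F v"
      by (rule loc[THEN spec, THEN mp, OF Uf, rule_format, OF F(1) Fx rF])
    then show ?thesis
      using fh[rule_format, OF F(1) Fx, of v] unfolding left_diff_distrib by linarith
  qed
  show ?thesis
    by (intro exI[of _ U] conjI allI impI U, rule main)
qed

end

section \<open>Suprema over families, the Fell topology and spectral bounds\<close>

lemma eq_SUP_if_approximated:
  fixes A :: "'b \<Rightarrow> real"
  assumes upper: "\<And>M. M \<in> T \<Longrightarrow> A M \<le> a" and approx: "\<And>e. e > 0 \<Longrightarrow> \<exists>M\<in>T. a - e \<le> A M"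
  shows "a = (SUP M\<in>T. A M)"
proof (rule antisym)
  have bdd: "bdd_above (A ` T)" using upper by (intro bdd_aboveI[of _ a]) auto
  show "a \<le> (SUP M\<in>T. A M)"
  proof (rule field_le_epsilon)
    fix e :: real assume "e > 0"
    then obtain M where M: "M \<in> T" "a - e \<le> A M" using approx by blast
    then show "a \<le> (SUP M\<in>T. A M) + e" using cSUP_upper[OF M(1) bdd] by linarith
  qed
  have "T \<noteq> {}" using approx[of 1] by auto
  then show "(SUP M\<in>T. A M) \<le> a" by (rule cSUP_least) (rule upper)
qed

lemma eq_INF_if_approximated:
  fixes A :: "'b \<Rightarrow> real"
  assumes lower: "\<And>M. M \<in> T \<Longrightarrow> a \<le> A M" and approx: "\<And>e. e > 0 \<Longrightarrow> \<exists>M\<in>T. A M \<le> a + e"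
  shows "a = (INF M\<in>T. A M)"
proof (rule antisym)
  have bdd: "bdd_below (A ` T)" using lower by (intro bdd_belowI[of _ a]) auto
  show "(INF M\<in>T. A M) \<le> a"
  proof (rule field_le_epsilon)
    fix e :: real assume "e > 0"
    then obtain M where M: "M \<in> T" "A M \<le> a + e" using approx by blast
    then show "(INF M\<in>T. A M) \<le> a + e" using cINF_lower[OF bdd M(1)] by linarith
  qed
  have "T \<noteq> {}" using approx[of 1] by auto
  then show "a \<le> (INF M\<in>T. A M)" by (rule cINF_greatest) (rule lower)
qed

context manageable_groupoid
begin

text \<open>Missing the compact set \<open>X - U\<close> is the same as being contained in
  \<open>U\<close>, so a basic Fell set with an empty family of hit conditions suffices.\<close>

lemma fell_accumulation_in_open:
  assumes acc: "fell_accumulation G TT N" and U: "open U" "N \<subseteq> U"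
  shows "\<exists>M\<in>TT. M \<noteq> N \<and> M \<subseteq> U"
proof -
  let ?S = "fell_basic G (X - U) {}"
  have adm: "fell_admissible G (X - U) {}"
    using compact_diff[OF compact_X U(1)] by (simp add: fell_admissible_def)
  have op: "fell_open G ?S"
    unfolding fell_open_def
  proof (intro conjI ballI)
    show "?S \<subseteq> closed_subsets G" by (auto simp: fell_basic_def)
    show "\<exists>K Us. fell_admissible G K Us \<and> A \<in> fell_basic G K Us \<and> fell_basic G K Us \<subseteq> ?S"
      if "A \<in> ?S" for A
      by (intro exI[of _ "X - U"] exI[of _ "{}"] conjI adm that order_refl)
  qed
  have "N \<in> closed_subsets G" using acc unfolding fell_accumulation_def by (rule conjunct1)
  then have N: "N \<in> ?S" using U(2) by (auto simp: fell_basic_def)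
  have all: "\<forall>S. fell_open G S \<and> N \<in> S \<longrightarrow> (\<exists>M\<in>TT. M \<noteq> N \<and> M \<in> S)"
    using acc unfolding fell_accumulation_def by (rule conjunct2)
  have "\<exists>M\<in>TT. M \<noteq> N \<and> M \<in> ?S" by (rule all[THEN spec, THEN mp, OF conjI[OF op N]])
  then obtain M where M: "M \<in> TT" "M \<noteq> N" "M \<in> ?S" by blast
  have "M \<subseteq> U" using M(3) by (auto simp: fell_basic_def closed_subsets_def)
  then show ?thesis using M(1,2) by blast
qed

lemma gker_hermitian:
  assumes h: "self_adjoint G h" and "d a = d b"
  shows "gker h b a = cnj (gker h a b)"
proof -
  have "h (quot b a) = cnj (h (ginv G (quot b a)))" using h unfolding self_adjoint_def by blast
  then show ?thesis using inv_quot[of b a] assms(2) by (simp add: gker_def)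
qed

text \<open>One constant for all fibres; it bounds the spectral infima and suprema over
  \<open>x\<close>, without which real \<open>INF\<close> and \<open>SUP\<close> would be default
  values.\<close>

lemma Cstar_form_bound:
  assumes h: "h \<in> Cstar G"
  shows "\<exists>C. \<forall>x F v. finite F \<longrightarrow> F \<subseteq> fib x \<longrightarrow>
    \<bar>kform (gker h) F v\<bar> \<le> C * (\<Sum>a\<in>F. (cmod (v a))\<^sup>2)"
proof -
  obtain f where f: "f \<in> Cc_on UNIV" and fh: "\<forall>x F v. finite F \<longrightarrow> F \<subseteq> fib x \<longrightarrow>
      \<bar>kform (gker f) F v - kform (gker h) F v\<bar> \<le> 1 * (\<Sum>a\<in>F. (cmod (v a))\<^sup>2)"
    using Cstar_form_approx[OF h zero_less_one] by blast
  obtain C where C: "\<forall>x F v. finite F \<longrightarrow> F \<subseteq> fib x \<longrightarrow>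
    \<bar>kform (gker f) F v\<bar> \<le> C * (\<Sum>a\<in>F. (cmod (v a))\<^sup>2)"
    using Cc_form_bound[OF f] by blast
  have main: "\<bar>kform (gker h) F v\<bar> \<le> (C + 1) * (\<Sum>a\<in>F. (cmod (v a))\<^sup>2)"
    if "finite F" "F \<subseteq> fib x" for x F v
    using fh[rule_format, OF that, of v] C[rule_format, OF that, of v] unfolding distrib_right by linarith
  show ?thesis by (intro exI[of _ "C + 1"] allI impI, rule main)
qed

lemma fiberN_nonempty: "N \<subseteq> X \<Longrightarrow> x \<in> N \<Longrightarrow> fiberN G N x \<noteq> {}"
proof -
  assume "N \<subseteq> X" "x \<in> N"
  then have "x \<in> fiberN G N x" using X_unit[of x] by (auto simp: fiberN_def XiN_def)
  then show ?thesis by blast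
qed

lemma spectral_bound_iffs:
  assumes h: "self_adjoint G h" and N: "closed N" "N \<subseteq> X" and x: "x \<in> N"
  shows "c \<le> inf_sp (fiberN G N x) (Hop G N h x) \<longleftrightarrow>
      (\<forall>F v. finite F \<and> F \<subseteq> fiberN G N x \<longrightarrow> c * (\<Sum>a\<in>F. (cmod (v a))\<^sup>2) \<le> kform (gker h) F v)"
    and "sup_sp (fiberN G N x) (Hop G N h x) \<le> c \<longleftrightarrow>
      (\<forall>F v. finite F \<and> F \<subseteq> fiberN G N x \<longrightarrow> kform (gker h) F v \<le> c * (\<Sum>a\<in>F. (cmod (v a))\<^sup>2))"
proof -
  have hC: "h \<in> Cstar G" using h by (simp add: self_adjoint_def)
  have herm: "gker h b a = cnj (gker h a b)" if "a \<in> fiberN G N x" "b \<in> fiberN G N x" for a b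
    by (rule gker_hermitian[OF h]) (use that in \<open>simp add: fiberN_def\<close>)
  note * = Hop_has_kernel[OF hC N x] fiberN_nonempty[OF N(2) x] herm
  show "c \<le> inf_sp (fiberN G N x) (Hop G N h x) \<longleftrightarrow>
      (\<forall>F v. finite F \<and> F \<subseteq> fiberN G N x \<longrightarrow> c * (\<Sum>a\<in>F. (cmod (v a))\<^sup>2) \<le> kform (gker h) F v)"
    by (rule le_inf_sp_kernel_iff[OF *])
  show "sup_sp (fiberN G N x) (Hop G N h x) \<le> c \<longleftrightarrow>
      (\<forall>F v. finite F \<and> F \<subseteq> fiberN G N x \<longrightarrow> kform (gker h) F v \<le> c * (\<Sum>a\<in>F. (cmod (v a))\<^sup>2))"
    by (rule sup_sp_kernel_le_iff[OF *])
qed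

text \<open>Combines the characterisation on single fibres with boundedness below. From here on
  spectra appear only through form inequalities.\<close>

lemma le_INF_inf_sp_iff:
  assumes h: "self_adjoint G h" and N: "closed N" "N \<subseteq> X" "N \<noteq> {}"
  shows "c \<le> (INF x\<in>N. inf_sp (fiberN G N x) (Hop G N h x)) \<longleftrightarrow>
    (\<forall>x\<in>N. \<forall>F v. finite F \<and> F \<subseteq> fiberN G N x \<longrightarrow> c * (\<Sum>a\<in>F. (cmod (v a))\<^sup>2) \<le> kform (gker h) F v)"
proof -
  have hC: "h \<in> Cstar G" using h by (simp add: self_adjoint_def)
  obtain C where C: "\<forall>x F v. finite F \<longrightarrow> F \<subseteq> fib x \<longrightarrow>
    \<bar>kform (gker h) F v\<bar> \<le> C * (\<Sum>a\<in>F. (cmod (v a))\<^sup>2)"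
    using Cstar_form_bound[OF hC] by blast
  have "- C \<le> inf_sp (fiberN G N x) (Hop G N h x)" if x: "x \<in> N" for x
    unfolding spectral_bound_iffs(1)[OF h N(1,2) x]
  proof (intro allI impI)
    fix F v assume F: "finite F \<and> F \<subseteq> fiberN G N x"
    then have "F \<subseteq> fib x" using fiberN_subset by blast
    then show "- C * (\<Sum>a\<in>F. (cmod (v a))\<^sup>2) \<le> kform (gker h) F v"
      using C[rule_format, of F x v] F by (simp add: abs_le_iff)
  qed
  then have "bdd_below ((\<lambda>x. inf_sp (fiberN G N x) (Hop G N h x)) ` N)"
    by (intro bdd_belowI[of _ "- C"]) auto
  from le_cINF_iff[OF N(3) this] show ?thesis
    using spectral_bound_iffs(1)[OF h N(1,2)] by simp
qed

lemma SUP_sup_sp_le_iff: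
  assumes h: "self_adjoint G h" and N: "closed N" "N \<subseteq> X" "N \<noteq> {}"
  shows "(SUP x\<in>N. sup_sp (fiberN G N x) (Hop G N h x)) \<le> c \<longleftrightarrow>
    (\<forall>x\<in>N. \<forall>F v. finite F \<and> F \<subseteq> fiberN G N x \<longrightarrow> kform (gker h) F v \<le> c * (\<Sum>a\<in>F. (cmod (v a))\<^sup>2))"
proof -
  have hC: "h \<in> Cstar G" using h by (simp add: self_adjoint_def)
  obtain C where C: "\<forall>x F v. finite F \<longrightarrow> F \<subseteq> fib x \<longrightarrow>
    \<bar>kform (gker h) F v\<bar> \<le> C * (\<Sum>a\<in>F. (cmod (v a))\<^sup>2)"
    using Cstar_form_bound[OF hC] by blast
  have "sup_sp (fiberN G N x) (Hop G N h x) \<le> C" if x: "x \<in> N" for x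
    unfolding spectral_bound_iffs(2)[OF h N(1,2) x]
  proof (intro allI impI)
    fix F v assume F: "finite F \<and> F \<subseteq> fiberN G N x"
    then have "F \<subseteq> fib x" using fiberN_subset by blast
    then show "kform (gker h) F v \<le> C * (\<Sum>a\<in>F. (cmod (v a))\<^sup>2)"
      using C[rule_format, of F x v] F by (simp add: abs_le_iff)
  qed
  then have "bdd_above ((\<lambda>x. sup_sp (fiberN G N x) (Hop G N h x)) ` N)"
    by (intro bdd_aboveI[of _ C]) auto
  from cSUP_le_iff[OF N(3) this] show ?thesis
    using spectral_bound_iffs(2)[OF h N(1,2)] by simp
qed

lemma gker_uminus: "gker (\<lambda>a. - h a) = (\<lambda>a b. - gker h a b)"
  by (simp add: gker_def fun_eq_iff)

lemma Cc_uminus: "f \<in> Cc_on S \<Longrightarrow> (\<lambda>a. - f a :: complex) \<in> Cc_on S"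
  by (auto simp: Cc_on_def intro: continuous_on_minus)

end

theorem theorem6p2:
  fixes G :: "('g::{t2_space, second_countable_topology}) groupoid"
    and TT :: "'g set set" and Xinf :: "'g set" and h :: "'g \<Rightarrow> complex"
  assumes "manageable G"
    and "fell_closed G TT"
    and "\<forall>N\<in>TT. tame G N"
    and "Xinf \<in> TT" and "invariant G Xinf"
    and "fell_accumulation G TT Xinf"
    and "\<forall>M\<in>TT - {Xinf}. Xinf \<subseteq> M"
    and "self_adjoint G h"
  shows "(INF x\<in>Xinf. inf_sp (fiberN G Xinf x) (Hop G Xinf h x))
           = (SUP M\<in>TT - {Xinf}. INF y\<in>M. inf_sp (fiberN G M y) (Hop G M h y))
         \<and> (SUP x\<in>Xinf. sup_sp (fiberN G Xinf x) (Hop G Xinf h x))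
           = (INF M\<in>TT - {Xinf}. SUP y\<in>M. sup_sp (fiberN G M y) (Hop G M h y))"
proof -
  interpret manageable_groupoid G by unfold_locales (rule assms(1))
  note acc = assms(6) and h = assms(8)
  have hC: "h \<in> Cstar G" using h by (simp add: self_adjoint_def)
  have cl: "closed M" "M \<subseteq> unit_space G" if "M \<in> TT" for M
    using assms(3) that by (auto simp: tame_def closed_subsets_def)
  note clX = cl[OF assms(4)]
  \<comment> \<open>The unit space is compact, so the empty set is isolated in the Fell topology:
    the lemma with empty \<open>U\<close> would give a member of \<open>TT\<close> that is empty and
    yet differs from \<open>Xinf\<close>.\<close>
  have ne: "Xinf \<noteq> {}"
    using fell_accumulation_in_open[OF acc open_empty] by auto
  have T0: "closed M" "M \<subseteq> unit_space G" "M \<noteq> {}" "Xinf \<subseteq> M" if "M \<in> TT - {Xinf}" for M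
    using that cl ne assms(7) by auto
  have fib_mono: "fiberN G Xinf x \<subseteq> fiberN G M x" if "M \<in> TT - {Xinf}" for M x
    using T0(4)[OF that] by (auto simp: fiberN_def XiN_def)
  note inf_iff = le_INF_inf_sp_iff[OF h] and sup_iff = SUP_sup_sp_le_iff[OF h]
  let ?A = "\<lambda>M. INF y\<in>M. inf_sp (fiberN G M y) (Hop G M h y)"
  let ?B = "\<lambda>M. SUP y\<in>M. sup_sp (fiberN G M y) (Hop G M h y)"
  have "?A Xinf = (SUP M\<in>TT - {Xinf}. ?A M)"
  proof (rule eq_SUP_if_approximated)
    fix M assume M: "M \<in> TT - {Xinf}"
    have "\<forall>x\<in>M. \<forall>F v. finite F \<and> F \<subseteq> fiberN G M x \<longrightarrow>
        ?A M * (\<Sum>a\<in>F. (cmod (v a))\<^sup>2) \<le> kform (gker h) F v"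
      by (rule inf_iff[OF T0(1-3)[OF M], THEN iffD1, OF order_refl])
    \<comment> \<open>A finitely supported vector over \<open>Xinf\<close> is also one over
      \<open>M\<close>, at the same base point and with the same form.\<close>
    then show "?A M \<le> ?A Xinf"
      unfolding inf_iff[OF clX ne] using T0(4)[OF M] fib_mono[OF M] by blast
  next
    fix e :: real assume e: "e > 0"
    have low: "?A Xinf * (\<Sum>a\<in>F. (cmod (v a))\<^sup>2) \<le> kform (gker h) F v"
      if "y \<in> Xinf" "finite F" "F \<subseteq> fiberN G Xinf y" for y F v
      using inf_iff[OF clX ne, THEN iffD1, OF order_refl] that by blast
    have "\<exists>U. open U \<and> Xinf \<subseteq> U \<and> (\<forall>M x F v. M \<subseteq> U \<longrightarrow> finite F \<longrightarrow> F \<subseteq> fiberN G M x \<longrightarrow>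
        (?A Xinf - e) * (\<Sum>a\<in>F. (cmod (v a))\<^sup>2) \<le> kform (gker h) F v)"
      by (rule form_semicontinuity[OF Cstar_form_approx[OF hC] clX assms(5) _ e]) (assumption, rule low)
    then obtain U where U: "open U" "Xinf \<subseteq> U"
      and Ub: "\<forall>M x F v. M \<subseteq> U \<longrightarrow> finite F \<longrightarrow> F \<subseteq> fiberN G M x \<longrightarrow>
        (?A Xinf - e) * (\<Sum>a\<in>F. (cmod (v a))\<^sup>2) \<le> kform (gker h) F v"
      by blast
    obtain M where M: "M \<in> TT" "M \<noteq> Xinf" "M \<subseteq> U"
      using fell_accumulation_in_open[OF acc U] by blast
    then have M': "M \<in> TT - {Xinf}" by simp
    have "?A Xinf - e \<le> ?A M"
      unfolding inf_iff[OF T0(1-3)[OF M']] using Ub M(3) by blast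
    then show "\<exists>M\<in>TT - {Xinf}. ?A Xinf - e \<le> ?A M" using M' by blast
  qed
  moreover have "?B Xinf = (INF M\<in>TT - {Xinf}. ?B M)"
  proof (rule eq_INF_if_approximated)
    fix M assume M: "M \<in> TT - {Xinf}"
    have "\<forall>x\<in>M. \<forall>F v. finite F \<and> F \<subseteq> fiberN G M x \<longrightarrow>
        kform (gker h) F v \<le> ?B M * (\<Sum>a\<in>F. (cmod (v a))\<^sup>2)"
      by (rule sup_iff[OF T0(1-3)[OF M], THEN iffD1, OF order_refl])
    then show "?B Xinf \<le> ?B M"
      unfolding sup_iff[OF clX ne] using T0(4)[OF M] fib_mono[OF M] by blast
  next
    fix e :: real assume e: "e > 0"
    \<comment> \<open>Upper bounds for \<open>h\<close> become lower bounds for \<open>?h\<close>,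
      whose kernel is the negated one and whose approximants are the negated approximants of
      \<open>h\<close>.\<close>
    let ?h = "\<lambda>a. - h a"
    have low: "- ?B Xinf * (\<Sum>a\<in>F. (cmod (v a))\<^sup>2) \<le> kform (gker ?h) F v"
      if "y \<in> Xinf" "finite F" "F \<subseteq> fiberN G Xinf y" for y F v
      using sup_iff[OF clX ne, THEN iffD1, OF order_refl, rule_format, of y F v] that
      by (simp add: gker_uminus kform_uminus)
    have approx: "\<exists>f\<in>Cc_on UNIV. \<forall>x F v. finite F \<longrightarrow> F \<subseteq> fib x \<longrightarrow>
      \<bar>kform (gker f) F v - kform (gker ?h) F v\<bar> \<le> t * (\<Sum>a\<in>F. (cmod (v a))\<^sup>2)" if t: "t > 0" for t
    proof -
      obtain f where f: "f \<in> Cc_on UNIV" and fh: "\<forall>x F v. finite F \<longrightarrow> F \<subseteq> fib x \<longrightarrow>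
        \<bar>kform (gker f) F v - kform (gker h) F v\<bar> \<le> t * (\<Sum>a\<in>F. (cmod (v a))\<^sup>2)"
        using Cstar_form_approx[OF hC t] by blast
      show ?thesis
        by (rule bexI[OF _ Cc_uminus[OF f]])
           (use fh in \<open>simp add: gker_uminus kform_uminus abs_minus_commute\<close>)
    qed
    have "\<exists>U. open U \<and> Xinf \<subseteq> U \<and> (\<forall>M x F v. M \<subseteq> U \<longrightarrow> finite F \<longrightarrow> F \<subseteq> fiberN G M x \<longrightarrow>
        (- ?B Xinf - e) * (\<Sum>a\<in>F. (cmod (v a))\<^sup>2) \<le> kform (gker ?h) F v)"
    proof (rule form_semicontinuity[OF _ clX assms(5) _ e])
      show "\<exists>f\<in>Cc_on UNIV. \<forall>x F v. finite F \<longrightarrow> F \<subseteq> fib x \<longrightarrow>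
        \<bar>kform (gker f) F v - kform (gker ?h) F v\<bar> \<le> t * (\<Sum>a\<in>F. (cmod (v a))\<^sup>2)" if "t > 0" for t
        by (rule approx[OF that])
    qed (rule low)
    then obtain U where U: "open U" "Xinf \<subseteq> U"
      and Ub: "\<forall>M x F v. M \<subseteq> U \<longrightarrow> finite F \<longrightarrow> F \<subseteq> fiberN G M x \<longrightarrow>
        (- ?B Xinf - e) * (\<Sum>a\<in>F. (cmod (v a))\<^sup>2) \<le> kform (gker ?h) F v"
      by blast
    obtain M where M: "M \<in> TT" "M \<noteq> Xinf" "M \<subseteq> U"
      using fell_accumulation_in_open[OF acc U] by blast
    then have M': "M \<in> TT - {Xinf}" by simp
    have "?B M \<le> ?B Xinf + e"
      unfolding sup_iff[OF T0(1-3)[OF M']]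
    proof (intro ballI allI impI)
      fix x F v assume "x \<in> M" and F: "finite F \<and> F \<subseteq> fiberN G M x"
      then have "(- ?B Xinf - e) * (\<Sum>a\<in>F. (cmod (v a))\<^sup>2) \<le> - kform (gker h) F v"
        using Ub[rule_format, OF M(3), of F x v] by (simp add: gker_uminus kform_uminus)
      then show "kform (gker h) F v \<le> (?B Xinf + e) * (\<Sum>a\<in>F. (cmod (v a))\<^sup>2)"
        unfolding left_diff_distrib distrib_right by linarith
    qed
    then show "\<exists>M\<in>TT - {Xinf}. ?B M \<le> ?B Xinf + e" using M' by blast
  qed
  ultimately show ?thesis ..
qed

end
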